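(* Let $r\ge1$ and let $\vec a,\vec b\in(-1,\infty)^r$ satisfy $b_j>a_i$ if $i\le j$ and $b_j>a_i-1$ if $i>j$ (for all $1\le i,j\le r$). Then the asymptotic zero distribution of $P_{\vec n}(x)$, for multi-indices $\vec n$ on the step-line as $|\vec n|\to\infty$, is given by $$\Big(\big(1-\tfrac1r\big)\delta_1+\tfrac1r\,\mu_{r-1}\Big)^{\boxtimes r}.$$
   Context: A multi-index $\vec n\in\mathbb Z_{\ge0}^r$ is on the step-line if $n_1\ge n_2\ge\dots\ge n_r\ge n_1-1$; $|\vec n|=n_1+\dots+n_r$. $P_{\vec n}$ is (up to a non-zero constant) the polynomial $$P_{\vec n}(x)={}_{r+1}F_r\left(\begin{array}{c}-|\vec n|,\ b_1+n_1+1,\dots,b_r+n_r+1\\ a_1+1,\dots,a_r+1\end{array};x\right).$$ It is the type II multiple orthogonal polynomial for the weights $w_1,\dots,w_r$ on $(0,1)$, where $w_j$ has Mellin transform $\int_0^1x^{s-1}w_j(x)dx=\frac{1}{s+b_j}\prod_{i=1}^r\Gamma(s+a_i)/\Gamma(s+b_i)$, i.e. $\int_0^1P_{\vec n}(x)x^kw_j(x)dx=0$ for $0\le k\le n_j-1$, $1\le j\le r$. The asymptotic zero distribution of a family of polynomials is the weak limit of their normalized zero counting measures (zeros counted with multiplicity). For $\alpha\ge0$, $\mu_\alpha$ (the deformed arcsine distribution) is the probability measure with density $$u_\alpha(x)=\frac{\sqrt{4(\alpha+1)x-(\alpha+2)^2x^2}}{2\pi x(1-x)},\qquad 0<x<\frac{4(\alpha+1)}{(\alpha+2)^2}.$$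 $\delta_1$ is the Dirac mass at $1$. $\boxtimes$ is the free multiplicative convolution of probability measures on $[0,\infty)$ (with $S$-transforms satisfying $S_{\mu\boxtimes\nu}(z)=S_\mu(z)S_\nu(z)$, where $S_\mu(z)=m_\mu^{-1}(z)\frac{z+1}{z}$, $m_\mu(z)=\sum_{k\ge1}z^k\int x^kd\mu(x)$ and $m_\mu^{-1}$ is the compositional inverse), and $\mu^{\boxtimes r}$ is the $r$-fold free multiplicative convolution of $\mu$ with itself. *)

theory Defs
  imports "HOL-Probability.Probability" "HOL-Computational_Algebra.Computational_Algebra"
begin

(* Vectors of length r (the parameters a, b and the multi-indices n) are functions on nat of
   which only the values at 1, ..., r are used. *)

definition mi_size :: "nat \<Rightarrow> (nat \<Rightarrow> nat) \<Rightarrow> nat" where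
  "mi_size r n = (\<Sum>j=1..r. n j)"

(* n_r >= n_1 - 1 is written without truncated subtraction. *)
definition on_step_line :: "nat \<Rightarrow> (nat \<Rightarrow> nat) \<Rightarrow> bool" where
  "on_step_line r n \<longleftrightarrow> (\<forall>j\<in>{1..<r}. n (Suc j) \<le> n j) \<and> n 1 \<le> n r + 1"

(* The hypergeometric series with upper parameters -N, us and lower parameters ls; it stops at
   degree N because pochhammer (- N) k = 0 for k > N. *)
definition hypergeo_poly :: "nat \<Rightarrow> real list \<Rightarrow> real list \<Rightarrow> real poly" where
  "hypergeo_poly N us ls = (\<Sum>k\<le>N. monom (fps_hypergeo (- real N # us) ls 1 $ k) k)"

definition P_poly ::
  "nat \<Rightarrow> (nat \<Rightarrow> real) \<Rightarrow> (nat \<Rightarrow> real) \<Rightarrow> (nat \<Rightarrow> nat) \<Rightarrow> real poly" where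
  "P_poly r a b n = hypergeo_poly (mi_size r n)
     (map (\<lambda>j. b j + real (n j) + 1) [1..<Suc r]) (map (\<lambda>i. a i + 1) [1..<Suc r])"

(* All complex zeros are counted, with multiplicity. The value for constant polynomials
   is irrelevant. *)
definition zero_measure :: "real poly \<Rightarrow> complex measure" where
  "zero_measure p =
     distr (measure_pmf (pmf_of_multiset (proots (map_poly complex_of_real p)))) borel (\<lambda>z. z)"

(* The library's weak_conv_m is stated through distribution functions and only covers measures
   on the real line. *)
definition weakly_converges ::
  "(nat \<Rightarrow> 'a::topological_space measure) \<Rightarrow> 'a measure \<Rightarrow> bool" where
  "weakly_converges M L \<longleftrightarrow>
     (\<forall>f :: 'a \<Rightarrow> real. continuous_on UNIV f \<and> bounded (range f) \<longrightarrow>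
        (\<lambda>m. \<integral>x. f x \<partial>M m) \<longlonglongrightarrow> (\<integral>x. f x \<partial>L))"

definition deformed_arcsine_density :: "real \<Rightarrow> real \<Rightarrow> real" where
  "deformed_arcsine_density \<alpha> x =
     (if 0 < x \<and> x < 4 * (\<alpha> + 1) / (\<alpha> + 2)\<^sup>2
      then sqrt (4 * (\<alpha> + 1) * x - (\<alpha> + 2)\<^sup>2 * x\<^sup>2) / (2 * pi * x * (1 - x)) else 0)"

definition deformed_arcsine :: "real \<Rightarrow> real measure" where
  "deformed_arcsine \<alpha> = density lborel (\<lambda>x. ennreal (deformed_arcsine_density \<alpha> x))"

definition mixture :: "real \<Rightarrow> real measure \<Rightarrow> real measure \<Rightarrow> real measure" where
  "mixture t \<mu> \<nu> = measure_of UNIV (sets borel)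
     (\<lambda>A. ennreal (1 - t) * emeasure \<mu> A + ennreal t * emeasure \<nu> A)"

(* Probability measures with compact support in [0, \<infinity>): here the moment series converges near 0
   and determines the measure. *)
definition compact_nonneg_prob :: "real measure \<Rightarrow> bool" where
  "compact_nonneg_prob \<mu> \<longleftrightarrow>
     prob_space \<mu> \<and> sets \<mu> = sets borel \<and> (\<exists>c. AE x in \<mu>. 0 \<le> x \<and> x \<le> c)"

definition moment_series :: "real measure \<Rightarrow> real fps" where
  "moment_series \<mu> = Abs_fps (\<lambda>k. if k = 0 then 0 else \<integral>x. x ^ k \<partial>\<mu>)"

(* The compositional inverse exists when the mean is nonzero, that is, for \<mu> other than the Dirac
   mass at 0. For the latter the moment series is 0 and fps_inv 0 = 0, so the value here is 0. *)
definition S_transform :: "real measure \<Rightarrow> real fps" where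
  "S_transform \<mu> = (fps_inv (moment_series \<mu>) * (fps_X + 1)) / fps_X"

(* There is at most one such measure, since the S-transform determines the moments. *)
definition free_mult_conv :: "real measure \<Rightarrow> real measure \<Rightarrow> real measure"
    (infixl "\<boxtimes>" 70) where
  "\<mu> \<boxtimes> \<nu> = (THE \<rho>. compact_nonneg_prob \<rho> \<and>
      S_transform \<rho> = S_transform \<mu> * S_transform \<nu>)"

(* For r = 0 this is the unit of the convolution; for r = 1 it is \<mu>. *)
primrec free_mult_power :: "real measure \<Rightarrow> nat \<Rightarrow> real measure" where
  "free_mult_power \<mu> 0 = return borel 1"
| "free_mult_power \<mu> (Suc k) = free_mult_power \<mu> k \<boxtimes> \<mu>"

end

theory Submission
  imports Defs "HOL-Real_Asymp.Real_Asymp"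
begin

unbundle no vec_syntax

text \<open>Let \<open>h\<close> be the generating function, in \<open>1/x\<close>, of the normalized power sums of the zeros.
  The hypergeometric differential equation, divided by \<open>N^(r+1) P\<close> with \<open>N = |n|\<close>, is a polynomial
  relation between \<open>h\<close>, its Euler derivatives and \<open>1/N\<close>. As \<open>N \<rightarrow> \<infinity>\<close> the derivatives drop out, all
  moments converge, and \<open>w = h - 1\<close> satisfies \<open>X (1 + w)^(r+1) = w (1 + w + 1/r)^r\<close> in the limit; this says
  that the \<open>S\<close>-transform of the limit is \<open>((z + 1 + 1/r) / (z + 1))^r\<close>. A direct computation of
  the moments of the deformed arcsine law shows that the base of this power is the \<open>S\<close>-transform
  of the mixture. The convolution powers exist because the analogous polynomials with
  integral parameters have all their zeros in \<open>(0, 1]\<close>.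

  Moments determine the weak limit because all zeros of \<open>P\<close> are positive: \<open>P\<close> is the end of a
  chain of hypergeometric polynomials with \<open>g(m) = g(m+1) - c(m) x g(m+r+1)\<close>, the contiguous
  relations of a branched continued fraction, and the conditions on the parameters make
  \<open>c(m) \<ge> 0\<close>. For \<open>z\<close> in the upper half-plane, induction along the chain keeps the arguments of any
  \<open>r + 1\<close> consecutive \<open>g(m)(z)\<close> in an angle smaller than \<open>\<pi>\<close>, so that no \<open>g(m)\<close> vanishes there.\<close>

section \<open>Zeros of branched recurrences\<close>

text \<open>The zeros are counted in the plane, where power sums test only holomorphic functions and
  fix no limit; for real zeros they are moments on the line. No uniform bound on the zeros of
  \<open>P\<close> is established: convergence of a high even moment controls the tails instead.

  The step-line enters twice. The numbers \<open>r n_j + j - N\<close> run through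
  \<open>1..r\<close>, and listing the upper parameters by these positions lets the two families of
  inequalities decide every sign along the chain. The same bounds give \<open>n_j / N\<close> the
  limit \<open>1/r\<close>, the origin of that constant in the limiting equation.

  Since the convolution is a definite description, an identity between S-transforms proves nothing
  until a measure is exhibited, and this for each intermediate power. The exponent is therefore
  decoupled from \<open>r\<close>: with \<open>q\<close> upper parameters growing like
  \<open>N/r\<close>, the limit has the \<open>q\<close>-th power as its S-transform. Integral
  parameters make such polynomials obtainable from \<open>(1 - x)^N\<close> by operators
  \<open>x d/dx + i\<close>, each of which keeps the zeros in \<open>(0, 1]\<close>.\<close>

lemma cis_cone:
  assumes "0 < \<rho>" "0 \<le> \<sigma>" "\<alpha> \<le> \<beta>" "\<beta> < \<alpha> + pi"
  shows "\<exists>\<gamma>. \<alpha> \<le> \<gamma> \<and> \<gamma> \<le> \<beta> \<and>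
     (\<exists>\<tau>>0. complex_of_real \<rho> * cis \<beta> + complex_of_real \<sigma> * cis \<alpha> = complex_of_real \<tau> * cis \<gamma>)"
proof (cases "\<alpha> = \<beta>")
  case True
  have "complex_of_real \<rho> * cis \<beta> + complex_of_real \<sigma> * cis \<alpha> = complex_of_real (\<rho> + \<sigma>) * cis \<beta>"
    using True by (simp add: algebra_simps)
  moreover have "0 < \<rho> + \<sigma>" using assms by simp
  ultimately show ?thesis using True by blast
next
  case False
  define \<delta> where "\<delta> = \<beta> - \<alpha>"
  have \<delta>: "0 < \<delta>" "\<delta> < pi" using False assms by (auto simp: \<delta>_def)
  \<comment> \<open>Rotating either ray onto the positive real axis leaves the sum on a known side
    of that axis; the two signs of the imaginary part bound the argument from below and from
    above.\<close>
  define w where "w = complex_of_real \<rho> * cis \<delta> + complex_of_real \<sigma>"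
  have imw: "Im w > 0" using \<delta> assms(1) by (simp add: w_def sin_gt_zero)
  then have w0: "w \<noteq> 0" by auto
  have arg: "0 < Arg w" "Arg w < pi" using imw Arg_lt_pi by blast+
  have weq: "w = complex_of_real (cmod w) * cis (Arg w)"
    using w0 by (metis Arg_eq cis_conv_exp)
  have "Im (w * cis (- \<delta>)) = Im (complex_of_real \<rho> + complex_of_real \<sigma> * cis (- \<delta>))"
    by (simp add: w_def algebra_simps cis_mult)
  also have "\<dots> = - \<sigma> * sin \<delta>" by simp
  also have "\<dots> \<le> 0" using assms(2) \<delta> by (simp add: sin_ge_zero)
  finally have "Im (w * cis (- \<delta>)) \<le> 0" .
  moreover have "w * cis (- \<delta>) = complex_of_real (cmod w) * cis (Arg w - \<delta>)"
    by (subst (1) weq) (simp add: mult.assoc cis_mult)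
  ultimately have "cmod w * sin (Arg w - \<delta>) \<le> 0" by simp
  then have "sin (Arg w - \<delta>) \<le> 0" using w0 by (simp add: mult_le_0_iff)
  then have le: "Arg w \<le> \<delta>"
    using arg \<delta> sin_gt_zero[of "Arg w - \<delta>"] by (metis diff_ge_0_iff_ge diff_le_eq le_add_same_cancel1 less_eq_real_def linorder_not_le diff_gt_0_iff_gt dual_order.strict_trans2)
  have "complex_of_real \<rho> * cis \<beta> + complex_of_real \<sigma> * cis \<alpha> = w * cis \<alpha>"
    by (simp add: w_def \<delta>_def algebra_simps cis_mult)
  also have "\<dots> = complex_of_real (cmod w) * cis (Arg w + \<alpha>)"
    by (subst (1) weq) (simp add: mult.assoc cis_mult)
  finally show ?thesis using le arg w0 by (intro exI[of _ "Arg w + \<alpha>"]) (auto simp: \<delta>_def)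
qed

text \<open>The phases \<open>\<phi> k\<close> are real numbers rather than classes modulo
  \<open>2 pi\<close>, so they can be compared along the chain. Descending from \<open>M\<close>,
  two facts persist: phases do not decrease with the index, and over \<open>r\<close> steps they
  grow by at most \<open>pi - \<theta>\<close>. Hence the phase \<open>\<alpha>\<close> of
  \<open>- z g(m + r + 1)\<close> lies below that of \<open>g(m + 1)\<close> by less than
  \<open>pi\<close>, and \<open>g m\<close> falls into the cone between them.\<close>

lemma branched_recurrence_nonzero_upper:
  fixes z :: complex and g :: "nat \<Rightarrow> complex" and c :: "nat \<Rightarrow> real"
  assumes z: "Im z > 0" and r: "r \<ge> 1"
    and rec: "\<And>m. m < M \<Longrightarrow> g m = g (m + 1) - complex_of_real (c m) * z * g (m + r + 1)"
    and c: "\<And>m. m < M \<Longrightarrow> 0 \<le> c m"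
    and one: "\<And>m. m \<ge> M \<Longrightarrow> g m = 1"
  shows "g 0 \<noteq> 0"
proof -
  define \<theta> where "\<theta> = Arg z"
  have \<theta>: "0 < \<theta>" "\<theta> < pi" using z Arg_lt_pi by (auto simp: \<theta>_def)
  have zeq: "z = complex_of_real (cmod z) * cis \<theta>"
    using z by (metis Arg_eq cis_conv_exp \<theta>_def zero_complex.simps(2) less_irrefl)
  have "\<exists>\<phi>. \<forall>k\<ge>m. (\<exists>\<tau>>0. g k = complex_of_real \<tau> * cis (\<phi> k)) \<and> \<phi> k \<le> \<phi> (k + 1)
           \<and> \<phi> (k + r) + \<theta> - pi \<le> \<phi> k" if "m \<le> M" for m
    using that
  proof (induction rule: inc_induct)
    case base
    then show ?case using one \<theta> by (intro exI[of _ "\<lambda>_. 0"]) (auto intro!: exI[of _ 1])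
  next
    case (step m)
    then obtain \<phi> where \<phi>: "\<And>k. k \<ge> Suc m \<Longrightarrow> \<exists>\<tau>>0. g k = complex_of_real \<tau> * cis (\<phi> k)"
      "\<And>k. k \<ge> Suc m \<Longrightarrow> \<phi> k \<le> \<phi> (k + 1)"
      "\<And>k. k \<ge> Suc m \<Longrightarrow> \<phi> (k + r) + \<theta> - pi \<le> \<phi> k" by metis
    have mono: "\<phi> (m + 1) \<le> \<phi> (m + 1 + j)" for j
      by (induction j) (use \<phi>(2) in \<open>auto intro: order_trans\<close>)
    obtain \<tau>1 where \<tau>1: "\<tau>1 > 0" "g (m + 1) = complex_of_real \<tau>1 * cis (\<phi> (m + 1))"
      using \<phi>(1)[of "m + 1"] by auto
    obtain \<tau>2 where \<tau>2: "\<tau>2 > 0" "g (m + r + 1) = complex_of_real \<tau>2 * cis (\<phi> (m + r + 1))"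
      using \<phi>(1)[of "m + r + 1"] by auto
    define \<alpha> where "\<alpha> = \<phi> (m + r + 1) + \<theta> - pi"
    have "g m = complex_of_real \<tau>1 * cis (\<phi> (m + 1))
        + complex_of_real (c m * cmod z * \<tau>2) * cis \<alpha>"
    proof -
      have "cis \<alpha> = - (cis (\<phi> (m + r + 1)) * cis \<theta>)"
        unfolding \<alpha>_def by (simp flip: cis_divide add: cis_mult)
      then show ?thesis using rec[OF step(2)] by (subst (asm) zeq) (simp add: \<tau>1(2)[simplified] \<tau>2(2)[simplified] mult_ac)
    qed
    moreover have "\<alpha> \<le> \<phi> (m + 1)" using \<phi>(3)[of "m + 1"] by (simp add: \<alpha>_def add_ac)
    moreover have "\<phi> (m + 1) < \<alpha> + pi" using mono[of r] \<theta> by (simp add: \<alpha>_def add_ac)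
    moreover have "0 \<le> c m * cmod z * \<tau>2" using c[OF step(2)] \<tau>2 by simp
    ultimately obtain \<gamma> \<tau> where \<gamma>: "\<alpha> \<le> \<gamma>" "\<gamma> \<le> \<phi> (m + 1)" "\<tau> > 0" "g m = complex_of_real \<tau> * cis \<gamma>"
      using cis_cone[OF \<tau>1(1)] by metis
    have "\<phi> (m + r) \<le> \<phi> (m + r + 1)" using \<phi>(2)[of "m + r"] r by simp
    then have "\<phi> (m + r) + \<theta> - pi \<le> \<gamma>" using \<gamma>(1) by (simp add: \<alpha>_def)
    note le = this
    show ?case
    proof (intro exI[of _ "\<phi>(m := \<gamma>)"] allI impI)
      fix k assume "m \<le> k"
      show "(\<exists>\<tau>>0. g k = complex_of_real \<tau> * cis ((\<phi>(m := \<gamma>)) k)) \<and> (\<phi>(m := \<gamma>)) k \<le> (\<phi>(m := \<gamma>)) (k + 1)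
           \<and> (\<phi>(m := \<gamma>)) (k + r) + \<theta> - pi \<le> (\<phi>(m := \<gamma>)) k"
      proof (cases "k = m")
        case True
        then show ?thesis using \<gamma> le r by auto
      next
        case False
        then have "k \<ge> Suc m" "k + r \<noteq> m" "k + 1 \<noteq> m" using \<open>m \<le> k\<close> by auto
        then have upd: "(\<phi>(m := \<gamma>)) k = \<phi> k" "(\<phi>(m := \<gamma>)) (k + 1) = \<phi> (k + 1)" "(\<phi>(m := \<gamma>)) (k + r) = \<phi> (k + r)"
          using False by simp_all
        show ?thesis unfolding upd using \<phi>[of k] \<open>k \<ge> Suc m\<close> by blast
      qed
    qed
  qed
  from this[of 0] obtain \<phi> where "\<forall>k\<ge>0. (\<exists>\<tau>>0. g k = complex_of_real \<tau> * cis (\<phi> k)) \<and> \<phi> k \<le> \<phi> (k + 1)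
           \<and> \<phi> (k + r) + \<theta> - pi \<le> \<phi> k" by blast
  then obtain \<tau> where "\<tau> > 0" "g 0 = complex_of_real \<tau> * cis (\<phi> 0)" by blast
  then show ?thesis by simp
qed

lemma poly_map_of_real:
  "poly (map_poly complex_of_real p) (complex_of_real x) = complex_of_real (poly p x)"
  by (induction p) (simp_all add: map_poly_pCons)

text \<open>Real coefficients transfer the upper half-plane to the lower one by conjugation. At a
  real point \<open>x \<le> 0\<close> nothing positive is ever subtracted, so all values along the
  chain stay at least 1.\<close>

lemma branched_recurrence_roots:
  fixes z :: complex and g :: "nat \<Rightarrow> real poly" and c :: "nat \<Rightarrow> real"
  assumes r: "r \<ge> 1"
    and rec: "\<And>m. m < M \<Longrightarrow> g m = g (m + 1) - smult (c m) (pCons 0 (g (m + r + 1)))"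
    and c: "\<And>m. m < M \<Longrightarrow> 0 \<le> c m"
    and one: "\<And>m. m \<ge> M \<Longrightarrow> g m = 1"
    and z: "poly (map_poly complex_of_real (g 0)) z = 0"
  shows "z \<in> \<real> \<and> 0 < Re z"
proof -
  define G where "G = (\<lambda>z m. poly (map_poly complex_of_real (g m)) z)"
  have map_diff: "map_poly complex_of_real (p - q) = map_poly complex_of_real p - map_poly complex_of_real q" for p q
    by (intro poly_eqI) (simp add: coeff_map_poly)
  have map_cmul: "map_poly complex_of_real (pCons 0 (smult x q)) = pCons 0 (smult (of_real x) (map_poly complex_of_real q))" for x q
    by (intro poly_eqI) (simp add: coeff_map_poly coeff_pCons split: nat.split)
  have G: "G z m = G z (m + 1) - complex_of_real (c m) * z * G z (m + r + 1)" if "m < M" for z m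
    using rec[OF that] by (simp add: G_def map_diff map_cmul)
  have G1: "G z m = 1" if "m \<ge> M" for z m using one[OF that] by (simp add: G_def)
  have cnj: "G (cnj z) m = cnj (G z m)" for z m
    unfolding G_def by (subst poly_cnj_real) (simp_all add: coeff_map_poly)
  have z0: "G z 0 = 0" using z by (simp add: G_def)
  have im: "Im z = 0"
  proof (rule ccontr)
    assume "Im z \<noteq> 0"
    then consider "Im z > 0" | "Im (cnj z) > 0" by force
    then show False
    proof cases
      case 1
      from branched_recurrence_nonzero_upper[OF 1 r G c G1] z0 show False by blast
    next
      case 2
      from branched_recurrence_nonzero_upper[OF 2 r G c G1] z0 cnj show False by simp
    qed
  qed
  have "0 < Re z"
  proof (rule ccontr)
    assume "\<not> 0 < Re z"
    then have x: "Re z \<le> 0" by simp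
    have "\<forall>k\<ge>m. 1 \<le> poly (g k) (Re z)" if "m \<le> M" for m
      using that
    proof (induction rule: inc_induct)
      case (step m)
      have g1: "1 \<le> poly (g k) (Re z)" if "k \<ge> Suc m" for k using step.IH that by blast
      have "0 \<le> poly (g (m + r + 1)) (Re z)" using g1[of "m + r + 1"] by simp
      then have "(c m * Re z) * poly (g (m + r + 1)) (Re z) \<le> 0"
        using x c[OF step(2)] by (intro mult_nonpos_nonneg mult_nonneg_nonpos)
      moreover have "poly (g m) (Re z) = poly (g (m + 1)) (Re z) - (c m * Re z) * poly (g (m + r + 1)) (Re z)"
        by (subst rec[OF step(2)]) simp
      ultimately have "1 \<le> poly (g m) (Re z)" using g1[of "m + 1"] by simp
      then show ?case using g1 by (metis le_antisym not_less_eq_eq)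
    qed (simp add: one)
    from this[of 0] have "1 \<le> poly (g 0) (Re z)" by blast
    then have "poly (g 0) (Re z) \<noteq> 0" by simp
    moreover have "z = complex_of_real (Re z)" using im by (simp add: complex_eq_iff)
    ultimately show False using z poly_map_of_real[of "g 0" "Re z"] by simp
  qed
  with im show ?thesis by (simp add: complex_is_Real_iff)
qed

section \<open>Contiguous hypergeometric polynomials\<close>

text \<open>The upper parameters carry an extra index 0, reserved for the terminating parameter
  \<open>- N\<close>.\<close>

definition hcoef :: "nat \<Rightarrow> (nat \<Rightarrow> real) \<Rightarrow> (nat \<Rightarrow> real) \<Rightarrow> nat \<Rightarrow> real" where
  "hcoef r u l k = (\<Prod>i\<le>r. pochhammer (u i) k) / (fact k * (\<Prod>j=1..r. pochhammer (l j) k))"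

lemma hcoef_0 [simp]: "hcoef r u l 0 = 1"
  by (simp add: hcoef_def)

lemma hcoef_cong:
  assumes "\<And>i. i \<le> r \<Longrightarrow> u i = u' i" "\<And>j. j \<in> {1..r} \<Longrightarrow> l j = l' j"
  shows "hcoef r u l k = hcoef r u' l' k"
  unfolding hcoef_def using assms by simp

lemma hcoef_eq_0:
  assumes "u 0 = - real N" "k > N"
  shows "hcoef r u l k = 0"
proof -
  have "pochhammer (u 0) k = 0"
    using assms by (simp add: pochhammer_of_nat_eq_0_iff)
  then have "(\<Prod>i\<le>r. pochhammer (u i) k) = 0" by (intro prod_zero) auto
  then show ?thesis by (simp add: hcoef_def)
qed

text \<open>After the common Pochhammer factors are removed, what remains is \<open>l j * (u i + 1 +
  k) - u i * (l j + 1 + k) = (k + 1) * (l j - u i)\<close>, and \<open>k + 1\<close> cancels against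
  the factorial.\<close>

lemma hcoef_contiguous:
  assumes i: "i \<le> r" and j: "j \<in> {1..r}" and l: "\<And>j. j \<in> {1..r} \<Longrightarrow> l j > 0"
  shows "hcoef r (u(i := u i + 1)) (l(j := l j + 1)) (Suc k) - hcoef r u l (Suc k) =
    (l j - u i) * (\<Prod>i'\<in>{..r}-{i}. u i') / (l j * (l j + 1) * (\<Prod>j'\<in>{1..r}-{j}. l j'))
    * hcoef r (\<lambda>i. u i + 1) (\<lambda>j'. l j' + 1 + (if j' = j then 1 else 0)) k"
proof -
  define U PU where "U = (\<Prod>i'\<in>{..r}-{i}. pochhammer (u i' + 1) k)" and "PU = (\<Prod>i'\<in>{..r}-{i}. u i')"
  define L PL where "L = (\<Prod>j'\<in>{1..r}-{j}. pochhammer (l j' + 1) k)" and "PL = (\<Prod>j'\<in>{1..r}-{j}. l j')"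
  define p q where "p = pochhammer (u i + 1) k" and "q = pochhammer (l j + 1) k"
  have lj: "l j > 0" using l j by blast
  have Lpos: "L > 0" "PL > 0" "q > 0"
    unfolding L_def PL_def q_def using l lj by (auto intro!: prod_pos pochhammer_pos add_pos_pos)
  have rest: "(\<Prod>x\<in>S. pochhammer (f x) (Suc k)) = (\<Prod>x\<in>S. f x) * (\<Prod>x\<in>S. pochhammer (f x + 1) k)"
    for f :: "nat \<Rightarrow> real" and S
    by (simp add: pochhammer_rec prod.distrib)
  have fin: "finite {..r}" "i \<in> {..r}" "finite {1..r}" using i by auto
  have 1: "(\<Prod>i'\<le>r. pochhammer ((u(i := u i + 1)) i') (Suc k)) = p * (u i + 1 + k) * (PU * U)"
  proof -
    have "(\<Prod>i'\<in>{..r}-{i}. pochhammer ((u(i := u i + 1)) i') (Suc k)) = PU * U"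
      unfolding PU_def U_def rest[symmetric] by (intro prod.cong) auto
    then show ?thesis
      unfolding prod.remove[OF fin(1,2)] by (simp only: fun_upd_same p_def pochhammer_Suc)
  qed
  have 2: "(\<Prod>j'=1..r. pochhammer ((l(j := l j + 1)) j') (Suc k)) = q * (l j + 1 + k) * (PL * L)"
  proof -
    have "(\<Prod>i'\<in>{1..r}-{j}. pochhammer ((l(j := l j + 1)) i') (Suc k)) = PL * L"
      unfolding PL_def L_def rest[symmetric] by (intro prod.cong) auto
    then show ?thesis
      unfolding prod.remove[OF fin(3) j] by (simp only: fun_upd_same q_def pochhammer_Suc)
  qed
  have 3: "(\<Prod>i'\<le>r. pochhammer (u i') (Suc k)) = u i * p * (PU * U)"
    unfolding prod.remove[OF fin(1,2)] rest by (simp only: pochhammer_rec p_def PU_def U_def mult_ac)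
  have 4: "(\<Prod>j'=1..r. pochhammer (l j') (Suc k)) = l j * q * (PL * L)"
    unfolding prod.remove[OF fin(3) j] rest by (simp only: pochhammer_rec q_def PL_def L_def mult_ac)
  have 5: "(\<Prod>i'\<le>r. pochhammer (u i' + 1) k) = p * U"
    using i by (simp add: prod.remove[of _ i] p_def U_def)
  have 6: "(\<Prod>j'=1..r. pochhammer (l j' + 1 + (if j' = j then 1 else 0)) k) = pochhammer (2 + l j) k * L"
    using j by (simp add: prod.remove[of _ j] L_def)
  have 7: "pochhammer (2 + l j) k = q * (l j + 1 + k) / (l j + 1)"
  proof -
    have "(l j + 1) * pochhammer (l j + 1 + 1) k = (l j + 1 + k) * q"
      unfolding q_def by (metis pochhammer_rec pochhammer_rec')
    then show ?thesis using lj by (simp add: field_simps add.commute)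
  qed
  show ?thesis
    unfolding hcoef_def 1 2 3 4 5 6 7 PU_def[symmetric] PL_def[symmetric]
    using lj Lpos by (simp add: divide_simps) (simp add: algebra_simps)
qed

definition hpoly :: "nat \<Rightarrow> (nat \<Rightarrow> real) \<Rightarrow> (nat \<Rightarrow> real) \<Rightarrow> nat \<Rightarrow> real poly" where
  "hpoly r u l N = (\<Sum>k\<le>N. monom (hcoef r u l k) k)"

lemma coeff_hpoly:
  assumes "u 0 = - real N"
  shows "coeff (hpoly r u l N) k = hcoef r u l k"
proof (cases "k \<le> N")
  case True
  then show ?thesis by (simp add: hpoly_def coeff_sum sum.delta if_distrib cong: if_cong)
next
  case False
  then show ?thesis using hcoef_eq_0[of u N k r l, OF assms] by (simp add: hpoly_def coeff_sum)
qed

text \<open>The quotient \<open>(m + (n - 1 - p)) div n\<close> counts the \<open>t < m\<close> with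
  \<open>t mod n = p\<close>, so it grows exactly when \<open>m\<close> itself has this
  residue.\<close>

lemma div_Suc_eq:
  fixes m n p :: nat
  assumes "p < n"
  shows "(Suc m + (n - 1 - p)) div n = (m + (n - 1 - p)) div n + (if m mod n = p then 1 else 0)"
proof -
  define q s where "q = m div n" and "s = m mod n"
  have m: "m = q * n + s" "s < n" using assms by (auto simp: q_def s_def)
  have "(m + (n - 1 - p)) div n = (q * n + (s + (n - 1 - p))) div n"
    by (simp only: m(1) add.assoc)
  also have "\<dots> = q + (s + (n - 1 - p)) div n"
    using assms by (subst div_mult_self3) auto
  finally have "(m + (n - 1 - p)) div n = q + (s + (n - 1 - p)) div n" .
  moreover have "(Suc m + (n - 1 - p)) div n = q + (Suc s + (n - 1 - p)) div n"
  proof -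
    have "(Suc m + (n - 1 - p)) div n = (q * n + (Suc s + (n - 1 - p))) div n"
      by (simp only: m(1) add.assoc add_Suc add_Suc_right)
    also have "\<dots> = q + (Suc s + (n - 1 - p)) div n"
      using assms by (subst div_mult_self3) auto
    finally show ?thesis .
  qed
  moreover have "(s + (n - 1 - p)) div n = (if p < s then 1 else 0)"
    using assms m(2) by (auto simp: div_if)
  moreover have "(Suc s + (n - 1 - p)) div n = (if p \<le> s then 1 else 0)"
    using assms m(2) by (auto simp: div_if)
  ultimately show ?thesis by (auto simp: s_def)
qed

text \<open>At step \<open>m = (r + 1) t + p\<close> with \<open>p \<noteq> 0\<close> the chain
  raises an upper parameter whose current value is \<open>\<beta> p + t\<close> and a lower one
  whose current value is \<open>\<alpha> (Suc ((t + p) mod r)) + t + (t + p) div r\<close>. The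
  hypothesis \<open>less\<close> says that the lower one is smaller as long as the polynomial has
  not yet become constant.\<close>

lemma hpoly_roots:
  assumes r: "r \<ge> 1"
    and \<beta>: "\<And>i. i \<in> {1..r} \<Longrightarrow> \<beta> i > 0" and \<alpha>: "\<And>j. j \<in> {1..r} \<Longrightarrow> \<alpha> j > 0"
    and less: "\<And>t p. p \<in> {1..r} \<Longrightarrow> t + 1 < N \<Longrightarrow> \<alpha> (Suc ((t + p) mod r)) + real ((t + p) div r) < \<beta> p"
    and z: "poly (map_poly complex_of_real (hpoly r (\<lambda>i. if i = 0 then - real N else \<beta> i) \<alpha> N)) z = 0"
  shows "z \<in> \<real> \<and> 0 < Re z"
proof -
  \<comment> \<open>Step \<open>m\<close> raises the upper parameter number \<open>m mod (r + 1)\<close> (number 0 being \<open>- N\<close>) and the lower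
    parameter number \<open>m mod r + 1\<close>; \<open>cu\<close> and \<open>cl\<close> count how often each has been raised.\<close>
  define cu where "cu m i = (m + (r - i)) div (r + 1)" for m i
  define cl where "cl m j = (m + (r - j)) div r" for m j
  define D where "D m = N - cu m 0" for m
  define u where "u m i = (if i = 0 then - real (D m) else \<beta> i + real (cu m i))" for m i
  define l where "l m j = \<alpha> j + real (cl m j)" for m j
  define iu where "iu m = m mod (r + 1)" for m
  define jl where "jl m = Suc (m mod r)" for m
  \<comment> \<open>Truncated subtraction keeps \<open>D\<close> at 0 once it is reached. From there
    on \<open>g m = 1\<close>, and the coefficient 0 makes the recurrence trivial.\<close>
  define c where "c m = (if D m = 0 then 0 else (l m (jl m) - u m (iu m)) * (\<Prod>i'\<in>{..r}-{iu m}. u m i')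
     / (l m (jl m) * (l m (jl m) + 1) * (\<Prod>j'\<in>{1..r}-{jl m}. l m j')))" for m
  define g where "g m = hpoly r (u m) (l m) (D m)" for m
  have cg: "coeff (g m) k = hcoef r (u m) (l m) k" for m k
    unfolding g_def by (rule coeff_hpoly) (simp add: u_def)
  have iu: "iu m \<le> r" for m unfolding iu_def using mod_less_divisor[of "r + 1" m] by simp
  have jl: "jl m \<in> {1..r}" for m unfolding jl_def using mod_less_divisor[of r m] r by (simp add: Suc_le_eq)
  have cu_Suc: "cu (Suc m) i = cu m i + (if iu m = i then 1 else 0)" if "i \<le> r" for m i
    using div_Suc_eq[of i "r + 1" m] that by (simp add: cu_def iu_def)
  have cl_Suc: "cl (Suc m) j = cl m j + (if jl m = j then 1 else 0)" if "j \<in> {1..r}" for m j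
    using div_Suc_eq[of "j - 1" r m] that by (auto simp: cl_def jl_def)
  \<comment> \<open>A block of \<open>r + 1\<close> steps passes once through the upper cycle but
    meets the lower parameter \<open>jl m\<close> at both ends. This is the shift on the right of
    \<open>hcoef_contiguous\<close>.\<close>
  have cu_r: "cu (m + r + 1) i = cu m i + 1" for m i
  proof -
    have "cu (m + r + 1) i = ((m + (r - i)) + (r + 1)) div (r + 1)"
      unfolding cu_def by (intro arg_cong2[where f = "(div)"]) simp_all
    then show ?thesis unfolding cu_def by (subst (asm) div_add_self2) auto
  qed
  have cl_r: "cl (m + r + 1) j = cl m j + 1 + (if jl m = j then 1 else 0)" if "j \<in> {1..r}" for m j
  proof -
    have "cl (m + r + 1) j = ((Suc m + (r - j)) + r) div r"
      unfolding cl_def by (intro arg_cong2[where f = "(div)"]) simp_all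
    also have "\<dots> = cl (Suc m) j + 1"
      unfolding cl_def using r by (subst div_add_self2) auto
    finally show ?thesis using cl_Suc[OF that] by simp
  qed
  have lpos: "l m j > 0" if "j \<in> {1..r}" for m j
    unfolding l_def using \<alpha>[OF that] by simp
  have upos: "u m i > 0" if "i \<in> {1..r}" for m i
    unfolding u_def using \<beta>[OF that] that by auto
  \<comment> \<open>By step \<open>(r + 1) t + p\<close> with \<open>p \<noteq> 0\<close> the
    parameter number 0 has already been raised \<open>t + 1\<close> times, so \<open>D m > 0\<close>
    leaves \<open>t + 1 < N\<close>.\<close>
  have D_pos: "t + 1 < N" "u m p = \<beta> p + t" "l m (jl m) = \<alpha> (Suc ((t + p) mod r)) + real (t + (t + p) div r)"
    if "D m > 0" "iu m = p" "p \<noteq> 0" "t = m div (r + 1)" for m p t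
  proof -
    have p: "1 \<le> p" "p \<le> r" using iu[of m] that by auto
    have m: "m = (r + 1) * t + p"
      using that(2,4) unfolding iu_def by (metis mult_div_mod_eq)
    have "cu m 0 = ((r + 1) * (t + 1) + (p - 1)) div (r + 1)"
      unfolding cu_def m using p by (intro arg_cong2[where f = "(div)"]) auto
    also have "\<dots> = t + 1" using p by (subst div_mult_self4) auto
    finally show "t + 1 < N" using that(1) by (simp add: D_def)
    have "cu m p = ((r + 1) * t + r) div (r + 1)"
      unfolding cu_def m using p by (intro arg_cong2[where f = "(div)"]) auto
    also have "\<dots> = t" by (subst div_mult_self4) auto
    finally show "u m p = \<beta> p + t" using p by (simp add: u_def)
    have m': "m = t * r + (t + p)" by (simp add: m algebra_simps)
    have "cl m (jl m) = m div r"
    proof -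
      have *: "s + (r - Suc s) = r - 1" if "s < r" for s using that by simp
      have "cl m (jl m) = ((m div r) * r + (m mod r + (r - Suc (m mod r)))) div r"
        unfolding cl_def jl_def by (simp add: add.assoc[symmetric])
      also have "m mod r + (r - Suc (m mod r)) = r - 1"
        using r by (intro *) simp
      also have "((m div r) * r + (r - 1)) div r = m div r" using r by (subst div_mult_self3) auto
      finally show ?thesis .
    qed
    also have "\<dots> = t + (t + p) div r" unfolding m' using r by (subst div_mult_self3) auto
    finally have "cl m (jl m) = t + (t + p) div r" .
    moreover have "m mod r = (t + p) mod r" unfolding m' by simp
    ultimately show "l m (jl m) = \<alpha> (Suc ((t + p) mod r)) + real (t + (t + p) div r)"
      by (simp add: l_def jl_def)
  qed
  have c_nonneg: "0 \<le> c m" for m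
  proof (cases "D m = 0")
    case False
    have "0 < l m (jl m) * (l m (jl m) + 1) * (\<Prod>j'\<in>{1..r}-{jl m}. l m j')"
      by (intro mult_pos_pos prod_pos add_pos_pos lpos jl) auto
    moreover have "0 \<le> (l m (jl m) - u m (iu m)) * (\<Prod>i'\<in>{..r}-{iu m}. u m i')"
    \<comment> \<open>Only \<open>u m 0\<close> is nonpositive. If it is the one being raised, both
      factors are nonnegative; otherwise it sits in the product, making it nonpositive, and
      \<open>less\<close> makes the difference nonpositive too.\<close>
    proof (cases "iu m = 0")
      case True
      have "0 \<le> (\<Prod>i'\<in>{..r}-{iu m}. u m i')"
        using True upos by (intro prod_nonneg) (auto intro!: less_imp_le)
      moreover have "0 \<le> l m (jl m) - u m (iu m)" using True lpos[OF jl, of m m] by (simp add: u_def)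
      ultimately show ?thesis by simp
    next
      case i: False
      have "(\<Prod>i'\<in>{..r}-{iu m}. u m i') = u m 0 * (\<Prod>i'\<in>{..r}-{iu m}-{0}. u m i')"
        using i by (intro prod.remove) auto
      also have "\<dots> \<le> 0"
        using upos by (intro mult_nonpos_nonneg prod_nonneg) (auto simp: u_def[of m 0] intro!: less_imp_le)
      finally have "(\<Prod>i'\<in>{..r}-{iu m}. u m i') \<le> 0" .
      moreover have "l m (jl m) - u m (iu m) \<le> 0"
        using D_pos[of m, OF _ refl i refl] less[of "iu m" "m div (r + 1)"] False i iu[of m] by auto
      ultimately show ?thesis by (rule mult_nonpos_nonpos[rotated])
    qed
    ultimately show ?thesis using False by (simp add: c_def)
  qed (simp add: c_def)
  have g1: "g m = 1" if "D m = 0" for m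
    using that by (simp add: g_def hpoly_def)
  have rec: "g m = g (m + 1) - smult (c m) (pCons 0 (g (m + r + 1)))" for m
  proof (cases "D m = 0")
    case True
    moreover have "D (m + 1) = 0" using True cu_Suc[of 0 m] by (auto simp: D_def)
    ultimately show ?thesis by (simp add: g1 c_def)
  next
    case False
    show ?thesis
    proof (rule poly_eqI)
      fix k
      show "coeff (g m) k = coeff (g (m + 1) - smult (c m) (pCons 0 (g (m + r + 1)))) k"
      proof (cases k)
        case (Suc k')
        have 1: "hcoef r (u (m + 1)) (l (m + 1)) k = hcoef r ((u m)(iu m := u m (iu m) + 1)) ((l m)(jl m := l m (jl m) + 1)) k"
          using False cu_Suc[of _ m] cl_Suc[of _ m]
          by (intro hcoef_cong) (auto simp: u_def l_def D_def of_nat_diff)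
        have 2: "hcoef r (u (m + r + 1)) (l (m + r + 1)) k' = hcoef r (\<lambda>i. u m i + 1) (\<lambda>j'. l m j' + 1 + (if j' = jl m then 1 else 0)) k'"
          using False cu_r[of m] cl_r[of _ m]
          by (intro hcoef_cong) (auto simp: u_def l_def D_def of_nat_diff)
        show ?thesis
          using hcoef_contiguous[where r = r and i = "iu m" and j = "jl m" and u = "u m" and l = "l m" and k = k', OF iu jl lpos] False unfolding Suc
          by (simp add: cg 1[unfolded Suc, simplified] 2[simplified] c_def)
      qed (simp add: cg)
    qed
  qed
  have "D m = 0" if "m \<ge> (r + 1) * N" for m
  proof -
    have "N = ((r + 1) * N) div (r + 1)" by (rule nonzero_mult_div_cancel_left[symmetric]) simp
    also have "\<dots> \<le> cu m 0" unfolding cu_def using that by (intro div_le_mono) simp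
    finally show ?thesis by (simp add: D_def)
  qed
  then have one: "\<And>m. m \<ge> (r + 1) * N \<Longrightarrow> g m = 1" using g1 by blast
  have "cu 0 i = 0" for i by (simp add: cu_def)
  moreover have "cl 0 j = 0" if "j \<in> {1..r}" for j using that by (simp add: cl_def)
  ultimately have "g 0 = hpoly r (\<lambda>i. if i = 0 then - real N else \<beta> i) \<alpha> N"
    unfolding g_def hpoly_def by (auto intro!: sum.cong arg_cong2[where f = monom] hcoef_cong simp: D_def u_def l_def)
  then show ?thesis
    using branched_recurrence_roots[OF r rec c_nonneg one] z by metis
qed

section \<open>The polynomials on the step-line\<close>

lemma foldl_mult_map:
  "foldl (\<lambda>r a. r * f a) x (map g [1..<Suc n]) = x * (\<Prod>i=1..n. f (g i :: real)) " for f :: "real \<Rightarrow> real"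
  by (induction n) (simp_all add: mult_ac)

lemma prod_atMost_split_0: "(\<Prod>i\<le>r. f i) = f 0 * (\<Prod>i=1..r. f i)" for f :: "nat \<Rightarrow> real"
proof -
  have "{..r} = insert 0 {1..r}" by auto
  then show ?thesis by simp
qed

lemma P_poly_eq:
  "P_poly r a b n = hpoly r (\<lambda>i. if i = 0 then - real (mi_size r n) else b i + real (n i) + 1) (\<lambda>i. a i + 1) (mi_size r n)"
proof -
  have *: "(\<Prod>i\<le>r. f i) = f 0 * (\<Prod>i=1..r. f i)" for f :: "nat \<Rightarrow> real"
    by (rule prod_atMost_split_0)
  show ?thesis
    unfolding P_poly_def hypergeo_poly_def hpoly_def
    by (intro sum.cong arg_cong2[where f = monom] refl)
      (simp only: fps_hypergeo_nth foldl_mult_map foldl_Cons hcoef_def *, simp add: mult_ac)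
qed

text \<open>On the step-line \<open>n i\<close> can exceed \<open>n j\<close> only for
  \<open>i < j\<close>, can fall short of it only for \<open>i > j\<close>, and in both cases by at
  most 1. Summing over \<open>i\<close> gives the bounds, which place
  \<open>r * n j + j - |n|\<close> in \<open>1..r\<close>.\<close>

lemma on_step_line_bounds:
  assumes n: "on_step_line r n" and j: "j \<in> {1..r}"
  shows "mi_size r n + 1 \<le> r * n j + j" "r * n j + j \<le> mi_size r n + r"
proof -
  have dec: "n j \<le> n i" if "1 \<le> i" "i \<le> j" "j \<le> r" for i j
    using that(2,3)
  proof (induction j rule: dec_induct)
    case (step k)
    then have "n (Suc k) \<le> n k" using n that(1) by (auto simp: on_step_line_def)
    then show ?case using step by simp
  qed simp
  have n1: "n i \<le> n j + 1" if "i \<in> {1..r}" "j \<in> {1..r}" for i j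
    using n dec[of 1 i] dec[of j r] that by (auto simp: on_step_line_def)
  have "mi_size r n \<le> (\<Sum>i=1..r. n j + (if i < j then 1 else 0))"
    unfolding mi_size_def using j n1 dec by (intro sum_mono) auto
  also have "\<dots> = r * n j + (\<Sum>i\<in>{i\<in>{1..r}. i < j}. 1)"
    by (simp add: sum.distrib flip: sum.inter_filter)
  also have "{i\<in>{1..r}. i < j} = {1..<j}" using j by auto
  finally show "mi_size r n + 1 \<le> r * n j + j" using j by (cases j) auto
  have "(\<Sum>i=1..r. n j) \<le> (\<Sum>i=1..r. n i + (if j < i then 1 else 0))"
    using j n1 dec by (intro sum_mono) auto
  also have "\<dots> = mi_size r n + (\<Sum>i\<in>{i\<in>{1..r}. j < i}. 1)"
    by (simp add: sum.distrib mi_size_def flip: sum.inter_filter)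
  also have "{i\<in>{1..r}. j < i} = {j<..r}" using j by auto
  finally have "r * n j \<le> mi_size r n + (r - j)" by simp
  then show "r * n j + j \<le> mi_size r n + r" using j by (auto simp: le_diff_conv2)
qed

lemma P_poly_roots:
  assumes r: "r \<ge> 1"
    and a: "\<And>i. i \<in> {1..r} \<Longrightarrow> a i > -1" and b: "\<And>j. j \<in> {1..r} \<Longrightarrow> b j > -1"
    and ab1: "\<And>i j. i \<in> {1..r} \<Longrightarrow> j \<in> {1..r} \<Longrightarrow> i \<le> j \<Longrightarrow> b j > a i"
    and ab2: "\<And>i j. i \<in> {1..r} \<Longrightarrow> j \<in> {1..r} \<Longrightarrow> i > j \<Longrightarrow> b j > a i - 1"
    and n: "on_step_line r n"
    and z: "poly (map_poly complex_of_real (P_poly r a b n)) z = 0"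
  shows "z \<in> \<real> \<and> 0 < Re z"
proof -
  define N where "N = mi_size r n"
  \<comment> \<open>The position of \<open>b\<^sub>j\<close> in the cycle of upper parameters for which the conditions on \<open>a\<close> and \<open>b\<close>
    make all coefficients of the chain nonnegative.\<close>
  define p where "p j = r * n j + j - N" for j
  have bounds: "N + 1 \<le> r * n j + j" "r * n j + j \<le> N + r" if "j \<in> {1..r}" for j
    using on_step_line_bounds[OF n that] by (simp_all add: N_def)
  have p: "p j \<in> {1..r}" "N + p j = r * n j + j" if "j \<in> {1..r}" for j
    using bounds[OF that] by (auto simp: p_def)
  have "inj_on p {1..r}"
  proof (rule inj_onI)
    fix i j assume ij: "i \<in> {1..r}" "j \<in> {1..r}" "p i = p j"
    then have eq: "r * n i + i = r * n j + j" using p(2)[of i] p(2)[of j] by simp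
    have "r * n i + (i - 1) = r * n j + (j - 1)" using eq ij by simp
    moreover have "i - 1 < r" "j - 1 < r" using ij by auto
    ultimately have "i - 1 = j - 1" by (metis mod_less mod_mult_self4)
    then show "i = j" using ij by auto
  qed
  then have bij: "bij_betw p {1..r} {1..r}"
    using endo_inj_surj[of "{1..r}" p] p(1) unfolding bij_betw_def by blast
  define q where "q = the_inv_into {1..r} p"
  have qb: "bij_betw q {1..r} {1..r}" using bij_betw_the_inv_into[OF bij] by (simp add: q_def)
  have q: "q i \<in> {1..r}" "p (q i) = i" if "i \<in> {1..r}" for i
    using bij_betw_apply[OF qb that] f_the_inv_into_f_bij_betw[OF bij, of i] that by (auto simp: q_def)
  define \<beta> where "\<beta> i = b (q i) + real (n (q i)) + 1" for i
  \<comment> \<open>The coefficients are symmetric in the upper parameters, so the polynomial does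
    not see that they are listed by position.\<close>
  have coef: "hcoef r (\<lambda>i. if i = 0 then - real N else b i + real (n i) + 1) l k
      = hcoef r (\<lambda>i. if i = 0 then - real N else \<beta> i) l k" for l k
  proof -
    have *: "(\<Prod>i\<le>r. f i) = f 0 * (\<Prod>i=1..r. f i)" for f :: "nat \<Rightarrow> real"
      by (rule prod_atMost_split_0)
    show ?thesis
      unfolding hcoef_def * \<beta>_def
      using prod.reindex_bij_betw[OF qb, of "\<lambda>i. pochhammer (b i + real (n i) + 1) k"] by simp
  qed
  have P: "P_poly r a b n = hpoly r (\<lambda>i. if i = 0 then - real N else \<beta> i) (\<lambda>i. a i + 1) N"
    unfolding P_poly_eq N_def[symmetric] hpoly_def coef ..
  show ?thesis
  proof (rule hpoly_roots[OF r])
    show "\<beta> i > 0" if "i \<in> {1..r}" for i using b[OF q(1)[OF that]] by (simp add: \<beta>_def)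
    show "a j + 1 > 0" if "j \<in> {1..r}" for j using a[OF that] by simp
    show "poly (map_poly complex_of_real (hpoly r (\<lambda>i. if i = 0 then - real N else \<beta> i) (\<lambda>i. a i + 1) N)) z = 0"
      using z P by simp
    fix t i assume i: "i \<in> {1..r}" and t: "t + 1 < N"
    define j where "j = q i"
    have j: "j \<in> {1..r}" "p j = i" using q[OF i] by (auto simp: j_def)
    define v where "v = t + i"
    \<comment> \<open>This yields \<open>f \<le> n j\<close>. If \<open>f < n j\<close>, there is a
      slack of 1 and \<open>a (Suc s) < b j + 1\<close> suffices, which both kinds of inequality
      provide; if \<open>f = n j\<close>, then \<open>Suc s < j\<close>, where
      \<open>b j > a (Suc s)\<close> is available.\<close>
    have v: "v + 2 \<le> r * n j + j" using p(2)[OF j(1)] t j(2) by (simp add: v_def)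
    define f s where "f = v div r" and "s = v mod r"
    have fs: "v = r * f + s" "s < r" using r by (auto simp: f_def s_def)
    have "a (Suc s) + real f < b j + real (n j)"
    proof (cases "f < n j")
      case True
      have "b j + 1 > a (Suc s)" using ab1[of "Suc s" j] ab2[of "Suc s" j] fs j by (cases "Suc s \<le> j") auto
      then show ?thesis using True by linarith
    next
      case False
      have "f = n j"
      proof (rule ccontr)
        assume "f \<noteq> n j"
        then have "n j + 1 \<le> f" using False by simp
        then have "r * (n j + 1) \<le> r * f" by (rule mult_le_mono2)
        then show False using v fs j by (simp add: algebra_simps)
      qed
      then have "Suc s \<le> j" using v fs by simp
      then show ?thesis using ab1[of "Suc s" j] fs j \<open>f = n j\<close> by auto
    qed
    then show "a (Suc ((t + i) mod r)) + 1 + real ((t + i) div r) < \<beta> i"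
      by (simp add: \<beta>_def j_def f_def s_def v_def)
  qed
qed

section \<open>Power sums of the zeros of hypergeometric polynomials\<close>

definition power_sums :: "real multiset \<Rightarrow> real fps" where
  "power_sums X = Abs_fps (\<lambda>k. \<Sum>x\<in>#X. x ^ k)"

definition root_poly :: "real multiset \<Rightarrow> real poly" where
  "root_poly X = (\<Prod>x\<in>#X. [:- x, 1:])"

lemma degree_root_poly: "degree (root_poly X) = size X"
  and lead_coeff_root_poly: "lead_coeff (root_poly X) = 1"
proof -
  have "root_poly X \<noteq> 0 \<and> degree (root_poly X) = size X \<and> lead_coeff (root_poly X) = 1"
  proof (induction X)
    case (add x X)
    have "root_poly (add_mset x X) = [:- x, 1:] * root_poly X" by (simp add: root_poly_def)
    moreover have "degree ([:- x, 1:] * root_poly X) = size (add_mset x X)"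
      using add by (subst degree_mult_eq) auto
    moreover have "lead_coeff ([:- x, 1:] * root_poly X) = 1"
      using add by (subst lead_coeff_mult) auto
    ultimately show ?case by (metis leading_coeff_0_iff zero_neq_one)
  qed (simp add: root_poly_def)
  then show "degree (root_poly X) = size X" "lead_coeff (root_poly X) = 1" by auto
qed

text \<open>The series is the sum of the geometric series \<open>1 / (1 - x X)\<close>, and each of
  these is 1 minus \<open>X\<close> times the logarithmic derivative of \<open>1 - x X\<close>.
  Multiplying by the product clears the denominators.\<close>

lemma Newton_identity:
  "power_sums X * (\<Prod>x\<in>#X. 1 - fps_const x * fps_X) =
   of_nat (size X) * (\<Prod>x\<in>#X. 1 - fps_const x * fps_X)
     - fps_X * fps_deriv (\<Prod>x\<in>#X. 1 - fps_const x * fps_X)"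
proof (induction X)
  case empty
  have "power_sums {#} = 0" by (simp add: power_sums_def fps_eq_iff)
  then show ?case by simp
next
  case (add x X)
  define R where "R = (\<Prod>x\<in>#X. 1 - fps_const x * fps_X)"
  have ps: "power_sums (add_mset x X) = Abs_fps (\<lambda>k. x ^ k) + power_sums X"
    by (simp add: power_sums_def fps_eq_iff)
  have geo: "Abs_fps (\<lambda>k. x ^ k) * (1 - fps_const x * fps_X) = 1"
  proof (rule fps_ext)
    fix n
    have "(Abs_fps (\<lambda>k. x ^ k) * (1 - fps_const x * fps_X)) $ n
        = (Abs_fps (\<lambda>k. x ^ k) - fps_const x * (fps_X * Abs_fps (\<lambda>k. x ^ k))) $ n"
      by (simp add: algebra_simps)
    then show "(Abs_fps (\<lambda>k. x ^ k) * (1 - fps_const x * fps_X)) $ n = 1 $ n"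
      by (cases n) auto
  qed
  have "power_sums (add_mset x X) * ((1 - fps_const x * fps_X) * R) =
     (Abs_fps (\<lambda>k. x ^ k) * (1 - fps_const x * fps_X)) * R + (1 - fps_const x * fps_X) * (power_sums X * R)"
    by (simp add: ps algebra_simps)
  also have "\<dots> = R + (1 - fps_const x * fps_X) * (of_nat (size X) * R - fps_X * fps_deriv R)"
    using add geo by (simp add: R_def)
  also have "\<dots> = of_nat (size (add_mset x X)) * ((1 - fps_const x * fps_X) * R)
     - fps_X * fps_deriv ((1 - fps_const x * fps_X) * R)"
    by (simp add: algebra_simps)
  finally show ?case by (simp add: R_def)
qed

lemma fps_of_reflect_root_poly:
  "fps_of_poly (reflect_poly (root_poly X)) = (\<Prod>x\<in>#X. 1 - fps_const x * fps_X)"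
proof -
  have 1: "fps_of_poly (reflect_poly [:- x, 1:]) = 1 - fps_const x * fps_X" for x :: real
    by (rule fps_ext) (simp add: reflect_poly_def cCons_def coeff_pCons split: nat.split)
  show ?thesis
    unfolding root_poly_def
    by (induction X) (simp_all add: reflect_poly_mult fps_of_poly_mult 1 del: mult_pCons_left)
qed

text \<open>In the variable \<open>1/x\<close>, conjugation by the polynomial turns the scaled Euler
  derivative \<open>(x d/dx + s)/N\<close> into the following operator, with \<open>h\<close> the generating function of
  the normalized power sums of the zeros.\<close>

definition euler_op :: "real fps \<Rightarrow> real \<Rightarrow> real \<Rightarrow> real fps \<Rightarrow> real fps" where
  "euler_op h \<epsilon> s u = (h + fps_const (s * \<epsilon>)) * u - fps_const \<epsilon> * (fps_X * fps_deriv u)"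

primrec euler_ops :: "real fps \<Rightarrow> real \<Rightarrow> (nat \<Rightarrow> real) \<Rightarrow> nat \<Rightarrow> real fps \<Rightarrow> real fps" where
  "euler_ops h \<epsilon> s 0 u = u"
| "euler_ops h \<epsilon> s (Suc l) u = euler_op h \<epsilon> (s (Suc l)) (euler_ops h \<epsilon> s l u)"

text \<open>Multiplication by \<open>R\<close>, the reversed polynomial, undoes the conjugation: the
  coefficient at \<open>i\<close> belongs to \<open>x^(N - i)\<close>, on which
  \<open>(x d/dx + s) / N\<close> acts as the scalar \<open>(N - i + s) / N\<close>.\<close>

lemma euler_op_mult:
  fixes R :: "real fps"
  assumes R: "h * R = R - fps_const (1 / real N) * (fps_X * fps_deriv R)" and N: "N > 0"
  shows "(R * euler_op h (1 / real N) s u) $ i = (real N - real i + s) / real N * (R * u) $ i"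
proof -
  have "R * euler_op h (1 / real N) s u = (h * R) * u + fps_const (s / N) * (R * u) - fps_const (1 / N) * (R * (fps_X * fps_deriv u))"
    unfolding euler_op_def by (simp add: algebra_simps)
  also have "\<dots> = R * u + fps_const (s / N) * (R * u) - fps_const (1 / N) * (fps_X * fps_deriv (R * u))"
    unfolding R by (simp add: algebra_simps)
  finally have "(R * euler_op h (1 / real N) s u) $ i = (R * u) $ i + s / N * (R * u) $ i - 1 / N * (i * (R * u) $ i)"
    by (simp del: fps_deriv_mult add: fps_X_mult_nth of_nat_diff split: nat.split)
  then show ?thesis using N by (simp add: add_divide_distrib diff_divide_distrib algebra_simps)
qed

lemma euler_ops_mult:
  fixes R :: "real fps"
  assumes R: "h * R = R - fps_const (1 / real N) * (fps_X * fps_deriv R)" and N: "N > 0"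
  shows "(R * euler_ops h (1 / real N) s l u) $ i = (\<Prod>j=1..l. (real N - real i + s j) / real N) * (R * u) $ i"
  by (induction l) (simp_all add: euler_op_mult[OF R N])

text \<open>With \<open>D = x d/dx\<close>, the two-term recurrence \<open>rec\<close> is the
  equation \<open>D (D + A_1 - 1)...(D + A_q - 1) p = x (D - N) (D + B_1)...(D + B_q) p\<close>.
  Division by \<open>x N^(q+1) p\<close> gives the claim; it is checked on coefficients after
  multiplication by \<open>R\<close>, where every operator is diagonal.\<close>

lemma euler_equation:
  fixes c :: real and X :: "real multiset" and A B :: "nat \<Rightarrow> real"
  assumes p: "p = smult c (root_poly X)" and c: "c \<noteq> 0" and N: "N = size X" "N > 0"
    and rec: "\<And>k. k < N \<Longrightarrow> real (k + 1) * (\<Prod>j=1..q. A j + real k) * coeff p (k + 1) =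
                (real k - real N) * (\<Prod>j=1..q. B j + real k) * coeff p k"
  defines "h \<equiv> fps_const (1 / real N) * power_sums X"
  shows "fps_X * euler_op h (1 / real N) 0 (euler_ops h (1 / real N) (\<lambda>j. A j - 1) q 1)
       = euler_ops h (1 / real N) B q (h - 1)"
proof -
  define R where "R = fps_of_poly (reflect_poly p)"
  have R: "R = fps_const c * (\<Prod>x\<in>#X. 1 - fps_const x * fps_X)"
    using c by (simp add: R_def p reflect_poly_smult fps_of_poly_smult fps_of_reflect_root_poly)
  have p0: "p \<noteq> 0" using c lead_coeff_root_poly[of X] by (auto simp: p)
  then have R0: "R \<noteq> 0" by (simp add: R_def fps_of_poly_eq_iff[of _ 0, simplified])
  have deg: "degree p = N" using c by (simp add: p degree_root_poly N)
  have Rn: "R $ i = (if i \<le> N then coeff p (N - i) else 0)" for i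
    by (simp add: R_def coeff_reflect_poly deg)
  have hR: "h * R = R - fps_const (1 / real N) * (fps_X * fps_deriv R)"
  proof -
    have "power_sums X * R = of_nat N * R - fps_X * fps_deriv R"
      using arg_cong[OF Newton_identity[of X], of "(*) (fps_const c)"] by (simp add: R N algebra_simps)
    then have "h * R = fps_const (1 / real N) * (of_nat N * R) - fps_const (1 / real N) * (fps_X * fps_deriv R)"
      by (simp only: h_def mult.assoc right_diff_distrib)
    also have "fps_const (1 / real N) * (of_nat N * R) = R"
      using N(2) by (simp add: fps_eq_iff fps_of_nat[symmetric] del: fps_of_nat)
    finally show ?thesis .
  qed
  note op = euler_op_mult[OF hR N(2)] and ops = euler_ops_mult[OF hR N(2)]
  \<comment> \<open>The series \<open>h - 1\<close> is the trace of the factor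
    \<open>(D - N) / N\<close>, that is, of the shift \<open>s = - N\<close>.\<close>
  have "R * (h - 1) = R * euler_op h (1 / real N) (- real N) 1"
    using N(2) by (simp add: euler_op_def)
  then have hm: "(R * (h - 1)) $ i = - real i / real N * R $ i" for i
    unfolding \<open>R * (h - 1) = _\<close> op by simp
  have "R * (fps_X * euler_op h (1 / real N) 0 (euler_ops h (1 / real N) (\<lambda>j. A j - 1) q 1))
      = R * euler_ops h (1 / real N) B q (h - 1)"
  proof (rule fps_ext)
    fix i
    show "(R * (fps_X * euler_op h (1 / real N) 0 (euler_ops h (1 / real N) (\<lambda>j. A j - 1) q 1))) $ i
      = (R * euler_ops h (1 / real N) B q (h - 1)) $ i"
    proof (cases i)
      case 0
      then show ?thesis unfolding ops hm by (simp add: mult.left_commute[of R fps_X])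
    next
      case (Suc i')
      have "(R * (fps_X * euler_op h (1 / real N) 0 (euler_ops h (1 / real N) (\<lambda>j. A j - 1) q 1))) $ i
        = (R * euler_op h (1 / real N) 0 (euler_ops h (1 / real N) (\<lambda>j. A j - 1) q 1)) $ i'"
        unfolding mult.left_commute[of R fps_X] Suc by simp
      also have "\<dots> = (real N - real i') / real N * ((\<Prod>j=1..q. (real N - real i' + (A j - 1)) / real N) * R $ i')"
        unfolding op ops by simp
      also have "\<dots> = (\<Prod>j=1..q. (real N - real i + B j) / real N) * (- real i / real N * R $ i)"
      proof (cases "i \<le> N")
        case True
        define k where "k = N - i"
        have k: "k < N" "N - i' = k + 1" "real N - real i' = real (k + 1)" "real i = real N - real k" "real i' = real N - real k - 1"
          using True Suc by (auto simp: k_def of_nat_diff)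
        have A: "(\<Prod>j=1..q. (real N - real i' + (A j - 1)) / real N) = (\<Prod>j=1..q. A j + real k) / real N ^ q"
          by (subst prod_dividef) (simp add: k(3) algebra_simps)
        have B: "(\<Prod>j=1..q. (real N - real i + B j) / real N) = (\<Prod>j=1..q. B j + real k) / real N ^ q"
          by (subst prod_dividef) (simp add: k(4) algebra_simps)
        have Ri: "R $ i' = coeff p (k + 1)" "R $ i = coeff p k"
          using True Suc k(2) by (simp_all add: Rn k_def)
        have "(real N - real i') / real N * ((\<Prod>j=1..q. A j + real k) / real N ^ q * coeff p (k + 1))
          = real (k + 1) * (\<Prod>j=1..q. A j + real k) * coeff p (k + 1) / (real N * real N ^ q)"
          unfolding k(3) by (simp only: times_divide_eq_left times_divide_eq_right divide_divide_eq_left mult_ac)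
        also have "\<dots> = (real k - real N) * (\<Prod>j=1..q. B j + real k) * coeff p k / (real N * real N ^ q)"
          by (simp only: rec[OF k(1)])
        also have "real k - real N = - real i" unfolding k(4) by simp
        also have "- real i * (\<Prod>j=1..q. B j + real k) * coeff p k / (real N * real N ^ q)
          = (\<Prod>j=1..q. B j + real k) / real N ^ q * (- real i / real N * coeff p k)"
          by (simp only: times_divide_eq_left times_divide_eq_right divide_divide_eq_left mult_ac)
        finally show ?thesis unfolding A B Ri .
      next
        \<comment> \<open>Beyond the degree all coefficients vanish, except that for
          \<open>i' = N\<close> the left side still contains a nonzero one, which is multiplied by
          \<open>N - i' = 0\<close>.\<close>
        case False
        then show ?thesis using Suc by (cases "i' = N") (auto simp: Rn)
      qed
      also have "\<dots> = (R * euler_ops h (1 / real N) B q (h - 1)) $ i"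
        unfolding ops hm ..
      finally show ?thesis .
    qed
  qed
  then show ?thesis using R0 by (metis mult_left_cancel)
qed

section \<open>Coefficientwise limits of the differential equation\<close>

definition coeffs_tendsto :: "(nat \<Rightarrow> real fps) \<Rightarrow> real fps \<Rightarrow> nat \<Rightarrow> bool" where
  "coeffs_tendsto f g k \<longleftrightarrow> (\<forall>i<k. (\<lambda>m. f m $ i) \<longlonglongrightarrow> g $ i)"

lemma coeffs_tendsto_mult:
  "coeffs_tendsto f g k \<Longrightarrow> coeffs_tendsto f' g' k \<Longrightarrow> coeffs_tendsto (\<lambda>m. f m * f' m) (g * g') k"
  unfolding coeffs_tendsto_def fps_mult_nth by (auto intro!: tendsto_intros)

lemma coeffs_tendsto_add:
  "coeffs_tendsto f g k \<Longrightarrow> coeffs_tendsto f' g' k \<Longrightarrow> coeffs_tendsto (\<lambda>m. f m + f' m) (g + g') k"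
  unfolding coeffs_tendsto_def by (auto intro!: tendsto_intros)

lemma coeffs_tendsto_euler_op:
  assumes h: "coeffs_tendsto h H k" and u: "coeffs_tendsto u U k"
    and e: "\<epsilon> \<longlonglongrightarrow> 0" and s: "(\<lambda>m. s m * \<epsilon> m) \<longlonglongrightarrow> \<sigma>"
  shows "coeffs_tendsto (\<lambda>m. euler_op (h m) (\<epsilon> m) (s m) (u m)) ((H + fps_const \<sigma>) * U) k"
proof -
  have "coeffs_tendsto (\<lambda>m. fps_const (s m * \<epsilon> m)) (fps_const \<sigma>) k"
    using s by (auto simp: coeffs_tendsto_def)
  from coeffs_tendsto_mult[OF coeffs_tendsto_add[OF h this] u]
  have *: "(\<lambda>m. ((h m + fps_const (s m * \<epsilon> m)) * u m) $ i) \<longlonglongrightarrow> ((H + fps_const \<sigma>) * U) $ i" if "i < k" for i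
    using that by (auto simp: coeffs_tendsto_def)
  have "(\<lambda>m. ((h m + fps_const (s m * \<epsilon> m)) * u m) $ i - \<epsilon> m * (real i * u m $ i)) \<longlonglongrightarrow> ((H + fps_const \<sigma>) * U) $ i - 0 * (real i * U $ i)"
    if "i < k" for i
    using that u by (intro tendsto_intros * e) (auto simp: coeffs_tendsto_def)
  moreover have X: "(fps_const a * (fps_X * fps_deriv v)) $ i = a * (real i * v $ i)" for a and v :: "real fps" and i
    by (cases i) auto
  ultimately show ?thesis
    by (simp only: coeffs_tendsto_def euler_op_def fps_sub_nth X mult_zero_left diff_zero) blast
qed

lemma coeffs_tendsto_euler_ops:
  assumes h: "coeffs_tendsto h H k" and u: "coeffs_tendsto u U k"
    and e: "\<epsilon> \<longlonglongrightarrow> 0" and s: "\<And>j. j \<in> {1..l} \<Longrightarrow> (\<lambda>m. s m j * \<epsilon> m) \<longlonglongrightarrow> \<sigma>"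
  shows "coeffs_tendsto (\<lambda>m. euler_ops (h m) (\<epsilon> m) (s m) l (u m)) ((H + fps_const \<sigma>) ^ l * U) k"
  using s
proof (induction l)
  case (Suc l)
  then show ?case
    using coeffs_tendsto_euler_op[OF h Suc.IH e, of "\<lambda>m. s m (Suc l)" \<sigma>] by (simp add: mult.assoc)
qed (use u in simp)

text \<open>When \<open>w = h - 1\<close> has no constant term, the coefficient of \<open>X^k\<close> in the operators applied
  to \<open>w\<close> depends affinely on the coefficient of \<open>X^k\<close> in \<open>w\<close>, the rest involving only lower
  coefficients.\<close>

lemma tendsto_top_coeff:
  fixes w :: "nat \<Rightarrow> real fps" and W :: "real fps"
  assumes w0: "\<And>m. w m $ 0 = 0" "W $ 0 = 0" and w: "coeffs_tendsto w W k"
    and e: "\<epsilon> \<longlonglongrightarrow> 0" and s: "\<And>j. j \<in> {1..l} \<Longrightarrow> (\<lambda>m. s m j * \<epsilon> m) \<longlonglongrightarrow> \<sigma>"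
  shows "(\<lambda>m. euler_ops (1 + w m) (\<epsilon> m) (s m) l (w m) $ k - (\<Prod>j=1..l. 1 + s m j * \<epsilon> m - \<epsilon> m * real k) * w m $ k)
     \<longlonglongrightarrow> ((1 + W + fps_const \<sigma>) ^ l * W) $ k - (1 + \<sigma>) ^ l * W $ k"
  using s
proof (induction l)
  case (Suc l)
  define u where "u m = euler_ops (1 + w m) (\<epsilon> m) (s m) l (w m)" for m
  define U where "U = (1 + W + fps_const \<sigma>) ^ l * W"
  define \<pi> where "\<pi> m = (\<Prod>j=1..l. 1 + s m j * \<epsilon> m - \<epsilon> m * real k)" for m
  have IH: "(\<lambda>m. u m $ k - \<pi> m * w m $ k) \<longlonglongrightarrow> U $ k - (1 + \<sigma>) ^ l * W $ k"
    using Suc unfolding u_def U_def \<pi>_def by simp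
  have "coeffs_tendsto (\<lambda>m. 1 + w m) (1 + W) k"
    using w by (intro coeffs_tendsto_add) (auto simp: coeffs_tendsto_def)
  then have u: "coeffs_tendsto u U k"
    unfolding u_def U_def using Suc.prems by (intro coeffs_tendsto_euler_ops w e) auto
  have u0: "u m $ 0 = 0" for m
    unfolding u_def by (induction l) (use w0 in \<open>simp_all add: euler_op_def\<close>)
  have U0: "U $ 0 = 0" by (simp add: U_def w0)
  \<comment> \<open>Neither factor has a constant term, so the coefficient at \<open>k\<close> of
    their product involves only coefficients strictly below \<open>k\<close>, whose limits are
    known.\<close>
  have sum0: "(\<Sum>i=0..k. f i * g (k - i)) = (\<Sum>i\<in>{1..<k}. f i * g (k - i))" if "f 0 = 0" "g 0 = 0" for f g :: "nat \<Rightarrow> real"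
    using that by (intro sum.mono_neutral_right) (auto simp: Suc_le_eq)
  have wu_eq: "(w m * u m) $ k = (\<Sum>i\<in>{1..<k}. w m $ i * u m $ (k - i))" for m
    unfolding fps_mult_nth by (rule sum0) (simp_all add: w0 u0)
  have WU_eq: "(W * U) $ k = (\<Sum>i\<in>{1..<k}. W $ i * U $ (k - i))"
    unfolding fps_mult_nth by (rule sum0) (simp_all add: w0 U0)
  have wu: "(\<lambda>m. (w m * u m) $ k) \<longlonglongrightarrow> (W * U) $ k"
    unfolding wu_eq WU_eq
    using w u by (intro tendsto_intros) (auto simp: coeffs_tendsto_def)
  define \<gamma> where "\<gamma> m = 1 + s m (Suc l) * \<epsilon> m - \<epsilon> m * real k" for m
  have \<gamma>: "\<gamma> \<longlonglongrightarrow> 1 + \<sigma> - 0 * real k"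
    unfolding \<gamma>_def using Suc.prems by (intro tendsto_intros e) auto
  have X: "(fps_const a * (fps_X * fps_deriv v)) $ i = a * (real i * v $ i)" for a and v :: "real fps" and i
    by (cases i) auto
  have "euler_ops (1 + w m) (\<epsilon> m) (s m) (Suc l) (w m) $ k = \<gamma> m * u m $ k + (w m * u m) $ k" for m
    unfolding euler_ops.simps u_def[symmetric] \<gamma>_def euler_op_def fps_sub_nth X
    by (simp add: algebra_simps)
  then have *: "euler_ops (1 + w m) (\<epsilon> m) (s m) (Suc l) (w m) $ k - (\<gamma> m * \<pi> m) * w m $ k
     = \<gamma> m * (u m $ k - \<pi> m * w m $ k) + (w m * u m) $ k" for m
    by (simp add: algebra_simps)
  have "(\<lambda>m. \<gamma> m * (u m $ k - \<pi> m * w m $ k) + (w m * u m) $ k)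
    \<longlonglongrightarrow> (1 + \<sigma> - 0 * real k) * (U $ k - (1 + \<sigma>) ^ l * W $ k) + (W * U) $ k"
    by (intro tendsto_intros \<gamma> IH wu)
  moreover have "(1 + \<sigma> - 0 * real k) * (U $ k - (1 + \<sigma>) ^ l * W $ k) + (W * U) $ k
     = ((1 + W + fps_const \<sigma>) ^ Suc l * W) $ k - (1 + \<sigma>) ^ Suc l * W $ k"
  proof -
    have "((1 + W + fps_const \<sigma>) * U) $ k = (1 + \<sigma>) * U $ k + (W * U) $ k"
      by (simp add: distrib_right)
    then show ?thesis by (simp add: U_def mult.assoc right_diff_distrib)
  qed
  ultimately show ?case unfolding *[symmetric] by (simp add: \<gamma>_def \<pi>_def mult.commute)
qed simp

text \<open>Strong induction on the coefficient. The factor \<open>X\<close> makes the left side of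
  the differential equation depend on lower coefficients only; on the right the coefficient at
  \<open>k\<close> enters with a factor tending to \<open>(1 + \<sigma>)^q \<noteq> 0\<close>, so it
  can be solved for. The fixed parameters \<open>A\<close> disappear on division by the size, while
  the \<open>B\<close> leave \<open>\<sigma>\<close>.\<close>

lemma power_sums_tendsto:
  fixes X :: "nat \<Rightarrow> real multiset" and A :: "nat \<Rightarrow> real" and B :: "nat \<Rightarrow> nat \<Rightarrow> real"
    and W :: "real fps"
  assumes p: "\<And>m. p m = smult (c m) (root_poly (X m))" and c: "\<And>m. c m \<noteq> 0"
    and N: "filterlim (\<lambda>m. size (X m)) at_top sequentially"
    and rec: "\<And>m k. k < size (X m) \<Longrightarrow> real (k + 1) * (\<Prod>j=1..q. A j + real k) * coeff (p m) (k + 1) =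
                (real k - real (size (X m))) * (\<Prod>j=1..q. B m j + real k) * coeff (p m) k"
    and B: "\<And>j. j \<in> {1..q} \<Longrightarrow> (\<lambda>m. B m j / real (size (X m))) \<longlonglongrightarrow> \<sigma>"
    and \<sigma>: "\<sigma> \<noteq> -1"
    and W0: "W $ 0 = 0" and W: "fps_X * (1 + W) ^ (q + 1) = (1 + W + fps_const \<sigma>) ^ q * W"
  shows "(\<lambda>m. power_sums (X m) $ k / real (size (X m))) \<longlonglongrightarrow> (1 + W) $ k"
proof -
  define \<epsilon> where "\<epsilon> m = 1 / real (size (X m))" for m
  \<comment> \<open>The value 0 for an empty multiset keeps the constant term zero for every
    \<open>m\<close>, as \<open>tendsto_top_coeff\<close> requires.\<close>
  define w where "w m = (if size (X m) = 0 then 0 else fps_const (\<epsilon> m) * power_sums (X m) - 1)" for m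
  have ev: "eventually (\<lambda>m. size (X m) > 0) sequentially"
    using N eventually_gt_at_top[of 0] by (auto simp: filterlim_iff)
  have e: "\<epsilon> \<longlonglongrightarrow> 0"
    unfolding \<epsilon>_def
    by (intro tendsto_divide_0[OF tendsto_const] filterlim_at_top_imp_at_infinity
        filterlim_compose[OF filterlim_real_sequentially N])
  have B': "(\<lambda>m. B m j * \<epsilon> m) \<longlonglongrightarrow> \<sigma>" if "j \<in> {1..q}" for j
    using B[OF that] by (simp add: \<epsilon>_def)
  have A': "(\<lambda>m. (A j - 1) * \<epsilon> m) \<longlonglongrightarrow> 0" for j
    using tendsto_mult[OF tendsto_const e, of "A j - 1"] by simp
  have w0: "w m $ 0 = 0" for m
    by (simp add: w_def \<epsilon>_def power_sums_def)
  have eq: "eventually (\<lambda>m. fps_X * euler_op (1 + w m) (\<epsilon> m) 0 (euler_ops (1 + w m) (\<epsilon> m) (\<lambda>j. A j - 1) q 1)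
       = euler_ops (1 + w m) (\<epsilon> m) (B m) q (w m)) sequentially"
    using ev
  proof eventually_elim
    case (elim m)
    then have "X m \<noteq> {#}" by auto
    then have w: "w m = fps_const (1 / real (size (X m))) * power_sums (X m) - 1"
      and w1: "1 + w m = fps_const (1 / real (size (X m))) * power_sums (X m)"
      by (simp_all add: w_def \<epsilon>_def)
    show ?case
      using euler_equation[OF p c refl elim rec] by (simp only: w1) (simp only: w \<epsilon>_def)
  qed
  have main: "(\<lambda>m. w m $ k) \<longlonglongrightarrow> W $ k" for k
  proof (induction k rule: less_induct)
    case (less k)
    then have w: "coeffs_tendsto w W k" by (simp add: coeffs_tendsto_def)
    have h: "coeffs_tendsto (\<lambda>m. 1 + w m) (1 + W) k"
      using w by (intro coeffs_tendsto_add) (auto simp: coeffs_tendsto_def)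
    have "coeffs_tendsto (\<lambda>m. euler_op (1 + w m) (\<epsilon> m) 0 (euler_ops (1 + w m) (\<epsilon> m) (\<lambda>j. A j - 1) q 1))
        ((1 + W + fps_const 0) * ((1 + W + fps_const 0) ^ q * 1)) k"
      by (intro coeffs_tendsto_euler_op coeffs_tendsto_euler_ops h e A') (auto simp: coeffs_tendsto_def)
    then have "(\<lambda>m. (fps_X * euler_op (1 + w m) (\<epsilon> m) 0 (euler_ops (1 + w m) (\<epsilon> m) (\<lambda>j. A j - 1) q 1)) $ k)
        \<longlonglongrightarrow> (fps_X * (1 + W) ^ (q + 1)) $ k"
      by (cases k) (auto simp: coeffs_tendsto_def)
    then have lim: "(\<lambda>m. euler_ops (1 + w m) (\<epsilon> m) (B m) q (w m) $ k) \<longlonglongrightarrow> ((1 + W + fps_const \<sigma>) ^ q * W) $ k"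
      unfolding W by (rule Lim_transform_eventually) (use eq in eventually_elim, simp)
    define \<pi> where "\<pi> m = (\<Prod>j=1..q. 1 + B m j * \<epsilon> m - \<epsilon> m * real k)" for m
    have "\<pi> \<longlonglongrightarrow> (\<Prod>j=1..q. 1 + \<sigma> - 0 * real k)"
      unfolding \<pi>_def by (intro tendsto_intros e B')
    then have \<pi>: "\<pi> \<longlonglongrightarrow> (1 + \<sigma>) ^ q" by simp
    have nz: "(1 + \<sigma>) ^ q \<noteq> 0" using \<sigma> by (simp add: add_eq_0_iff)
    have "(\<lambda>m. \<pi> m * w m $ k) \<longlonglongrightarrow> (1 + \<sigma>) ^ q * W $ k"
      using tendsto_diff[OF lim tendsto_top_coeff[where s = B and l = q, OF w0 W0 w e B']] by (simp add: \<pi>_def)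
    from tendsto_divide[OF this \<pi> nz] have "(\<lambda>m. \<pi> m * w m $ k / \<pi> m) \<longlonglongrightarrow> W $ k"
      by (simp only: nonzero_mult_div_cancel_left[OF nz])
    then show ?case
      by (rule Lim_transform_eventually)
        (use tendsto_imp_eventually_ne[OF \<pi> nz] in eventually_elim, simp)
  qed
  have "(\<lambda>m. (1 + w m) $ k) \<longlonglongrightarrow> (1 + W) $ k"
    unfolding fps_add_nth by (intro tendsto_intros main)
  then show ?thesis
    by (rule Lim_transform_eventually) (use ev in eventually_elim, auto simp: w_def \<epsilon>_def)
qed

section \<open>Moments, weak convergence and S-transforms\<close>

lemma compact_nonneg_probD:
  assumes "compact_nonneg_prob \<nu>"
  shows "real_distribution \<nu>" "\<exists>C\<ge>1. AE x in \<nu>. 0 \<le> x \<and> x \<le> C"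
proof -
  show "real_distribution \<nu>"
    using assms by (simp add: compact_nonneg_prob_def real_distribution_def real_distribution_axioms_def)
  obtain c where c: "AE x in \<nu>. 0 \<le> x \<and> x \<le> c" using assms by (auto simp: compact_nonneg_prob_def)
  have "AE x in \<nu>. 0 \<le> x \<and> x \<le> max c 1" using c by eventually_elim auto
  then show "\<exists>C\<ge>1. AE x in \<nu>. 0 \<le> x \<and> x \<le> C" by (intro exI[of _ "max c 1"]) auto
qed

lemma compact_nonneg_prob_moment:
  assumes \<nu>: "real_distribution \<nu>" and C: "AE x in \<nu>. 0 \<le> x \<and> x \<le> C"
  shows "integrable \<nu> (\<lambda>x. x ^ k)" "(\<integral>x. x ^ k \<partial>\<nu>) \<le> C ^ k"
proof -
  interpret real_distribution \<nu> by (rule \<nu>)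
  have bd: "AE x in \<nu>. norm (x ^ k) \<le> C ^ k"
    using C by eventually_elim (simp add: power_mono)
  then show int: "integrable \<nu> (\<lambda>x. x ^ k)"
    by (intro integrable_const_bound[of _ "C ^ k"]) auto
  have "(\<integral>x. x ^ k \<partial>\<nu>) \<le> (\<integral>x. C ^ k \<partial>\<nu>)"
    using bd by (intro integral_mono_AE int) auto
  then show "(\<integral>x. x ^ k \<partial>\<nu>) \<le> C ^ k" by (simp add: prob_space[unfolded space_eq_univ])
qed

text \<open>The even power absorbs the tail of the test function minus its polynomial approximation;
  its integral is small because \<open>x \<le> R / 2\<close> almost surely in the limit.\<close>

lemma polynomial_majorant:
  fixes g :: "real \<Rightarrow> real"
  assumes g: "continuous_on UNIV g" and B: "\<And>x. \<bar>g x\<bar> \<le> B" and R: "R \<ge> 1" and e: "\<epsilon> > 0"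
  obtains a d D where "\<And>x L. d \<le> 2 * L \<Longrightarrow> \<bar>g x - (\<Sum>i\<le>d. a i * x ^ i)\<bar> \<le> \<epsilon> + D * (x / R) ^ (2 * L)"
    and "D \<ge> 0"
proof -
  obtain p where "real_polynomial_function p" and p: "\<And>x. x \<in> {- R..R} \<Longrightarrow> \<bar>g x - p x\<bar> < \<epsilon>"
    using Stone_Weierstrass_real_polynomial_function[OF compact_Icc continuous_on_subset[OF g subset_UNIV] e, of "- R" R]
    by auto
  then obtain a d where pa: "p = (\<lambda>x. \<Sum>i\<le>d. a i * x ^ i)"
    by (auto simp: real_polynomial_function_iff_sum)
  define A where "A = B + (\<Sum>i\<le>d. \<bar>a i\<bar>)"
  have "0 \<le> B" using B[of 0] by linarith
  then have A: "A \<ge> 0" by (simp add: A_def sum_nonneg)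
  show thesis
  proof (rule that[of d a "A * R ^ d"])
    show "0 \<le> A * R ^ d" using A R by simp
    fix x L assume L: "d \<le> 2 * L"
    have nn: "0 \<le> A * R ^ d * (x / R) ^ (2 * L)" using A R by (simp add: power_mult)
    have "\<bar>g x - p x\<bar> \<le> \<epsilon> + A * R ^ d * (x / R) ^ (2 * L)"
    proof (cases "\<bar>x\<bar> \<le> R")
      case True
      then have "x \<in> {- R..R}" by auto
      from p[OF this] nn show ?thesis by linarith
    next
      case False
      then have x: "R \<le> \<bar>x\<bar>" "1 \<le> \<bar>x\<bar>" using R by auto
      have "\<bar>p x\<bar> \<le> (\<Sum>i\<le>d. \<bar>a i * x ^ i\<bar>)" unfolding pa by (rule sum_abs)
      also have "\<dots> \<le> (\<Sum>i\<le>d. \<bar>a i\<bar> * \<bar>x\<bar> ^ d)"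
        using x by (intro sum_mono) (simp add: abs_mult power_abs mult_left_mono power_increasing)
      finally have "\<bar>p x\<bar> \<le> (\<Sum>i\<le>d. \<bar>a i\<bar>) * \<bar>x\<bar> ^ d" by (simp add: sum_distrib_right)
      moreover have "B \<le> B * \<bar>x\<bar> ^ d" using \<open>0 \<le> B\<close> x by (simp add: mult_le_cancel_left1 one_le_power)
      moreover have "\<bar>g x - p x\<bar> \<le> \<bar>g x\<bar> + \<bar>p x\<bar>" by simp
      ultimately have "\<bar>g x - p x\<bar> \<le> A * \<bar>x\<bar> ^ d" using B[of x] by (simp add: A_def distrib_right)
      also have "\<bar>x\<bar> ^ d = R ^ d * (\<bar>x\<bar> / R) ^ d" using R by (simp add: power_divide)
      also have "(\<bar>x\<bar> / R) ^ d \<le> (\<bar>x\<bar> / R) ^ (2 * L)"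
        using x R L by (intro power_increasing) auto
      also have "(\<bar>x\<bar> / R) ^ (2 * L) = (x / R) ^ (2 * L)" using R by (simp add: power_mult power_divide)
      finally show ?thesis using A R e by (simp add: mult_left_mono mult.assoc)
    qed
    then show "\<bar>g x - (\<Sum>i\<le>d. a i * x ^ i)\<bar> \<le> \<epsilon> + A * R ^ d * (x / R) ^ (2 * L)" by (simp add: pa)
  qed
qed

text \<open>The measures \<open>M m\<close> may lack a common bounded support: one convergent even
  moment controls their tails. Its order \<open>2 * L\<close> is chosen from \<open>\<nu>\<close>
  alone, before \<open>m\<close> tends to infinity.\<close>

lemma moments_imp_weak_convergence:
  fixes g :: "real \<Rightarrow> real" and M :: "nat \<Rightarrow> real measure"
  assumes M: "\<And>m. real_distribution (M m)" and int: "\<And>m k. integrable (M m) (\<lambda>x. x ^ k)"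
    and \<nu>: "compact_nonneg_prob \<nu>"
    and lim: "\<And>k. (\<lambda>m. \<integral>x. x ^ k \<partial>M m) \<longlonglongrightarrow> (\<integral>x. x ^ k \<partial>\<nu>)"
    and g: "continuous_on UNIV g" and bdd: "bounded (range g)"
  shows "(\<lambda>m. \<integral>x. g x \<partial>M m) \<longlonglongrightarrow> (\<integral>x. g x \<partial>\<nu>)"
proof (rule LIMSEQ_I)
  fix \<epsilon>0 :: real assume \<epsilon>0: "\<epsilon>0 > 0"
  \<comment> \<open>Replacing \<open>g\<close> by its polynomial costs less than
    \<open>2 * \<epsilon>\<close> for \<open>M m\<close> and again for \<open>\<nu>\<close>; the
    polynomial integrals differ by less than \<open>\<epsilon>\<close>.\<close>
  define \<epsilon> where "\<epsilon> = \<epsilon>0 / 5"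
  have e: "\<epsilon> > 0" using \<epsilon>0 by (simp add: \<epsilon>_def)
  obtain B where B: "\<And>x. \<bar>g x\<bar> \<le> B" using bdd by (auto simp: bounded_iff)
  obtain C where C: "C \<ge> 1" "AE x in \<nu>. 0 \<le> x \<and> x \<le> C" using compact_nonneg_probD(2)[OF \<nu>] by auto
  note \<nu>d = compact_nonneg_probD(1)[OF \<nu>]
  note \<nu>int = compact_nonneg_prob_moment[OF \<nu>d C(2)]
  define R where "R = 2 * C"
  have R: "R \<ge> 1" using C by (simp add: R_def)
  obtain a d D where maj: "\<And>x L. d \<le> 2 * L \<Longrightarrow> \<bar>g x - (\<Sum>i\<le>d. a i * x ^ i)\<bar> \<le> \<epsilon> + D * (x / R) ^ (2 * L)"
    and D: "D \<ge> 0" using polynomial_majorant[OF g B R e] by metis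
  have "(\<lambda>n. D * (1 / 2) ^ n) \<longlonglongrightarrow> D * 0" by (intro tendsto_intros LIMSEQ_realpow_zero) auto
  then have "eventually (\<lambda>n. D * (1 / 2) ^ n < \<epsilon>) sequentially" using e by (intro order_tendstoD) auto
  then obtain n0 where n0: "\<And>n. n \<ge> n0 \<Longrightarrow> D * (1 / 2) ^ n < \<epsilon>" by (auto simp: eventually_sequentially)
  define L where "L = n0 + d"
  have L: "d \<le> 2 * L" "D * (1 / 2) ^ (2 * L) < \<epsilon>" using n0[of "2 * L"] by (auto simp: L_def)
  define I where "I K = (\<integral>x. (x / R) ^ (2 * L) \<partial>K)" for K
  define P where "P K = (\<integral>x. (\<Sum>i\<le>d. a i * x ^ i) \<partial>K)" for K
  have approx: "\<bar>(\<integral>x. g x \<partial>K) - P K\<bar> \<le> \<epsilon> + D * I K"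
    if K: "real_distribution K" "\<And>k. integrable K (\<lambda>x. x ^ k)" for K
  proof -
    interpret K: real_distribution K by (rule K)
    have [measurable]: "g \<in> borel_measurable borel" using g by (rule borel_measurable_continuous_onI)
    have gi: "integrable K g" using B by (intro K.integrable_const_bound[of _ B]) auto
    have pi: "integrable K (\<lambda>x. \<Sum>i\<le>d. a i * x ^ i)" using K(2) by auto
    have Ii: "integrable K (\<lambda>x. (x / R) ^ (2 * L))" using K(2) by (simp add: power_divide)
    have "\<bar>(\<integral>x. g x \<partial>K) - P K\<bar> = \<bar>\<integral>x. g x - (\<Sum>i\<le>d. a i * x ^ i) \<partial>K\<bar>"
      unfolding P_def using gi pi by simp
    also have "\<dots> \<le> (\<integral>x. \<bar>g x - (\<Sum>i\<le>d. a i * x ^ i)\<bar> \<partial>K)" by (rule integral_abs_bound)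
    also have "\<dots> \<le> (\<integral>x. \<epsilon> + D * (x / R) ^ (2 * L) \<partial>K)"
      using maj[OF L(1)] gi pi Ii by (intro integral_mono) auto
    also have "\<dots> = \<epsilon> + D * I K" using Ii by (simp add: I_def K.prob_space[unfolded K.space_eq_univ])
    finally show ?thesis .
  qed
  have Ieq: "I K = (\<integral>x. x ^ (2 * L) \<partial>K) / R ^ (2 * L)" for K by (simp add: I_def power_divide)
  have "I \<nu> \<le> C ^ (2 * L) / R ^ (2 * L)"
    unfolding Ieq using R \<nu>int(2)[of "2 * L"] by (intro divide_right_mono) auto
  also have "\<dots> = (C / R) ^ (2 * L)" by (simp only: power_divide)
  also have "C / R = 1 / 2" using C by (simp add: R_def)
  finally have I\<nu>: "D * I \<nu> < \<epsilon>" using L(2) D by (meson mult_left_mono order_le_less_trans)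
  have "(\<lambda>m. D * I (M m)) \<longlonglongrightarrow> D * I \<nu>"
    unfolding Ieq using R by (intro tendsto_intros lim) auto
  then have ev1: "eventually (\<lambda>m. D * I (M m) < \<epsilon>) sequentially" using I\<nu> by (rule order_tendstoD)
  have Peq: "P K = (\<Sum>i\<le>d. a i * (\<integral>x. x ^ i \<partial>K))" if "\<And>k. integrable K (\<lambda>x. x ^ k)" for K
    unfolding P_def using that by (simp add: Bochner_Integration.integral_sum)
  have "(\<lambda>m. P (M m)) \<longlonglongrightarrow> P \<nu>"
    unfolding Peq[OF int] Peq[OF \<nu>int(1)] by (intro tendsto_intros lim)
  then have ev2: "eventually (\<lambda>m. \<bar>P (M m) - P \<nu>\<bar> < \<epsilon>) sequentially"
    using e by (auto simp: tendsto_iff dist_real_def)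
  have "eventually (\<lambda>m. norm ((\<integral>x. g x \<partial>M m) - (\<integral>x. g x \<partial>\<nu>)) < \<epsilon>0) sequentially"
    using ev1 ev2
  proof eventually_elim
    case (elim m)
    then show ?case
      using approx[OF M int, of m] approx[OF \<nu>d \<nu>int(1)] I\<nu> unfolding \<epsilon>_def real_norm_def by linarith
  qed
  then show "\<exists>no. \<forall>m\<ge>no. norm ((\<integral>x. g x \<partial>M m) - (\<integral>x. g x \<partial>\<nu>)) < \<epsilon>0"
    by (simp add: eventually_sequentially)
qed

text \<open>A constant sequence converges weakly by its moments, so bounded continuous functions
  have equal integrals under both measures. Cosines and sines then give equal characteristic
  functions.\<close>

lemma compact_nonneg_prob_eqI:
  assumes \<rho>: "compact_nonneg_prob \<rho>" and \<rho>': "compact_nonneg_prob \<rho>'"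
    and eq: "\<And>k. (\<integral>x. x ^ k \<partial>\<rho>) = (\<integral>x. x ^ k \<partial>\<rho>')"
  shows "\<rho> = \<rho>'"
proof -
  interpret \<rho>: real_distribution \<rho> by (rule compact_nonneg_probD[OF \<rho>])
  interpret \<rho>': real_distribution \<rho>' by (rule compact_nonneg_probD[OF \<rho>'])
  have int: "integrable \<rho> (\<lambda>x. x ^ k)" for k
    using compact_nonneg_probD[OF \<rho>] compact_nonneg_prob_moment by blast
  have *: "(\<integral>x. g x \<partial>\<rho>) = (\<integral>x. g x \<partial>\<rho>')" if "continuous_on UNIV g" "bounded (range g)" for g :: "real \<Rightarrow> real"
    using moments_imp_weak_convergence[of "\<lambda>_. \<rho>" \<rho>' g] that \<rho>.real_distribution_axioms int \<rho>' eq
    by (simp add: LIMSEQ_const_iff)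
  have c: "(\<integral>x. cos (t * x) \<partial>\<rho>) = (\<integral>x. cos (t * x) \<partial>\<rho>')" "(\<integral>x. sin (t * x) \<partial>\<rho>) = (\<integral>x. sin (t * x) \<partial>\<rho>')" for t
    by (intro * continuous_intros boundedI[of _ 1]; auto)+
  have iexp_int: "integrable K (\<lambda>x. iexp (t * x))" if "real_distribution K" for K t
  proof -
    interpret K: real_distribution K by (rule that)
    show ?thesis by (intro K.integrable_const_bound[of _ 1]) auto
  qed
  have "char \<rho> t = char \<rho>' t" for t
  proof (rule complex_eqI)
    show "Re (char \<rho> t) = Re (char \<rho>' t)"
      using c(1)[of t] iexp_int[OF \<rho>.real_distribution_axioms] iexp_int[OF \<rho>'.real_distribution_axioms]
      unfolding char_def by (simp add: Re_exp flip: integral_Re)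
    show "Im (char \<rho> t) = Im (char \<rho>' t)"
      using c(2)[of t] iexp_int[OF \<rho>.real_distribution_axioms] iexp_int[OF \<rho>'.real_distribution_axioms]
      unfolding char_def by (simp add: Im_exp flip: integral_Im)
  qed
  then show ?thesis
    by (intro Levy_uniqueness \<rho>.real_distribution_axioms \<rho>'.real_distribution_axioms) auto
qed

section \<open>S-transforms and uniqueness of the convolution\<close>

lemma moment_series_nth_0 [simp]: "moment_series \<mu> $ 0 = 0"
  by (simp add: moment_series_def)

lemma fps_inv_nth_0 [simp]: "fps_inv a $ 0 = 0" and fps_inv_nth_1: "fps_inv a $ 1 = 1 / a $ 1"
  by (simp_all add: fps_inv_def)

text \<open>Composition with the inverse \<open>I\<close> of the moment series turns the equation
  into \<open>I (1 + X)^(q+1) = (1 + X + \<sigma>)^q X\<close>, which is explicit in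
  \<open>I\<close>. The inverse exists because the left side of \<open>eq\<close> has linear
  coefficient 1, forcing a nonzero mean.\<close>

lemma S_transform_eqI:
  fixes q :: nat
  assumes eq: "fps_X * (1 + moment_series \<mu>) ^ (q + 1) = (1 + moment_series \<mu> + fps_const \<sigma>) ^ q * moment_series \<mu>"
  shows "S_transform \<mu> = ((1 + fps_X + fps_const \<sigma>) * inverse (1 + fps_X)) ^ q"
proof -
  define W where "W = moment_series \<mu>"
  define I where "I = fps_inv W"
  have W0: "W $ 0 = 0" by (simp add: W_def)
  have W1: "W $ 1 \<noteq> 0"
  proof
    assume "W $ 1 = 0"
    then have "((1 + W + fps_const \<sigma>) ^ q * W) $ 1 = 0" using W0 by (simp add: fps_mult_nth_1)
    moreover have "(fps_X * (1 + W) ^ (q + 1)) $ 1 = 1" using W0 by (simp add: fps_power_zeroth)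
    ultimately show False using eq unfolding W_def[symmetric] by (metis zero_neq_one)
  qed
  have I0: "I $ 0 = 0" by (simp add: I_def)
  have WI: "W oo I = fps_X" unfolding I_def using W0 W1 by (rule fps_inv_right)
  have "(fps_X * (1 + W) ^ (q + 1)) oo I = ((1 + W + fps_const \<sigma>) ^ q * W) oo I"
    using eq by (simp add: W_def)
  then have "I * (1 + fps_X) ^ (q + 1) = (1 + fps_X + fps_const \<sigma>) ^ q * fps_X"
    using I0 by (simp only: fps_compose_mult_distrib[OF I0] fps_compose_power[OF I0, symmetric] fps_compose_add_distrib WI fps_X_fps_compose_startby0 fps_compose_1 fps_const_compose)
  moreover have inv: "(1 + fps_X :: real fps) * inverse (1 + fps_X) = 1"
    by (simp add: inverse_mult_eq_1')
  ultimately have "I * (1 + fps_X) = fps_X * ((1 + fps_X + fps_const \<sigma>) * inverse (1 + fps_X)) ^ q"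
  proof -
    have "I * (1 + fps_X) = I * (1 + fps_X) * ((1 + fps_X) * inverse (1 + fps_X)) ^ q" by (simp add: inv)
    also have "\<dots> = (I * (1 + fps_X) ^ (q + 1)) * inverse (1 + fps_X) ^ q"
      by (simp add: power_mult_distrib mult_ac)
    also have "\<dots> = fps_X * ((1 + fps_X + fps_const \<sigma>) * inverse (1 + fps_X)) ^ q"
      unfolding \<open>I * (1 + fps_X) ^ (q + 1) = _\<close> by (simp add: power_mult_distrib mult_ac)
    finally show ?thesis .
  qed
  then show ?thesis
    unfolding S_transform_def W_def[symmetric] I_def[symmetric]
    by (simp only: add.commute[of fps_X 1] nonzero_mult_div_cancel_left[OF fps_X_neq_zero])
qed

text \<open>The constant term of the S-transform is the inverse of the mean, with
  \<open>1 / 0 = 0\<close>. Its nonvanishing therefore excludes a zero mean and makes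
  \<open>fps_inv\<close> an involution.\<close>

lemma S_transform_inj:
  assumes eq: "S_transform \<mu> = S_transform \<nu>" and nz: "S_transform \<mu> $ 0 \<noteq> 0"
  shows "moment_series \<mu> = moment_series \<nu>"
proof -
  have S: "S_transform \<mu> = fps_shift 1 (fps_inv (moment_series \<mu>)) * (1 + fps_X)" for \<mu>
  proof -
    have "fps_inv (moment_series \<mu>) = fps_X * fps_shift 1 (fps_inv (moment_series \<mu>))"
      by (rule fps_ext) (simp add: fps_inv_def[of "moment_series \<mu>"])
    then have "fps_inv (moment_series \<mu>) * (fps_X + 1) = fps_X * (fps_shift 1 (fps_inv (moment_series \<mu>)) * (1 + fps_X))"
      by (metis mult.assoc add.commute)
    then show ?thesis
      by (simp only: S_transform_def nonzero_mult_div_cancel_left[OF fps_X_neq_zero])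
  qed
  have inv: "moment_series \<mu> = fps_inv (fps_inv (moment_series \<mu>))" if "S_transform \<mu> $ 0 \<noteq> 0" for \<mu>
  proof -
    have "fps_inv (moment_series \<mu>) $ 1 \<noteq> 0" using that by (simp add: S)
    then have "moment_series \<mu> $ 1 \<noteq> 0" by (auto simp: fps_inv_nth_1[unfolded One_nat_def])
    then show ?thesis by (simp add: fps_inv_idempotent)
  qed
  have "fps_shift 1 (fps_inv (moment_series \<mu>)) = fps_shift 1 (fps_inv (moment_series \<nu>))"
  proof -
    have "(1 + fps_X :: real fps) $ 0 \<noteq> 0" by simp
    then have "(1 + fps_X :: real fps) \<noteq> 0" by (metis fps_zero_nth)
    then show ?thesis using eq unfolding S by simp
  qed
  then have sh: "fps_inv (moment_series \<mu>) $ (n + 1) = fps_inv (moment_series \<nu>) $ (n + 1)" for n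
    by (metis fps_shift_nth)
  have "fps_inv (moment_series \<mu>) = fps_inv (moment_series \<nu>)"
  proof (rule fps_ext)
    show "fps_inv (moment_series \<mu>) $ n = fps_inv (moment_series \<nu>) $ n" for n
      using sh[of "n - 1"] by (cases n) simp_all
  qed
  then show ?thesis using inv[OF nz] inv[of \<nu>] nz eq by simp
qed

lemma free_mult_conv_eqI:
  assumes \<rho>: "compact_nonneg_prob \<rho>" and S: "S_transform \<rho> = S_transform \<mu> * S_transform \<nu>"
    and nz: "S_transform \<rho> $ 0 \<noteq> 0"
  shows "\<mu> \<boxtimes> \<nu> = \<rho>"
  unfolding free_mult_conv_def
proof (rule the_equality)
  fix \<rho>' assume \<rho>': "compact_nonneg_prob \<rho>' \<and> S_transform \<rho>' = S_transform \<mu> * S_transform \<nu>"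
  then have m: "moment_series \<rho> = moment_series \<rho>'" using S_transform_inj S nz by metis
  show "\<rho>' = \<rho>"
  proof (rule compact_nonneg_prob_eqI)
    interpret \<rho>: real_distribution \<rho> by (rule compact_nonneg_probD[OF \<rho>])
    interpret \<rho>': real_distribution \<rho>' by (rule compact_nonneg_probD[OF conjunct1[OF \<rho>']])
    show "(\<integral>x. x ^ k \<partial>\<rho>') = (\<integral>x. x ^ k \<partial>\<rho>)" for k
      using arg_cong[OF m, of "\<lambda>f. f $ k"]
      by (cases "k = 0") (auto simp: moment_series_def \<rho>.prob_space[unfolded \<rho>.space_eq_univ] \<rho>'.prob_space[unfolded \<rho>'.space_eq_univ])
  qed (use \<rho> \<rho>' in auto)
qed (use \<rho> S in auto)

text \<open>Each convolution is evaluated only through a witness, hence a whole family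
  \<open>\<rho>\<close> of candidates, one per intermediate power.\<close>

lemma free_mult_power_eqI:
  assumes \<rho>: "\<And>k. k \<le> r \<Longrightarrow> compact_nonneg_prob (\<rho> k)"
    and S: "\<And>k. k \<le> r \<Longrightarrow> S_transform (\<rho> k) = S_transform \<mu> ^ k"
    and \<rho>0: "\<rho> 0 = return borel 1" and nz: "S_transform \<mu> $ 0 \<noteq> 0"
  shows "k \<le> r \<Longrightarrow> free_mult_power \<mu> k = \<rho> k"
proof (induction k)
  case (Suc k)
  then show ?case
    using \<rho>[of "Suc k"] S[of "Suc k"] S[of k] nz
    by (auto intro!: free_mult_conv_eqI simp: mult.commute fps_power_zeroth)
qed (simp add: \<rho>0)

section \<open>Polynomials with zeros in the unit interval\<close>

lemma of_real_poly_map_mult: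
  "map_poly complex_of_real (p * q) = map_poly complex_of_real p * map_poly complex_of_real q"
  by (rule poly_eqI) (simp add: coeff_map_poly coeff_mult)

lemma map_poly_of_real_root_poly:
  "map_poly complex_of_real (root_poly X) = (\<Prod>x\<in>#X. [:- complex_of_real x, 1:])"
proof (induction X)
  case (add x X)
  have "map_poly complex_of_real (root_poly (add_mset x X)) = map_poly complex_of_real ([:- x, 1:] * root_poly X)"
    by (simp add: root_poly_def)
  also have "\<dots> = map_poly complex_of_real [:- x, 1:] * map_poly complex_of_real (root_poly X)"
    by (rule of_real_poly_map_mult)
  finally show ?case by (simp add: add map_poly_pCons del: mult_pCons_left)
qed (simp add: root_poly_def)

lemma real_rooted_split:
  fixes p :: "real poly"
  assumes p: "p \<noteq> 0"
    and roots: "\<And>z. poly (map_poly complex_of_real p) z = 0 \<Longrightarrow> z \<in> \<real> \<and> Q (Re z)"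
  obtains X where "p = smult (lead_coeff p) (root_poly X)"
    "proots (map_poly complex_of_real p) = image_mset complex_of_real X" "\<And>x. x \<in># X \<Longrightarrow> Q x"
proof -
  define P where "P = map_poly complex_of_real p"
  define X where "X = image_mset Re (proots P)"
  have P0: "P \<noteq> 0" using p by (simp add: P_def map_poly_eq_0_iff)
  have Z: "z \<in> \<real> \<and> Q (Re z)" if "z \<in># proots P" for z
    using that P0 roots[of z] by (simp add: P_def)
  have X: "image_mset complex_of_real X = proots P"
  proof -
    have "image_mset complex_of_real X = image_mset (\<lambda>z. z) (proots P)"
      unfolding X_def multiset.map_comp
      using Z by (intro image_mset_cong) (auto simp: complex_is_Real_iff complex_eq_iff)
    then show ?thesis by simp
  qed
  have "smult (lead_coeff P) (\<Prod>x\<in>#proots P. [:- x, 1:]) = P"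
    by (rule complex_poly_decompose_multiset)
  moreover have "(\<Prod>x\<in>#proots P. [:- x, 1:]) = map_poly complex_of_real (root_poly X)"
    unfolding map_poly_of_real_root_poly X[symmetric] by (simp add: multiset.map_comp comp_def)
  moreover have "lead_coeff P = of_real (lead_coeff p)"
    by (simp add: P_def coeff_map_poly degree_map_poly)
  ultimately have eq: "P = smult (of_real (lead_coeff p)) (map_poly complex_of_real (root_poly X))" by simp
  have "p = smult (lead_coeff p) (root_poly X)"
  proof (rule poly_eqI)
    fix k
    have "complex_of_real (coeff p k) = complex_of_real (coeff (smult (lead_coeff p) (root_poly X)) k)"
      using arg_cong[OF eq, of "\<lambda>P. coeff P k"] by (simp add: P_def coeff_map_poly)
    then show "coeff p k = coeff (smult (lead_coeff p) (root_poly X)) k" by (simp only: of_real_eq_iff)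
  qed
  moreover have "Q x" if "x \<in># X" for x using that Z by (auto simp: X_def)
  ultimately show thesis using X by (intro that[of X]) (simp_all add: P_def)
qed

definition theta :: "real \<Rightarrow> real poly \<Rightarrow> real poly" where
  "theta s p = smult s p + pCons 0 (pderiv p)"

lemma coeff_theta: "coeff (theta s p) k = (s + real k) * coeff p k"
  by (cases k) (simp_all add: theta_def coeff_pderiv algebra_simps)

definition unit_rooted :: "real poly \<Rightarrow> bool" where
  "unit_rooted p \<longleftrightarrow> (\<exists>c X. c \<noteq> 0 \<and> p = smult c (root_poly X) \<and> (\<forall>x\<in>#X. 0 < x \<and> x \<le> 1))"

lemma poly_pderiv_linear_factors:
  fixes z :: complex
  assumes "\<And>x. x \<in># X \<Longrightarrow> z \<noteq> x"
  shows "poly (pderiv (\<Prod>x\<in>#X. [:- x, 1:])) z = poly (\<Prod>x\<in>#X. [:- x, 1:]) z * (\<Sum>x\<in>#X. 1 / (z - x))"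
  using assms
proof (induction X)
  case (add x X)
  define F where "F = (\<Prod>x\<in>#X. [:- x, 1:])"
  have "z - x \<noteq> 0" using add.prems[of x] by simp
  have "pderiv ([:- x, 1:] * F) = [:- x, 1:] * pderiv F + F"
    by (simp only: pderiv_mult) (simp add: pderiv_pCons)
  then have "poly (pderiv ([:- x, 1:] * F)) z = (z - x) * poly (pderiv F) z + poly F z"
    by (simp only: poly_add poly_mult) simp
  also have "\<dots> = (z - x) * (poly F z * (\<Sum>x\<in>#X. 1 / (z - x))) + poly F z"
    using add unfolding F_def by simp
  also have "\<dots> = ((z - x) * poly F z) * (1 / (z - x) + (\<Sum>x\<in>#X. 1 / (z - x)))"
    using \<open>z - x \<noteq> 0\<close> by (simp add: divide_simps) (simp add: algebra_simps)
  also have "(z - x) * poly F z = poly ([:- x, 1:] * F) z"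
    by (simp only: poly_mult) simp
  finally show ?case by (simp add: F_def del: mult_pCons_left)
qed simp

lemma Re_sum_mset: "Re (\<Sum>x\<in>#X. f x) = (\<Sum>x\<in>#X. Re (f x))"
  and Im_sum_mset: "Im (\<Sum>x\<in>#X. f x) = (\<Sum>x\<in>#X. Im (f x))"
  by (induction X) simp_all

lemma sum_mset_nonneg_real:
  fixes f :: "'a \<Rightarrow> real"
  assumes "\<And>x. x \<in># X \<Longrightarrow> 0 \<le> f x"
  shows "0 \<le> (\<Sum>x\<in>#X. f x)"
  using assms by (induction X) auto

text \<open>At a zero of \<open>s p + x p'\<close> outside the zeros of \<open>p\<close> one has
  \<open>s + \<Sum> z / (z - x) = 0\<close>; each summand has imaginary part of the sign of \<open>- Im z\<close>, and is
  nonnegative for real \<open>z\<close> outside \<open>(0, 1]\<close>.\<close>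

lemma unit_rooted_theta:
  assumes p: "unit_rooted p" and s: "s > 0"
  shows "unit_rooted (theta s p)"
proof -
  obtain c X where c: "c \<noteq> 0" and pX: "p = smult c (root_poly X)" and X: "\<And>x. x \<in># X \<Longrightarrow> 0 < x \<and> x \<le> 1"
    using p by (auto simp: unit_rooted_def)
  have "coeff (theta s p) (degree p) \<noteq> 0"
    using c s lead_coeff_root_poly[of X] by (simp add: coeff_theta pX)
  then have nz: "theta s p \<noteq> 0" by auto
  have "z \<in> \<real> \<and> (0 < Re z \<and> Re z \<le> 1)" if z: "poly (map_poly complex_of_real (theta s p)) z = 0" for z
  proof (cases "\<exists>x\<in>#X. z = complex_of_real x")
    case False
    define F where "F = (\<Prod>x\<in>#image_mset complex_of_real X. [:- x, 1:])"
    have Fz: "poly F z \<noteq> 0" using False by (auto simp: F_def poly_prod_mset)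
    have "map_poly complex_of_real p = smult (of_real c) F"
      unfolding pX F_def by (rule poly_eqI)
        (simp add: coeff_map_poly multiset.map_comp comp_def flip: map_poly_of_real_root_poly)
    moreover have "map_poly complex_of_real (theta s p)
       = smult (of_real s) (map_poly complex_of_real p) + pCons 0 (pderiv (map_poly complex_of_real p))"
      by (rule poly_eqI) (simp add: theta_def coeff_map_poly coeff_pCons coeff_pderiv split: nat.split)
    ultimately have "of_real c * (of_real s * poly F z + z * poly (pderiv F) z) = 0"
      using z by (simp add: pderiv_smult algebra_simps)
    then have "of_real s * poly F z + z * poly (pderiv F) z = 0" using c by simp
    moreover have "poly (pderiv F) z = poly F z * (\<Sum>x\<in>#image_mset complex_of_real X. 1 / (z - x))"
      unfolding F_def using False by (intro poly_pderiv_linear_factors) auto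
    ultimately have "poly F z * (of_real s + z * (\<Sum>x\<in>#image_mset complex_of_real X. 1 / (z - x))) = 0"
      by (simp only: distrib_left mult_ac)
    then have "of_real s + z * (\<Sum>x\<in>#image_mset complex_of_real X. 1 / (z - x)) = 0"
      using Fz by (simp only: mult_eq_0_iff) simp
    moreover have "z * (\<Sum>x\<in>#image_mset complex_of_real X. 1 / (z - x)) = (\<Sum>x\<in>#X. z / (z - of_real x))"
      by (simp add: sum_mset_distrib_left multiset.map_comp comp_def)
    ultimately have eq: "of_real s + (\<Sum>x\<in>#X. z / (z - of_real x)) = 0" by simp
    have Im0: "(\<Sum>x\<in>#X. Im (z / (z - of_real x))) = 0"
      and Re0: "s + (\<Sum>x\<in>#X. Re (z / (z - of_real x))) = 0"
      using arg_cong[OF eq, of Im] arg_cong[OF eq, of Re] by (simp_all add: Re_sum_mset Im_sum_mset)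
    have Xne: "X \<noteq> {#}" using Re0 s by auto
    have Im: "Im (z / (z - of_real x)) = - Im z * (x / (cmod (z - of_real x))\<^sup>2)" for x
      by (simp add: Im_divide cmod_power2 field_simps)
    have "(\<Sum>x\<in>#X. Im (z / (z - of_real x))) = - Im z * (\<Sum>x\<in>#X. x / (cmod (z - of_real x))\<^sup>2)"
      unfolding Im by (simp add: sum_mset_distrib_left)
    moreover have "0 < (\<Sum>x\<in>#Y. x / (cmod (z - of_real x))\<^sup>2)" if "Y \<subseteq># X" "Y \<noteq> {#}" for Y
      using that
    proof (induction Y)
      case (add y Y)
      have "y \<in># X" using add.prems by (meson mset_subset_eqD union_single_eq_member)
      then have "0 < y / (cmod (z - of_real y))\<^sup>2" using X[of y] False by (intro divide_pos_pos) auto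
      moreover have "0 \<le> (\<Sum>x\<in>#Y. x / (cmod (z - of_real x))\<^sup>2)"
      proof (cases "Y = {#}")
        case False
        then show ?thesis using add.IH add.prems by (simp add: less_imp_le mset_subset_eq_insertD subset_mset.less_imp_le)
      qed simp
      ultimately show ?case by simp
    qed simp
    ultimately have Imz: "Im z = 0" using Im0 Xne by (metis less_irrefl mult_eq_0_iff neg_equal_0_iff_equal subset_mset.order_refl)
    have "0 < Re z \<and> Re z \<le> 1"
    proof (rule ccontr)
      assume neg: "\<not> (0 < Re z \<and> Re z \<le> 1)"
      have zz: "z = of_real (Re z)" using Imz by (simp add: complex_eq_iff)
      have "0 \<le> Re (z / (z - of_real x))" if "x \<in># X" for x
      proof -
        have "z / (z - of_real x) = of_real (Re z / (Re z - x))"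
          by (subst (1 2) zz) (simp only: of_real_diff[symmetric] of_real_divide[symmetric])
        then show ?thesis using neg X[OF that] by (auto simp: zero_le_divide_iff)
      qed
      then have "0 \<le> (\<Sum>x\<in>#X. Re (z / (z - of_real x)))"
        by (rule sum_mset_nonneg_real)
      then show False using Re0 s by simp
    qed
    then show ?thesis using Imz by (simp add: complex_is_Real_iff)
  qed (use X in auto)
  from real_rooted_split[OF nz this] obtain Y where
    "theta s p = smult (lead_coeff (theta s p)) (root_poly Y)" "\<And>x. x \<in># Y \<Longrightarrow> 0 < x \<and> x \<le> 1"
    by metis
  then show ?thesis using nz unfolding unit_rooted_def by (metis leading_coeff_0_iff)
qed

text \<open>The product equals \<open>n! (n+1)_k / (1)_k\<close>, so the multiplier adds
  \<open>q\<close> upper parameters \<open>n + 1\<close> and \<open>q\<close> lower parameters 1 to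
  a hypergeometric polynomial. It is realized by \<open>q\<close> rounds of \<open>theta s\<close>
  for \<open>s = 1, ..., n\<close>.\<close>

lemma unit_rooted_multiplier:
  assumes p: "unit_rooted p"
  obtains p' where "unit_rooted p'" "\<And>k. coeff p' k = (\<Prod>i=1..n. real i + real k) ^ q * coeff p k"
proof -
  have 1: "\<exists>p'. unit_rooted p' \<and> (\<forall>k. coeff p' k = (\<Prod>i=1..n. real i + real k) * coeff p k)"
    if "unit_rooted p" for p n
  proof (induction n)
    case (Suc n)
    then obtain p' where p': "unit_rooted p'" "\<And>k. coeff p' k = (\<Prod>i=1..n. real i + real k) * coeff p k" by blast
    have "unit_rooted (theta (real (Suc n)) p')" using p'(1) by (rule unit_rooted_theta) simp
    then show ?case by (intro exI[of _ "theta (real (Suc n)) p'"]) (simp add: coeff_theta p'(2) mult_ac)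
  qed (use that in auto)
  have "\<exists>p'. unit_rooted p' \<and> (\<forall>k. coeff p' k = (\<Prod>i=1..n. real i + real k) ^ q * coeff p k)"
  proof (induction q)
    case (Suc q)
    then obtain p' where p': "unit_rooted p'" "\<And>k. coeff p' k = (\<Prod>i=1..n. real i + real k) ^ q * coeff p k" by blast
    from 1[OF p'(1), of n] p'(2) show ?case by (auto simp: mult_ac)
  qed (use p in auto)
  then show thesis using that by blast
qed

section \<open>Empirical measures and their limits\<close>

definition empirical :: "real multiset \<Rightarrow> real measure" where
  "empirical X = distr (measure_pmf (pmf_of_multiset X)) borel (\<lambda>x. x)"

lemma integral_pmf_of_multiset:
  fixes f :: "'a \<Rightarrow> real"
  assumes "X \<noteq> {#}"
  shows "(\<integral>x. f x \<partial>measure_pmf (pmf_of_multiset X)) = (\<Sum>x\<in>#X. f x) / real (size X)"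
proof -
  \<comment> \<open>The index set is relaxed to a fixed finite superset \<open>S\<close>, because
    the support changes during the induction on \<open>Y\<close>.\<close>
  have "(\<Sum>x\<in>S. real (count Y x) * f x) = (\<Sum>x\<in>#Y. f x)" if "finite S" "set_mset Y \<subseteq> S" for S Y
    using that
  proof (induction Y)
    case (add y Y)
    have "(\<Sum>x\<in>S. real (count (add_mset y Y) x) * f x)
       = (\<Sum>x\<in>S. real (count Y x) * f x + (if x = y then f y else 0))"
      by (intro sum.cong) (auto simp: algebra_simps)
    then show ?case using add by (simp add: sum.distrib)
  qed simp
  then have *: "(\<Sum>x\<in>set_mset X. real (count X x) * f x) = (\<Sum>x\<in>#X. f x)" by simp
  have "(\<integral>x. f x \<partial>measure_pmf (pmf_of_multiset X)) = (\<Sum>x\<in>set_mset X. f x * pmf (pmf_of_multiset X) x)"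
    using assms by (intro integral_measure_pmf_real) auto
  then show ?thesis using assms * by (simp add: mult.commute sum_divide_distrib[symmetric])
qed

lemma empirical_integral:
  assumes "X \<noteq> {#}" "f \<in> borel_measurable borel"
  shows "(\<integral>x. f x \<partial>empirical X) = (\<Sum>x\<in>#X. f x) / real (size X)"
  using assms by (simp add: empirical_def integral_distr integral_pmf_of_multiset)

lemma empirical_real_distribution: "real_distribution (empirical X)"
  unfolding empirical_def real_distribution_def real_distribution_axioms_def
  by (auto intro!: prob_space.prob_space_distr prob_space_measure_pmf)

lemma empirical_integrable:
  fixes f :: "real \<Rightarrow> real"
  assumes "X \<noteq> {#}" "f \<in> borel_measurable borel"
  shows "integrable (empirical X) f"
  unfolding empirical_def
  using integrable_distr_eq[of "\<lambda>x. x" "measure_pmf (pmf_of_multiset X)" borel f] assms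
  by (simp add: integrable_measure_pmf_finite)

lemma empirical_moment:
  assumes "X \<noteq> {#}"
  shows "(\<integral>x. x ^ k \<partial>empirical X) = power_sums X $ k / real (size X)"
  using assms by (simp add: empirical_integral power_sums_def)

text \<open>Tightness gives a weak limit along a subsequence. That is enough, since its moments are
  identified by the limits \<open>h\<close> of the full sequence.\<close>

lemma exists_limit_measure:
  fixes X :: "nat \<Rightarrow> real multiset"
  assumes X: "\<And>m x. x \<in># X m \<Longrightarrow> 0 < x \<and> x \<le> 1" and ne: "\<And>m. X m \<noteq> {#}"
    and lim: "\<And>k. (\<lambda>m. power_sums (X m) $ k / real (size (X m))) \<longlonglongrightarrow> h k"
  obtains \<nu> where "compact_nonneg_prob \<nu>" "\<And>k. (\<integral>x. x ^ k \<partial>\<nu>) = h k"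
proof -
  have AE: "AE x in empirical (X m). 0 < x \<and> x \<le> 1" for m
    unfolding empirical_def using X ne by (subst AE_distr_iff) (auto simp: AE_measure_pmf_iff)
  interpret M: real_distribution "empirical (X m)" for m by (rule empirical_real_distribution)
  have "tight (\<lambda>m. empirical (X m))"
    unfolding tight_def
  proof (intro conjI allI impI)
    fix \<epsilon> :: real assume "\<epsilon> > 0"
    moreover have "measure (empirical (X m)) {0<..1} = 1" for m
      using AE[of m] by (subst M.prob_eq_1) auto
    ultimately show "\<exists>a b. a < b \<and> (\<forall>n. 1 - \<epsilon> < measure (empirical (X n)) {a<..b})"
      by (intro exI[of _ 0] exI[of _ 1]) auto
  qed (rule M.real_distribution_axioms)
  from tight_imp_convergent_subsubsequence[OF this strict_mono_id] obtain s \<nu>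
    where s: "strict_mono s" and \<nu>: "real_distribution \<nu>" and wc: "weak_conv_m (\<lambda>m. empirical (X (s m))) \<nu>"
    by (auto simp: comp_def)
  interpret \<nu>: real_distribution \<nu> by (rule \<nu>)
  have conv: "(\<lambda>m. (\<Sum>x\<in>#X (s m). f x) / real (size (X (s m)))) \<longlonglongrightarrow> (\<integral>x. f x \<partial>\<nu>)"
    if f: "continuous_on UNIV f" "\<And>x. \<bar>f x\<bar> \<le> B" for f :: "real \<Rightarrow> real" and B
  proof -
    have "(\<lambda>m. \<integral>x. f x \<partial>empirical (X (s m))) \<longlonglongrightarrow> (\<integral>x. f x \<partial>\<nu>)"
      using f by (intro weak_conv_imp_integral_bdd_continuous_conv[OF _ _ wc, where B = B])
        (auto simp: continuous_on_eq_continuous_at M.real_distribution_axioms \<nu>)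
    then show ?thesis using ne f by (simp add: empirical_integral borel_measurable_continuous_onI)
  qed
  \<comment> \<open>A bounded continuous function whose zero set is exactly \<open>[0, 1]\<close>:
    its integral vanishes in the limit, which confines the support of \<open>\<nu>\<close>.\<close>
  define e where "e x = min 1 (max 0 (x - 1) + max 0 (- x))" for x :: real
  have sum0: "(\<Sum>x\<in>#X (s m). e x) = 0" for m
  proof -
    have "(\<Sum>x\<in>#X (s m). e x) = (\<Sum>x\<in>#X (s m). 0)"
      using X by (intro arg_cong[where f = sum_mset] image_mset_cong) (force simp: e_def)
    then show ?thesis by simp
  qed
  have econt: "continuous_on UNIV e" unfolding e_def by (intro continuous_intros)
  have "(\<lambda>m. (\<Sum>x\<in>#X (s m). e x) / real (size (X (s m)))) \<longlonglongrightarrow> (\<integral>x. e x \<partial>\<nu>)"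
    by (rule conv[OF econt, of 1]) (auto simp: e_def)
  then have "(\<integral>x. e x \<partial>\<nu>) = 0" by (simp add: sum0 LIMSEQ_const_iff)
  moreover have "integrable \<nu> e"
  proof (rule \<nu>.integrable_const_bound)
    show "AE x in \<nu>. norm (e x) \<le> 1" by (simp add: e_def)
    show "e \<in> borel_measurable \<nu>" using borel_measurable_continuous_onI[OF econt] by simp
  qed
  moreover have "AE x in \<nu>. 0 \<le> e x" by (simp add: e_def)
  ultimately have "AE x in \<nu>. e x = 0" using integral_nonneg_eq_0_iff_AE by blast
  then have AE\<nu>: "AE x in \<nu>. 0 \<le> x \<and> x \<le> 1"
    by eventually_elim (auto simp: e_def min_def max_def split: if_splits)
  have mom: "(\<integral>x. x ^ k \<partial>\<nu>) = h k" for k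
  proof -
    \<comment> \<open>Powers are not bounded test functions; clamping the argument changes nothing
      on \<open>[0, 1]\<close>.\<close>
    define f where "f x = (min 1 (max 0 x)) ^ k" for x :: real
    have f: "continuous_on UNIV f" "\<And>x. \<bar>f x\<bar> \<le> 1"
      by (auto simp: f_def power_abs intro!: continuous_intros power_le_one)
    have "(\<Sum>x\<in>#X m. f x) = power_sums (X m) $ k" for m
      unfolding power_sums_def fps_nth_Abs_fps
      using X by (intro arg_cong[where f = sum_mset] image_mset_cong) (force simp: f_def)
    then have "(\<lambda>m. power_sums (X (s m)) $ k / real (size (X (s m)))) \<longlonglongrightarrow> (\<integral>x. f x \<partial>\<nu>)"
      using conv[OF f] by simp
    moreover have "(\<lambda>m. power_sums (X (s m)) $ k / real (size (X (s m)))) \<longlonglongrightarrow> h k"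
      using LIMSEQ_subseq_LIMSEQ[OF lim s] by (simp add: comp_def)
    ultimately have "(\<integral>x. f x \<partial>\<nu>) = h k" by (rule LIMSEQ_unique)
    moreover have "(\<integral>x. f x \<partial>\<nu>) = (\<integral>x. x ^ k \<partial>\<nu>)"
    proof (rule integral_cong_AE)
      show "AE x in \<nu>. f x = x ^ k" using AE\<nu> by eventually_elim (simp add: f_def)
    qed (use borel_measurable_continuous_onI[OF f(1)] in auto)
    ultimately show ?thesis by simp
  qed
  show thesis
    by (rule that[of \<nu>]) (use AE\<nu> mom \<nu>.prob_space_axioms in \<open>auto simp: compact_nonneg_prob_def\<close>)
qed

section \<open>Deformed arcsine distribution\<close>

text \<open>The substitution \<open>u = sqrt (x / (c - x))\<close> rationalizes
  \<open>sqrt (x (c - x))\<close>, so the antiderivatives needed below are combinations of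
  \<open>arctan (k u)\<close> and the semicircle function.\<close>

lemma DERIV_arctan_sqrt:
  fixes x c k :: real
  assumes x: "0 < x" "x < c"
  shows "((\<lambda>x. arctan (k * sqrt (x / (c - x)))) has_real_derivative
            k * c / (2 * sqrt (x * (c - x)) * (c - x + k\<^sup>2 * x))) (at x)"
proof -
  define S where "S = sqrt (x * (c - x))"
  have S: "S > 0" "S\<^sup>2 = x * (c - x)" using x by (simp_all add: S_def)
  have U: "sqrt (x / (c - x)) = S / (c - x)"
  proof -
    have "x / (c - x) = (x * (c - x)) / (c - x)\<^sup>2" using x by (simp add: power2_eq_square)
    then show ?thesis using x by (simp only: real_sqrt_divide S_def) simp
  qed
  have d1: "((\<lambda>x. x / (c - x)) has_real_derivative c / (c - x)\<^sup>2) (at x)"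
    using x by (auto intro!: derivative_eq_intros simp: power2_eq_square field_simps)
  have d2: "((\<lambda>x. sqrt (x / (c - x))) has_real_derivative (inverse (sqrt (x / (c - x))) / 2) * (c / (c - x)\<^sup>2)) (at x)"
    using x by (intro DERIV_chain2[OF DERIV_real_sqrt d1]) simp
  have d3: "((\<lambda>x. arctan (k * sqrt (x / (c - x)))) has_real_derivative
      inverse (1 + (k * sqrt (x / (c - x)))\<^sup>2) * (k * ((inverse (sqrt (x / (c - x))) / 2) * (c / (c - x)\<^sup>2)))) (at x)"
    by (intro DERIV_chain2[OF DERIV_arctan] DERIV_cmult d2)
  have pos: "c - x + k\<^sup>2 * x > 0" using x by (intro add_pos_nonneg) auto
  have "1 + (k * (S / (c - x)))\<^sup>2 = (c - x + k\<^sup>2 * x) / (c - x)"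
  proof -
    have "(S / (c - x))\<^sup>2 = x / (c - x)"
      using x by (simp add: power_divide S(2)) (simp add: power2_eq_square)
    then show ?thesis using x by (simp only: power_mult_distrib) (simp add: field_simps)
  qed
  then have "inverse (1 + (k * (S / (c - x)))\<^sup>2) * (k * ((inverse (S / (c - x)) / 2) * (c / (c - x)\<^sup>2)))
     = ((c - x) / (c - x + k\<^sup>2 * x)) * (k * (((c - x) / S / 2) * (c / (c - x)\<^sup>2)))" by simp
  also have "\<dots> = k * c / (2 * S * (c - x + k\<^sup>2 * x))"
    using x S(1) pos by (simp add: power2_eq_square divide_simps) (simp add: algebra_simps)
  finally show ?thesis using d3 unfolding U S_def by simp
qed

lemma DERIV_semicircle:
  fixes x c :: real
  assumes x: "0 < x" "x < c"
  shows "((\<lambda>x. sqrt (x * (c - x))) has_real_derivative (c - 2 * x) / (2 * sqrt (x * (c - x)))) (at x)"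
proof -
  have "((\<lambda>x. x * (c - x)) has_real_derivative (c - 2 * x)) (at x)"
    by (auto intro!: derivative_eq_intros)
  from DERIV_chain2[OF DERIV_real_sqrt this] x show ?thesis by (simp add: field_simps)
qed

lemma tendsto_arctan_sqrt_right:
  fixes c k :: real
  assumes "c > 0"
  shows "((\<lambda>x. arctan (k * sqrt (x / (c - x)))) \<longlongrightarrow> 0) (at_right 0)"
proof -
  have "((\<lambda>x. arctan (k * sqrt (x / (c - x)))) \<longlongrightarrow> arctan (k * sqrt (0 / (c - 0)))) (at_right 0)"
    using assms by (intro tendsto_intros) auto
  then show ?thesis by simp
qed

lemma tendsto_arctan_sqrt_left:
  fixes c k :: real
  assumes c: "c > 0" and k: "k > 0"
  shows "((\<lambda>x. arctan (k * sqrt (x / (c - x)))) \<longlongrightarrow> pi / 2) (at_left c)"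
proof -
  have "LIM x at_left c. x / (c - x) :> at_top"
  proof (rule LIM_at_top_divide)
    show "((\<lambda>x. x) \<longlongrightarrow> c) (at_left c)" by (rule tendsto_ident_at)
    show "0 < c" by fact
    have "((\<lambda>x. c - x) \<longlongrightarrow> c - c) (at_left c)" by (intro tendsto_intros)
    then show "((\<lambda>x. c - x) \<longlongrightarrow> 0) (at_left c)" by simp
    show "eventually (\<lambda>x. 0 < c - x) (at_left c)" by (auto simp: eventually_at_filter)
  qed
  then have "LIM x at_left c. k * sqrt (x / (c - x)) :> at_top"
    by (intro filterlim_tendsto_pos_mult_at_top[OF tendsto_const k] filterlim_compose[OF sqrt_at_top])
  then show ?thesis by (rule filterlim_compose[OF tendsto_arctan_at_top])
qed

context
  fixes c :: real
  assumes c: "0 < c" "c \<le> 1"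
begin

text \<open>Up to a constant this is \<open>(1 - x) x^k\<close> times the deformed arcsine density
  with right endpoint \<open>c\<close>. The division by \<open>x\<close> stands apart so that
  \<open>k = 0\<close> is covered.\<close>

definition arcw :: "nat \<Rightarrow> real \<Rightarrow> real" where
  "arcw k x = x ^ k * sqrt (x * (c - x)) / x"

lemma isCont_arcw: "0 < x \<Longrightarrow> isCont (arcw k) x"
  unfolding arcw_def by (intro continuous_intros) auto

lemma sqrt_quotient: "0 < x \<Longrightarrow> x < c \<Longrightarrow> (c - x) / sqrt (x * (c - x)) = sqrt (x * (c - x)) / x"
  by (simp add: divide_simps flip: power2_eq_square)

lemma arcw_0_integral:
  "set_integrable lborel {0<..<c} (arcw 0)" "(LBINT x:{0<..<c}. arcw 0 x) = c * pi / 2"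
proof -
  define F where "F x = sqrt (x * (c - x)) + c * arctan (1 * sqrt (x / (c - x)))" for x
  have D: "(F has_real_derivative arcw 0 x) (at x)" if "0 < x" "x < c" for x
  proof -
    have "(F has_real_derivative (c - 2 * x) / (2 * sqrt (x * (c - x))) +
        c * (1 * c / (2 * sqrt (x * (c - x)) * (c - x + 1\<^sup>2 * x)))) (at x)"
      unfolding F_def by (intro DERIV_add DERIV_cmult DERIV_arctan_sqrt DERIV_semicircle that)
    also have "(c - 2 * x) / (2 * sqrt (x * (c - x))) + c * (1 * c / (2 * sqrt (x * (c - x)) * (c - x + 1\<^sup>2 * x)))
       = (c - x) / sqrt (x * (c - x))"
      using c that by (simp add: field_simps)
    finally show ?thesis using sqrt_quotient[OF that] by (simp add: arcw_def)
  qed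
  have lim0: "(F \<longlongrightarrow> sqrt (0 * (c - 0)) + c * 0) (at_right 0)"
    unfolding F_def using c by (intro tendsto_intros tendsto_arctan_sqrt_right) auto
  have limc: "(F \<longlongrightarrow> sqrt (c * (c - c)) + c * (pi / 2)) (at_left c)"
    unfolding F_def using c by (intro tendsto_intros tendsto_arctan_sqrt_left) auto
  have nn: "0 \<le> arcw 0 x" if "0 < x" "x < c" for x using that by (simp add: arcw_def)
  note ftc = interval_integral_FTC_nonneg[of "ereal 0" "ereal c" F "arcw 0" "sqrt (0 * (c - 0)) + c * 0" "sqrt (c * (c - c)) + c * (pi / 2)"]
  show "set_integrable lborel {0<..<c} (arcw 0)"
    using ftc(1) c D nn lim0 limc isCont_arcw by (simp add: ereal_tendsto_simps)
  show "(LBINT x:{0<..<c}. arcw 0 x) = c * pi / 2"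
    using ftc(2) c D nn lim0 limc isCont_arcw by (simp add: ereal_tendsto_simps interval_integral_Ioo)
qed

lemma arcw_integrable: "set_integrable lborel {0<..<c} (arcw k)"
proof -
  have m: "set_borel_measurable lborel {0<..<c} (arcw k)"
    unfolding set_borel_measurable_def arcw_def by measurable
  show ?thesis
  proof (rule set_integrable_bound[OF arcw_0_integral(1)])
    show "AE x in lborel. x \<in> {0<..<c} \<longrightarrow> norm (arcw k x) \<le> norm (arcw 0 x)"
      using c by (auto simp: arcw_def abs_mult intro!: mult_left_le_one_le divide_right_mono power_le_one)
  qed (use m in auto)
qed

text \<open>Integration by parts for a beta integral: \<open>x^k (c - x) sqrt (x (c - x))\<close>
  vanishes at both ends, and its derivative is the combination \<open>f\<close> of two neighbouring
  integrands.\<close>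

lemma arcw_rec:
  "(real k + 2) * (LBINT x:{0<..<c}. arcw (Suc k) x) = c * (real k + 1 / 2) * (LBINT x:{0<..<c}. arcw k x)"
proof -
  define F where "F x = x ^ k * ((c - x) * sqrt (x * (c - x)))" for x
  define f where "f x = c * (real k + 1 / 2) * arcw k x - (real k + 2) * arcw (Suc k) x" for x
  have D: "(F has_real_derivative f x) (at x)" if x: "0 < x" "x < c" for x
  proof -
    define S where "S = sqrt (x * (c - x))"
    have S: "S > 0" "(c - x) / S = S / x" using x sqrt_quotient by (simp_all add: S_def)
    have "(F has_real_derivative (real k * x ^ (k - 1)) * ((c - x) * S) + (- 1 * S + (c - x) * ((c - 2 * x) / (2 * S))) * x ^ k) (at x)"
      unfolding F_def S_def
      by (rule derivative_eq_intros DERIV_semicircle x refl | simp)+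
    also have "real k * x ^ (k - 1) = real k * x ^ k / x" using x by (cases k) auto
    also have "(c - x) * ((c - 2 * x) / (2 * S)) = (S / x) * (c - 2 * x) / 2" by (simp flip: S(2))
    also have "real k * x ^ k / x * ((c - x) * S) + (- 1 * S + S / x * (c - 2 * x) / 2) * x ^ k = f x"
      using x unfolding f_def arcw_def S_def[symmetric] by (simp add: field_simps)
    finally show ?thesis .
  qed
  have int: "set_integrable lborel {0<..<c} f"
    unfolding f_def by (intro set_integral_diff set_integrable_mult_right arcw_integrable)
  have cont: "isCont f x" if "0 < x" for x unfolding f_def using that by (intro continuous_intros isCont_arcw)
  have "(F \<longlongrightarrow> 0 ^ k * ((c - 0) * sqrt (0 * (c - 0)))) (at_right 0)" "(F \<longlongrightarrow> c ^ k * ((c - c) * sqrt (c * (c - c)))) (at_left c)"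
    unfolding F_def by (intro tendsto_intros)+
  then have "(LBINT x=ereal 0..ereal c. f x) = 0 - 0"
    using c D int cont by (intro interval_integral_FTC_integrable[where F = F])
      (simp_all add: ereal_tendsto_simps has_real_derivative_iff_has_vector_derivative[symmetric])
  then have "(LBINT x:{0<..<c}. f x) = 0" using c by (simp add: interval_integral_Ioo)
  then show ?thesis
    unfolding f_def by (subst (asm) set_integral_diff(2)) (auto intro: arcw_integrable)
qed

end

lemma deformed_arcsine_integral:
  fixes r :: real
  assumes r: "r \<ge> 1"
  defines "c \<equiv> 4 * r / (r + 1)\<^sup>2" and "\<phi> \<equiv> (\<lambda>x. (r + 1) / (2 * pi) * (sqrt (x * (4 * r / (r + 1)\<^sup>2 - x)) / (x * (1 - x))))"
  shows "0 < c" "c \<le> 1"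
    "deformed_arcsine_density (r - 1) x = indicator {0<..<c} x * \<phi> x"
    "\<And>x. x \<in> {0<..<c} \<Longrightarrow> 0 \<le> \<phi> x"
    "set_integrable lborel {0<..<c} \<phi>" "(LBINT x:{0<..<c}. \<phi> x) = 1"
proof -
  define s where "s = (r - 1) / (r + 1)"
  have s: "s\<^sup>2 = 1 - c" "0 \<le> s"
    using r by (simp_all add: s_def c_def power_divide divide_simps) (simp add: power2_eq_square algebra_simps)
  show c0: "0 < c" using r by (simp add: c_def)
  show c1: "c \<le> 1" using s(1) zero_le_power2[of s] by linarith
  have rc: "(r + 1)\<^sup>2 * c = 4 * r" using r by (simp add: c_def)
  show "deformed_arcsine_density (r - 1) x = indicator {0<..<c} x * \<phi> x" for x
  proof (cases "x \<in> {0<..<c}")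
    case True
    have "4 * (r - 1 + 1) * x - (r - 1 + 2)\<^sup>2 * x\<^sup>2 = (r + 1)\<^sup>2 * (x * (c - x))"
    proof -
      have "4 * (r - 1 + 1) * x - (r - 1 + 2)\<^sup>2 * x\<^sup>2 = 4 * r * x - (r + 1)\<^sup>2 * x\<^sup>2"
        by (simp add: add.commute)
      also have "\<dots> = (r + 1)\<^sup>2 * c * x - (r + 1)\<^sup>2 * x\<^sup>2" by (simp only: rc)
      also have "\<dots> = (r + 1)\<^sup>2 * (x * (c - x))" by (simp add: power2_eq_square algebra_simps)
      finally show ?thesis .
    qed
    then have "sqrt (4 * (r - 1 + 1) * x - (r - 1 + 2)\<^sup>2 * x\<^sup>2) = (r + 1) * sqrt (x * (c - x))"
      using r by (simp add: real_sqrt_mult)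
    then show ?thesis using True by (simp add: deformed_arcsine_density_def \<phi>_def c_def add.commute)
  next
    case False
    then show ?thesis by (auto simp: deformed_arcsine_density_def c_def add.commute)
  qed
  show nn: "0 \<le> \<phi> x" if "x \<in> {0<..<c}" for x
    using that c1 r unfolding \<phi>_def c_def[symmetric] by simp
  \<comment> \<open>From \<open>(c - x) / (1 - x) = 1 - (1 - c) / (1 - x)\<close>. The first term
    integrates to an arctangent with factor 1; for the second, \<open>s\<^sup>2 = 1 - c\<close>
    gives \<open>c - x + s\<^sup>2 * x = c * (1 - x)\<close>, the required pole at 1.\<close>
  define F where "F x = (r + 1) / pi * (arctan (1 * sqrt (x / (c - x))) - s * arctan (s * sqrt (x / (c - x))))" for x
  have D: "(F has_real_derivative \<phi> x) (at x)" if x: "0 < x" "x < c" for x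
  proof -
    define S where "S = sqrt (x * (c - x))"
    have S: "S > 0" "(c - x) / S = S / x" using x sqrt_quotient[OF c0 c1] by (simp_all add: S_def)
    have x1: "1 - x > 0" using x c1 by simp
    have "(F has_real_derivative (r + 1) / pi * (1 * c / (2 * S * (c - x + 1\<^sup>2 * x)) - s * (s * c / (2 * S * (c - x + s\<^sup>2 * x))))) (at x)"
      unfolding F_def S_def by (intro DERIV_diff DERIV_cmult DERIV_arctan_sqrt x)
    also have "c - x + s\<^sup>2 * x = c * (1 - x)" by (simp add: s(1) algebra_simps)
    also have "s * (s * c / (2 * S * (c * (1 - x)))) = (1 - c) / (2 * S * (1 - x))"
      using c0 by (simp flip: s(1) add: power2_eq_square)
    also have "1 * c / (2 * S * (c - x + 1\<^sup>2 * x)) = 1 / (2 * S)" using c0 by simp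
    also have "1 / (2 * S) - (1 - c) / (2 * S * (1 - x)) = (c - x) / S / (2 * (1 - x))"
      using S(1) x1 by (simp add: field_simps)
    also have "(r + 1) / pi * ((c - x) / S / (2 * (1 - x))) = \<phi> x"
      unfolding S(2) \<phi>_def c_def[symmetric] S_def[symmetric] by simp
    finally show ?thesis .
  qed
  have cont: "isCont \<phi> x" if "0 < x" "x < c" for x
    unfolding \<phi>_def using that c1 by (intro continuous_intros) auto
  have lim0: "(F \<longlongrightarrow> (r + 1) / pi * (0 - s * 0)) (at_right 0)"
    unfolding F_def using c0 by (intro tendsto_intros tendsto_arctan_sqrt_right) auto
  have limS: "((\<lambda>x. s * arctan (s * sqrt (x / (c - x)))) \<longlongrightarrow> s * (pi / 2)) (at_left c)"
  \<comment> \<open>For \<open>r = 1\<close> the factor \<open>s\<close> vanishes and the inner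
    arctangent does not tend to \<open>pi / 2\<close>, but the whole term is 0.\<close>
  proof (cases "s = 0")
    case False
    then show ?thesis using s(2) c0 by (intro tendsto_intros tendsto_arctan_sqrt_left) auto
  qed simp
  have limc: "(F \<longlongrightarrow> (r + 1) / pi * (pi / 2 - s * (pi / 2))) (at_left c)"
    unfolding F_def using c0
    by (intro limS tendsto_arctan_sqrt_left tendsto_diff tendsto_mult[OF tendsto_const]) auto
  have val: "(r + 1) / pi * (pi / 2 - s * (pi / 2)) - (r + 1) / pi * (0 - s * 0) = 1"
  proof -
    have "(r + 1) / pi * (pi / 2 - s * (pi / 2)) = (r + 1) / 2 * (1 - s)" by (simp add: field_simps)
    also have "1 - s = 2 / (r + 1)" using r by (simp add: s_def divide_simps)
    finally show ?thesis using r by simp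
  qed
  note ftc = interval_integral_FTC_nonneg[of "ereal 0" "ereal c" F \<phi> "(r + 1) / pi * (0 - s * 0)" "(r + 1) / pi * (pi / 2 - s * (pi / 2))"]
  show "set_integrable lborel {0<..<c} \<phi>"
    using ftc(1) c0 D nn lim0 limc cont by (simp add: ereal_tendsto_simps)
  have "(LBINT x=ereal 0..ereal c. \<phi> x) = (r + 1) / pi * (pi / 2 - s * (pi / 2)) - (r + 1) / pi * (0 - s * 0)"
    using c0 D nn lim0 limc cont by (intro ftc(2)) (simp_all add: ereal_tendsto_simps)
  also note val
  finally have "(LBINT x=ereal 0..ereal c. \<phi> x) = 1" .
  then show "(LBINT x:{0<..<c}. \<phi> x) = 1" using c0 by (simp add: interval_integral_Ioo)
qed

text \<open>Differences of consecutive moments are the tractable quantity: the factor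
  \<open>1 - x\<close> removes the pole of the density and leaves a beta integral.\<close>

lemma deformed_arcsine_moments:
  fixes r :: real
  assumes r: "r \<ge> 1"
  defines "c \<equiv> 4 * r / (r + 1)\<^sup>2" and "M \<equiv> deformed_arcsine (r - 1)"
  shows "integrable M (\<lambda>x. x ^ k)" "AE x in M. 0 \<le> x"
    "(\<integral>x. x ^ 0 \<partial>M) = 1"
    "(\<integral>x. x ^ k \<partial>M) - (\<integral>x. x ^ Suc k \<partial>M) = (r + 1) / (2 * pi) * (LBINT x:{0<..<c}. arcw c k x)"
proof -
  define \<phi> where "\<phi> x = (r + 1) / (2 * pi) * (sqrt (x * (c - x)) / (x * (1 - x)))" for x
  note di = deformed_arcsine_integral[OF r, folded c_def, folded \<phi>_def]
  have \<phi>m[measurable]: "\<phi> \<in> borel_measurable borel" unfolding \<phi>_def by measurable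
  have dens: "deformed_arcsine_density (r - 1) = (\<lambda>x. indicator {0<..<c} x * \<phi> x)"
    by (rule ext) (rule di(3))
  have nn: "0 \<le> indicator {0<..<c} x * \<phi> x" for x using di(4)[of x] by (auto simp: indicator_def)
  have M: "M = density lborel (\<lambda>x. ennreal (indicator {0<..<c} x * \<phi> x))"
    unfolding M_def deformed_arcsine_def dens ..
  have si: "set_integrable lborel {0<..<c} (\<lambda>x. \<phi> x * x ^ k)" for k
  proof (rule set_integrable_bound[OF di(5)])
    show "set_borel_measurable lborel {0<..<c} (\<lambda>x. \<phi> x * x ^ k)"
      unfolding set_borel_measurable_def by measurable
    show "AE x in lborel. x \<in> {0<..<c} \<longrightarrow> norm (\<phi> x * x ^ k) \<le> norm (\<phi> x)"
      using di(2) by (intro AE_I2) (auto simp: abs_mult intro!: mult_right_le_one_le power_le_one)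
  qed
  show int: "integrable M (\<lambda>x. x ^ k)" for k
    unfolding M using si[of k] nn
    by (subst integrable_density) (auto simp: set_integrable_def mult.assoc)
  have mom: "(\<integral>x. x ^ k \<partial>M) = (LBINT x:{0<..<c}. \<phi> x * x ^ k)" for k
    unfolding M using nn
    by (subst integral_density) (auto simp: set_lebesgue_integral_def mult.assoc)
  show "AE x in M. 0 \<le> x"
    unfolding M by (subst AE_density) (auto simp: indicator_def)
  show "(\<integral>x. x ^ 0 \<partial>M) = 1" using di(6) mom[of 0] by simp
  have "(\<integral>x. x ^ k \<partial>M) - (\<integral>x. x ^ Suc k \<partial>M) = (LBINT x:{0<..<c}. \<phi> x * x ^ k - \<phi> x * x ^ Suc k)"
    unfolding mom by (rule set_integral_diff(2)[OF si si, symmetric])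
  also have "\<dots> = (LBINT x:{0<..<c}. (r + 1) / (2 * pi) * arcw c k x)"
  proof (rule set_lebesgue_integral_cong)
    show "\<forall>x. x \<in> {0<..<c} \<longrightarrow> \<phi> x * x ^ k - \<phi> x * x ^ Suc k = (r + 1) / (2 * pi) * arcw c k x"
    proof (intro allI impI)
      fix x assume "x \<in> {0<..<c}"
      then have x: "x > 0" "1 - x > 0" using di(2) by auto
      have "\<phi> x * x ^ k - \<phi> x * x ^ Suc k = (1 - x) * \<phi> x * x ^ k" by (simp add: algebra_simps)
      also have "(1 - x) * \<phi> x = (r + 1) / (2 * pi) * (sqrt (x * (c - x)) / x)"
        unfolding \<phi>_def using x by simp
      finally show "\<phi> x * x ^ k - \<phi> x * x ^ Suc k = (r + 1) / (2 * pi) * arcw c k x"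
        by (simp add: arcw_def[OF di(1,2)])
    qed
  qed simp
  finally show "(\<integral>x. x ^ k \<partial>M) - (\<integral>x. x ^ Suc k \<partial>M) = (r + 1) / (2 * pi) * (LBINT x:{0<..<c}. arcw c k x)"
    by simp
qed

text \<open>The recurrence is that of the binomial series:
  \<open>(r + 1) sqrt (1 - c X) = (r + 1) - 2 X D(X)\<close>. Squaring and using
  \<open>(r + 1)^2 c = 4 r\<close> gives the quadratic equation.\<close>

lemma quadratic_of_recurrence:
  fixes D :: "nat \<Rightarrow> real" and r c :: real
  assumes r: "r \<ge> 1" and c: "c = 4 * r / (r + 1)\<^sup>2"
    and D0: "D 0 = r / (r + 1)" and rec: "\<And>k. (real k + 2) * D (Suc k) = c * (real k + 1 / 2) * D k"
  shows "fps_const (r + 1) * Abs_fps D = fps_const r + fps_X * (Abs_fps D)\<^sup>2"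
proof -
  define G where "G = fps_const (r + 1) * (fps_binomial (1 / 2) oo (fps_const (- c) * fps_X))"
  have Gn: "G $ k = (r + 1) * ((- c) ^ k * ((1 / 2) gchoose k))" for k
    by (simp add: G_def fps_compose_linear)
  have Dk: "- 2 * D k = (r + 1) * ((- c) ^ Suc k * ((1 / 2) gchoose Suc k))" for k
  proof (induction k)
    case 0
    then show ?case using r by (simp add: D0 c power2_eq_square divide_simps)
  next
    case (Suc k)
    have g: "(1 / 2 :: real) gchoose Suc (Suc k) = ((1 / 2 - real (Suc k)) / (real k + 2)) * ((1 / 2) gchoose Suc k)"
      using gbinomial_mult_1[of "1 / 2 :: real" "Suc k"] by (simp add: field_simps)
    have "D (Suc k) = (real k + 2) * D (Suc k) / (real k + 2)" by simp
    then have "- 2 * D (Suc k) = - 2 * D k * (c * (real k + 1 / 2) / (real k + 2))"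
      unfolding rec[of k] by simp
    also have "\<dots> = (r + 1) * ((- c) ^ Suc (Suc k) * ((1 / 2) gchoose Suc (Suc k)))"
      unfolding Suc.IH g power_Suc[of _ "Suc k"] by (simp add: field_simps)
    finally show ?case .
  qed
  have G: "G = fps_const (r + 1) - 2 * (fps_X * Abs_fps D)"
  proof (rule fps_ext)
    show "G $ k = (fps_const (r + 1) - 2 * (fps_X * Abs_fps D)) $ k" for k
      using Dk[of "k - 1"] by (cases k) (simp_all add: Gn fps_numeral_fps_const)
  qed
  have sq: "fps_binomial (1 / 2) ^ 2 = (1 + fps_X :: real fps)"
    by (simp add: fps_binomial_power fps_binomial_1)
  have "G\<^sup>2 = fps_const ((r + 1)\<^sup>2) * ((1 + fps_X) oo (fps_const (- c) * fps_X))"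
    unfolding G_def power_mult_distrib fps_const_power
    by (subst fps_compose_power) (simp_all add: sq)
  also have "\<dots> = fps_const ((r + 1)\<^sup>2) - fps_const ((r + 1)\<^sup>2 * c) * fps_X"
    by (simp add: fps_compose_add_distrib algebra_simps flip: fps_const_neg)
  also have "(r + 1)\<^sup>2 * c = 4 * r" using r by (simp add: c)
  finally have "(fps_const (r + 1) - 2 * (fps_X * Abs_fps D))\<^sup>2 = (fps_const (r + 1))\<^sup>2 - 4 * fps_const r * fps_X"
    unfolding G by (simp add: fps_numeral_fps_const)
  then have "4 * fps_X * (fps_const (r + 1) * Abs_fps D) = 4 * fps_X * (fps_const r + fps_X * (Abs_fps D)\<^sup>2)"
    by (simp only: power2_eq_square) (simp add: algebra_simps)
  then show ?thesis by simp
qed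

section \<open>Mixtures with a point mass\<close>

lemma sets_mixture [simp]: "sets (mixture t \<mu> \<nu>) = sets borel"
  unfolding mixture_def by (subst sets_measure_of) (auto simp: sets.sigma_sets_eq[of borel, simplified])

lemma space_mixture [simp]: "space (mixture t \<mu> \<nu>) = UNIV"
  by (simp add: mixture_def space_measure_of_conv)

lemma emeasure_mixture:
  assumes "sets \<mu> = sets borel" "sets \<nu> = sets borel" and A: "A \<in> sets borel"
  shows "emeasure (mixture t \<mu> \<nu>) A = ennreal (1 - t) * emeasure \<mu> A + ennreal t * emeasure \<nu> A"
proof (rule emeasure_measure_of[OF mixture_def])
  show "countably_additive (sets (mixture t \<mu> \<nu>)) (\<lambda>A. ennreal (1 - t) * emeasure \<mu> A + ennreal t * emeasure \<nu> A)"
    unfolding countably_additive_def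
  proof (intro allI impI)
    fix B :: "nat \<Rightarrow> real set"
    assume "range B \<subseteq> sets (mixture t \<mu> \<nu>)" "disjoint_family B"
    then have "(\<Sum>i. emeasure \<mu> (B i)) = emeasure \<mu> (\<Union>i. B i)" "(\<Sum>i. emeasure \<nu> (B i)) = emeasure \<nu> (\<Union>i. B i)"
      using assms by (auto intro!: suminf_emeasure)
    then show "(\<Sum>i. ennreal (1 - t) * emeasure \<mu> (B i) + ennreal t * emeasure \<nu> (B i))
        = ennreal (1 - t) * emeasure \<mu> (\<Union>i. B i) + ennreal t * emeasure \<nu> (\<Union>i. B i)"
      by (subst suminf_add[symmetric]) auto
  qed
qed (use A in \<open>auto simp: positive_def\<close>)

lemma nn_integral_mixture:
  assumes s: "sets \<mu> = sets borel" "sets \<nu> = sets borel" and f: "f \<in> borel_measurable borel"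
  shows "(\<integral>\<^sup>+x. f x \<partial>mixture t \<mu> \<nu>) = ennreal (1 - t) * (\<integral>\<^sup>+x. f x \<partial>\<mu>) + ennreal t * (\<integral>\<^sup>+x. f x \<partial>\<nu>)"
proof -
  have m: "borel_measurable (mixture t \<mu> \<nu>) = borel_measurable borel"
    "borel_measurable \<mu> = borel_measurable borel" "borel_measurable \<nu> = borel_measurable borel"
    by (intro measurable_cong_sets sets_mixture s refl)+
  show ?thesis
    using f
  proof (induction rule: borel_measurable_induct)
    case (cong f g)
    then have "f = g" by auto
    then show ?case using cong by simp
  next
    case (set A)
    then show ?case using s by (simp add: emeasure_mixture)
  next
    case (mult u v)
    then show ?case by (simp add: nn_integral_cmult m distrib_left mult_ac)
  next
    case (add u v)
    then show ?case by (simp add: nn_integral_add m distrib_left add_ac)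
  next
    case (seq U)
    have "integral\<^sup>N K (SUP i. U i) = (SUP i. integral\<^sup>N K (U i))"
      if "sets K = sets borel" for K
    proof -
      have "(SUP i. U i) = (\<lambda>x. SUP i. U i x)" by (rule ext) (simp add: image_comp)
      moreover have "U i \<in> borel_measurable K" for i
        using seq(1) measurable_cong_sets[OF that refl] by blast
      ultimately show ?thesis
        using nn_integral_monotone_convergence_SUP[of U K] \<open>incseq U\<close> by simp
    qed
    note mc = this
    have "(SUP i. ennreal (1 - t) * (\<integral>\<^sup>+x. U i x \<partial>\<mu>) + ennreal t * (\<integral>\<^sup>+x. U i x \<partial>\<nu>))
        = (SUP i. ennreal (1 - t) * (\<integral>\<^sup>+x. U i x \<partial>\<mu>)) + (SUP i. ennreal t * (\<integral>\<^sup>+x. U i x \<partial>\<nu>))"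
      using \<open>incseq U\<close> by (intro ennreal_SUP_add)
        (auto simp: incseq_def le_fun_def intro!: mult_left_mono nn_integral_mono)
    then show ?case
      by (simp only: mc[OF sets_mixture] mc[OF s(1)] mc[OF s(2)] seq.IH SUP_mult_left_ennreal)
  qed
qed

lemma mixture_moment:
  assumes t: "0 \<le> t" "t \<le> 1" and s: "sets \<mu> = sets borel" "sets \<nu> = sets borel"
    and i: "integrable \<mu> (\<lambda>x. x ^ k)" "integrable \<nu> (\<lambda>x. x ^ k)"
    and nn: "AE x in \<mu>. 0 \<le> x" "AE x in \<nu>. 0 \<le> x"
  shows "(\<integral>x. x ^ k \<partial>mixture t \<mu> \<nu>) = (1 - t) * (\<integral>x. x ^ k \<partial>\<mu>) + t * (\<integral>x. x ^ k \<partial>\<nu>)"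
proof -
  have nnk: "AE x in \<mu>. 0 \<le> x ^ k" "AE x in \<nu>. 0 \<le> x ^ k"
    using nn(1) by (eventually_elim, simp) (use nn(2) in eventually_elim, simp)
  have null: "emeasure K {x. \<not> 0 \<le> x ^ k} = 0" if "AE x in K. 0 \<le> x ^ k" "sets K = sets borel" for K :: "real measure"
  proof -
    have N: "{x :: real. \<not> 0 \<le> x ^ k} \<in> sets borel" by measurable
    have sp: "{x \<in> space K. \<not> 0 \<le> x ^ k} = {x. \<not> 0 \<le> x ^ k}" using sets_eq_imp_space_eq[OF that(2)] by simp
    have "{x \<in> space K. \<not> 0 \<le> x ^ k} \<in> sets K" unfolding sp that(2) by (rule N)
    from AE_iff_measurable[OF this refl] that(1) show ?thesis unfolding sp by simp
  qed
  have "AE x in mixture t \<mu> \<nu>. 0 \<le> x ^ k"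
  proof (subst AE_iff_measurable[OF _ refl])
    show "{x \<in> space (mixture t \<mu> \<nu>). \<not> 0 \<le> x ^ k} \<in> sets (mixture t \<mu> \<nu>)" by simp
    show "emeasure (mixture t \<mu> \<nu>) {x \<in> space (mixture t \<mu> \<nu>). \<not> 0 \<le> x ^ k} = 0"
      using s null[OF nnk(1) s(1)] null[OF nnk(2) s(2)] by (subst emeasure_mixture) auto
  qed
  moreover have "(\<lambda>x. x ^ k) \<in> borel_measurable (mixture t \<mu> \<nu>)"
    by (subst measurable_cong_sets[OF sets_mixture refl]) simp
  ultimately have "(\<integral>x. x ^ k \<partial>mixture t \<mu> \<nu>) = enn2real (\<integral>\<^sup>+x. ennreal (x ^ k) \<partial>mixture t \<mu> \<nu>)"
    by (intro integral_eq_nn_integral) auto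
  also have "(\<integral>\<^sup>+x. ennreal (x ^ k) \<partial>mixture t \<mu> \<nu>)
      = ennreal (1 - t) * ennreal (\<integral>x. x ^ k \<partial>\<mu>) + ennreal t * ennreal (\<integral>x. x ^ k \<partial>\<nu>)"
    using s by (simp add: nn_integral_mixture nn_integral_eq_integral[OF i(1) nnk(1)] nn_integral_eq_integral[OF i(2) nnk(2)])
  also have "\<dots> = ennreal ((1 - t) * (\<integral>x. x ^ k \<partial>\<mu>) + t * (\<integral>x. x ^ k \<partial>\<nu>))"
    using t nnk by (simp add: ennreal_mult ennreal_plus integral_nonneg_AE)
  finally have eq: "(\<integral>x. x ^ k \<partial>mixture t \<mu> \<nu>) = enn2real (ennreal ((1 - t) * (\<integral>x. x ^ k \<partial>\<mu>) + t * (\<integral>x. x ^ k \<partial>\<nu>)))" .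
  have "0 \<le> (1 - t) * (\<integral>x. x ^ k \<partial>\<mu>) + t * (\<integral>x. x ^ k \<partial>\<nu>)"
    using t nnk by (simp add: integral_nonneg_AE)
  then show ?thesis unfolding eq by (rule enn2real_ennreal)
qed

text \<open>The equation of \<open>S_transform_eqI\<close> for \<open>q = 0\<close>; it gives the
  unit of the convolution the S-transform 1.\<close>

lemma moment_series_return:
  "fps_X * (1 + moment_series (return borel 1)) = moment_series (return borel 1)"
  by (rule fps_ext) (simp add: moment_series_def integral_return)

text \<open>In terms of \<open>E = X D(X)\<close>, with \<open>D\<close> the moment differences of
  the arcsine law, \<open>m (1 - X) = X - E / r\<close>. Multiplied by \<open>(1 - X)^2\<close>, the
  claim becomes a quadratic relation in \<open>E\<close>, which \<open>(r + 1) E = r X + E^2\<close>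
  reduces to an identity.\<close>

lemma moment_series_mixture:
  fixes r :: real
  assumes r: "r \<ge> 1"
  defines "m \<equiv> moment_series (mixture (1 / r) (return borel 1) (deformed_arcsine (r - 1)))"
  shows "fps_X * (1 + m) ^ 2 = (1 + m + fps_const (1 / r)) * m"
proof -
  define c where "c = 4 * r / (r + 1)\<^sup>2"
  define M where "M = deformed_arcsine (r - 1)"
  note arc = deformed_arcsine_moments[OF r, folded c_def M_def]
  note c = deformed_arcsine_integral(1,2)[OF r, folded c_def]
  define D where "D k = (\<integral>x. x ^ k \<partial>M) - (\<integral>x. x ^ Suc k \<partial>M)" for k
  have D: "D k = (r + 1) / (2 * pi) * (LBINT x:{0<..<c}. arcw c k x)" for k
    unfolding D_def by (rule arc(4))
  have D0: "D 0 = r / (r + 1)"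
    unfolding D arcw_0_integral(2)[OF c] using r by (simp add: c_def power2_eq_square)
  have Drec: "(real k + 2) * D (Suc k) = c * (real k + 1 / 2) * D k" for k
  proof -
    have "(real k + 2) * D (Suc k) = (r + 1) / (2 * pi) * ((real k + 2) * (LBINT x:{0<..<c}. arcw c (Suc k) x))"
      unfolding D by (simp add: mult_ac)
    also have "\<dots> = c * (real k + 1 / 2) * D k" unfolding arcw_rec[OF c] D by (simp add: mult_ac)
    finally show ?thesis .
  qed
  define E where "E = fps_X * Abs_fps D"
  define b where "b = fps_const (1 / r)"
  have bR: "b * fps_const r = 1" using r by (simp add: b_def)
  have quad: "fps_const (r + 1) * Abs_fps D = fps_const r + fps_X * (Abs_fps D)\<^sup>2"
    using quadratic_of_recurrence[of r c D] r c_def D0 Drec by blast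
  have "fps_X * (fps_const (r + 1) * Abs_fps D) = fps_X * (fps_const r + fps_X * (Abs_fps D)\<^sup>2)"
    unfolding quad ..
  then have "(fps_const r + 1) * E = fps_const r * fps_X + E\<^sup>2"
    by (simp add: E_def power2_eq_square algebra_simps flip: fps_const_add)
  then have "b * ((fps_const r + 1) * E) = b * (fps_const r * fps_X + E\<^sup>2)" by simp
  then have "(b * fps_const r) * E + b * E = (b * fps_const r) * fps_X + b * E\<^sup>2"
    by (simp add: algebra_simps)
  then have Eq: "b * E\<^sup>2 = E + b * E - fps_X" unfolding bR by (simp add: algebra_simps)
  have mom: "(\<integral>x. x ^ k \<partial>mixture (1 / r) (return borel 1) M) = (1 - 1 / r) + 1 / r * (\<integral>x. x ^ k \<partial>M)" for k
  proof -
    have "sets M = sets borel" by (simp add: M_def deformed_arcsine_def)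
    moreover have "integrable (return borel (1::real)) (\<lambda>x. x ^ k)"
      by (intro finite_measure.integrable_const_bound[of _ _ 1] prob_space.finite_measure prob_space_return)
        (auto simp: AE_return)
    ultimately show ?thesis
      using r arc(1,2) by (subst mixture_moment) (auto simp: AE_return integral_return)
  qed
  have mX: "m * (1 - fps_X) = fps_X - b * E"
  proof (rule fps_ext)
    fix k
    have "(m * (1 - fps_X)) $ k = m $ k - (fps_X * m) $ k" by (simp add: algebra_simps)
    also have "\<dots> = (fps_X - b * E) $ k"
    proof (cases k)
      case (Suc j)
      have "m $ Suc j = (1 - 1 / r) + 1 / r * (\<integral>x. x ^ Suc j \<partial>M)"
        using mom[of "Suc j"] by (simp add: m_def moment_series_def M_def)
      moreover have "(fps_X * m) $ Suc j = (if j = 0 then 0 else (1 - 1 / r) + 1 / r * (\<integral>x. x ^ j \<partial>M))"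
        using mom[of j] by (simp add: m_def moment_series_def M_def)
      moreover have "(b * E) $ Suc j = 1 / r * D j" by (simp add: b_def E_def)
      ultimately show ?thesis
        unfolding Suc using arc(3) by (cases "j = 0") (simp_all add: D_def right_diff_distrib diff_divide_distrib)
    qed (simp add: m_def b_def E_def)
    finally show "(m * (1 - fps_X)) $ k = (fps_X - b * E) $ k" .
  qed
  have "(fps_X * (1 + m) ^ 2) * (1 - fps_X)\<^sup>2 = fps_X * ((1 - fps_X) + m * (1 - fps_X)) ^ 2"
    by (simp add: power2_eq_square algebra_simps)
  also have "\<dots> = fps_X * (1 - b * E)\<^sup>2" unfolding mX by simp
  also have "\<dots> = fps_X * (1 - 2 * (b * E)) + fps_X * b * (b * E\<^sup>2)"
    by (simp add: power2_eq_square algebra_simps)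
  also have "\<dots> = (1 + b - b * fps_X) * (fps_X - b * E) - b * E * fps_X + b * (b * E\<^sup>2)"
    unfolding Eq by (simp add: algebra_simps)
  also have "\<dots> = ((1 - fps_X) * (1 + b) + (fps_X - b * E)) * (fps_X - b * E)"
    by (simp add: power2_eq_square algebra_simps)
  also have "\<dots> = ((1 + m + b) * m) * (1 - fps_X)\<^sup>2"
    unfolding mX[symmetric] by (simp add: power2_eq_square algebra_simps)
  finally have "(fps_X * (1 + m) ^ 2) * (1 - fps_X)\<^sup>2 = ((1 + m + b) * m) * (1 - fps_X)\<^sup>2" .
  moreover have "(1 - fps_X :: real fps)\<^sup>2 \<noteq> 0"
  proof -
    have "(1 - fps_X :: real fps) $ 0 \<noteq> 0" by simp
    then have "(1 - fps_X :: real fps) \<noteq> 0" by (metis fps_zero_nth)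
    then show ?thesis by simp
  qed
  ultimately show ?thesis by (simp add: b_def)
qed

section \<open>Asymptotic zero distribution\<close>

text \<open>The series \<open>J\<close> is \<open>z S(z) / (1 + z)\<close> for the prescribed
  \<open>S(z) = ((z + 1 + \<sigma>) / (z + 1))^q\<close>, and \<open>W\<close> is its compositional
  inverse.\<close>

lemma exists_limit_series:
  fixes \<sigma> :: real
  assumes \<sigma>: "\<sigma> > 0"
  obtains W :: "real fps" where "W $ 0 = 0" "fps_X * (1 + W) ^ (q + 1) = (1 + W + fps_const \<sigma>) ^ q * W"
proof -
  define J :: "real fps" where "J = fps_X * (1 + fps_X + fps_const \<sigma>) ^ q * inverse (1 + fps_X) ^ (q + 1)"
  define W where "W = fps_inv J"
  have W0: "W $ 0 = 0" by (simp add: W_def)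
  have J0: "J $ 0 = 0" by (simp add: J_def)
  have "J $ 1 = (1 + \<sigma>) ^ q"
    unfolding J_def mult.assoc by (simp add: fps_power_zeroth)
  then have "J $ 1 \<noteq> 0" using \<sigma> by simp
  then have JW: "J oo W = fps_X" unfolding W_def using J0 by (intro fps_inv_right) auto
  have inv: "inverse (1 + fps_X) oo W = inverse (1 + W)"
    using W0 by (subst fps_inverse_compose) (simp_all add: fps_compose_add_distrib)
  have "J oo W = W * (1 + W + fps_const \<sigma>) ^ q * inverse (1 + W) ^ (q + 1)"
    using W0 unfolding J_def
    by (simp only: fps_compose_mult_distrib[OF W0] fps_compose_power[OF W0, symmetric] inv fps_compose_add_distrib
        fps_X_fps_compose_startby0 fps_compose_1 fps_const_compose)
  then have "fps_X * (1 + W) ^ (q + 1) = W * (1 + W + fps_const \<sigma>) ^ q * (inverse (1 + W) * (1 + W)) ^ (q + 1)"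
    unfolding JW by (simp only: power_mult_distrib mult_ac)
  also have "inverse (1 + W) * (1 + W) = 1" using W0 by (intro inverse_mult_eq_1) simp
  finally show thesis using W0 that by (simp add: mult.commute)
qed

text \<open>Compare coefficients in \<open>(1 - x) p' = - N p\<close>.\<close>

lemma coeff_one_minus_X_power_rec:
  fixes N k :: nat
  shows "real (k + 1) * coeff ([:1, - 1:] ^ N) (k + 1) = (real k - real N) * coeff ([:1, - 1 :: real:] ^ N) k"
proof -
  define p :: "real poly" where "p = [:1, - 1:] ^ N"
  have p: "[:1, - 1:] * pderiv p = smult (- real N) p"
  proof (cases N)
    case (Suc M)
    have "[:1, - 1 :: real:] * pderiv p = smult (real N) ([:1, - 1:] ^ M * [:1, - 1:]) * pderiv [:1, - 1:]"
      unfolding p_def Suc pderiv_power_Suc by (simp only: mult_smult_left mult_smult_right mult_ac)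
    also have "pderiv [:1, - 1 :: real:] = [:- 1:]" by (simp add: pderiv_pCons)
    also have "[:1, - 1 :: real:] ^ M * [:1, - 1:] = p" by (simp only: p_def Suc power_Suc2)
    finally show ?thesis by simp
  qed (simp add: p_def)
  have "coeff ([:1, - 1:] * pderiv p) k = coeff (pderiv p) k - (case k of 0 \<Rightarrow> 0 | Suc j \<Rightarrow> coeff (pderiv p) j)"
    by (simp add: coeff_pCons split: nat.split)
  then have "real (k + 1) * coeff p (k + 1) - real k * coeff p k = - real N * coeff p k"
    unfolding p by (cases k) (simp_all add: coeff_pderiv)
  then show ?thesis by (simp add: p_def algebra_simps)
qed

lemma one_minus_X_power_eq: "[:1, - 1 :: real:] ^ N = smult ((- 1) ^ N) (root_poly (replicate_mset N 1))"
proof -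
  have "[:1, - 1 :: real:] = smult (- 1) [:- 1, 1:]" by simp
  then have "[:1, - 1 :: real:] ^ N = smult ((- 1) ^ N) ([:- 1, 1:] ^ N)" by (metis smult_power)
  then show ?thesis by (simp add: root_poly_def)
qed

text \<open>Up to a constant, \<open>p m\<close> is the hypergeometric polynomial with upper
  parameters \<open>- N m\<close> and \<open>q\<close> copies of \<open>m + 2\<close>, and
  \<open>q\<close> lower parameters 1. Its zeros stay in \<open>(0, 1]\<close>, so a limit measure
  exists, and \<open>power_sums_tendsto\<close> computes its moments.\<close>

lemma exists_measure_of_series:
  fixes r :: nat
  assumes r: "r \<ge> 1"
    and W0: "W $ 0 = 0" and W: "fps_X * (1 + W) ^ (q + 1) = (1 + W + fps_const (1 / real r)) ^ q * W"
  obtains \<nu> where "compact_nonneg_prob \<nu>" "moment_series \<nu> = W"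
proof -
  \<comment> \<open>Chosen so that the upper parameters \<open>m + 2\<close> are asymptotically
    \<open>N m / r\<close>, whatever \<open>q\<close> is.\<close>
  define N where "N m = r * (m + 1)" for m
  have base: "unit_rooted ([:1, - 1:] ^ N)" for N
    unfolding unit_rooted_def one_minus_X_power_eq by (intro exI[of _ "(- 1) ^ N"] exI[of _ "replicate_mset N 1"]) auto
  have "\<exists>p. unit_rooted p \<and> (\<forall>k. coeff p k = (\<Prod>i=1..m+1. real i + real k) ^ q * coeff ([:1, - 1:] ^ N m) k)" for m
    using unit_rooted_multiplier[OF base, of "m + 1" q "N m"] by metis
  then obtain p where p: "\<And>m. unit_rooted (p m)"
    and coeff_p: "\<And>m k. coeff (p m) k = (\<Prod>i=1..m+1. real i + real k) ^ q * coeff ([:1, - 1:] ^ N m) k" by metis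
  from p obtain c X where c: "\<And>m. c m \<noteq> 0" and pX: "\<And>m. p m = smult (c m) (root_poly (X m))"
    and X: "\<And>m x. x \<in># X m \<Longrightarrow> 0 < x \<and> x \<le> 1"
    unfolding unit_rooted_def by metis
  have "(\<Prod>i=1..m+1. real i + real k) ^ q \<noteq> 0" for m k
    by (intro power_not_zero prod_pos[THEN less_imp_neq, symmetric]) auto
  then have "coeff (p m) k = 0 \<longleftrightarrow> coeff ([:1, - 1 :: real:] ^ N m) k = 0" for m k
    by (simp add: coeff_p)
  then have "degree (p m) = degree ([:1, - 1 :: real:] ^ N m)" for m
    unfolding degree_def by simp
  then have size: "size (X m) = N m" for m
    using c by (simp add: pX degree_root_poly degree_power_eq)
  \<comment> \<open>Telescoping: passing from \<open>k\<close> to \<open>k + 1\<close> replaces the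
    factor \<open>1 + k\<close> by \<open>n + 1 + k\<close>, which produces \<open>A = 1\<close> and
    \<open>B = m + 2\<close> for \<open>n = m + 1\<close>.\<close>
  have prod_shift: "(\<Prod>i=1..n. real i + real (k + 1)) * (1 + real k) = (\<Prod>i=1..n. real i + real k) * (real n + 1 + real k)" for n k
    by (induction n) (simp_all add: algebra_simps)
  have lim: "(\<lambda>m. power_sums (X m) $ k / real (size (X m))) \<longlonglongrightarrow> (1 + W) $ k" for k
  proof (rule power_sums_tendsto[OF pX c _ _ _ _ W0 W, where A = "\<lambda>_. 1" and B = "\<lambda>m _. real m + 2"])
    show "filterlim (\<lambda>m. size (X m)) at_top sequentially"
      unfolding size
    proof (rule filterlim_at_top_mono[OF filterlim_ident])
      show "eventually (\<lambda>m. m \<le> N m) sequentially"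
      proof (intro always_eventually allI)
        show "m \<le> N m" for m using mult_le_mono[OF r, of m "m + 1"] by (simp add: N_def)
      qed
    qed
    show "real (k + 1) * (\<Prod>j=1..q. 1 + real k) * coeff (p m) (k + 1)
        = (real k - real (size (X m))) * (\<Prod>j=1..q. real m + 2 + real k) * coeff (p m) k" for m k
    proof -
      have "real (k + 1) * (\<Prod>j=1..q. 1 + real k) * coeff (p m) (k + 1)
        = ((\<Prod>i=1..m+1. real i + real (k + 1)) * (1 + real k)) ^ q * (real (k + 1) * coeff ([:1, - 1:] ^ N m) (k + 1))"
        by (simp only: coeff_p prod_constant card_atLeastAtMost power_mult_distrib) (simp add: mult_ac)
      also have "\<dots> = ((\<Prod>i=1..m+1. real i + real k) * (real (m + 1) + 1 + real k)) ^ q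
          * ((real k - real (N m)) * coeff ([:1, - 1:] ^ N m) k)"
        by (simp only: prod_shift coeff_one_minus_X_power_rec)
      also have "\<dots> = (real k - real (size (X m))) * (\<Prod>j=1..q. real m + 2 + real k) * coeff (p m) k"
        by (simp only: coeff_p prod_constant card_atLeastAtMost power_mult_distrib size) (simp add: mult_ac add_ac)
      finally show ?thesis .
    qed
    have "(\<lambda>m. (1 / real r) * ((real m + 2) / (real m + 1))) \<longlonglongrightarrow> (1 / real r) * 1"
      by (intro tendsto_intros) real_asymp
    moreover have "real (size (X m)) = real r * (real m + 1)" for m
      by (simp add: size N_def algebra_simps)
    ultimately show "(\<lambda>m. (real m + 2) / real (size (X m))) \<longlonglongrightarrow> 1 / real r" by simp
    have "0 < 1 / real r" using r by simp
    then show "1 / real r \<noteq> - 1" by linarith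
  qed
  have ne: "X m \<noteq> {#}" for m using size[of m] r by (auto simp: N_def)
  obtain \<nu> where \<nu>: "compact_nonneg_prob \<nu>" "\<And>k. (\<integral>x. x ^ k \<partial>\<nu>) = (1 + W) $ k"
    by (rule exists_limit_measure[OF _ ne lim]) (use X in blast)+
  have "moment_series \<nu> = W"
    by (rule fps_ext) (simp add: moment_series_def \<nu>(2) W0)
  with \<nu>(1) show thesis by (rule that)
qed

text \<open>Exponent \<open>q\<close> in the limiting equation means the \<open>q\<close>-th power
  of the S-transform of \<open>\<mu>\<close>, with the same \<open>1 / r\<close> throughout. The
  limit measures \<open>\<nu> q\<close> thus supply every intermediate power.\<close>

lemma free_mult_power_mixture:
  fixes r :: nat
  assumes r: "r \<ge> 1"
  defines "\<mu> \<equiv> mixture (1 / real r) (return borel 1) (deformed_arcsine (real r - 1))"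
  obtains W where "W $ 0 = 0" "fps_X * (1 + W) ^ (r + 1) = (1 + W + fps_const (1 / real r)) ^ r * W"
    "compact_nonneg_prob (free_mult_power \<mu> r)" "moment_series (free_mult_power \<mu> r) = W"
proof -
  have r0: "1 / real r > 0" using r by simp
  have "\<exists>\<nu>. compact_nonneg_prob \<nu> \<and> moment_series \<nu> $ 0 = 0 \<and>
    fps_X * (1 + moment_series \<nu>) ^ (q + 1) = (1 + moment_series \<nu> + fps_const (1 / real r)) ^ q * moment_series \<nu>" for q
    using exists_limit_series[OF r0, of q] exists_measure_of_series[OF r, of _ q] by metis
  then obtain \<nu> where \<nu>: "\<And>q. compact_nonneg_prob (\<nu> q)"
    "\<And>q. fps_X * (1 + moment_series (\<nu> q)) ^ (q + 1) = (1 + moment_series (\<nu> q) + fps_const (1 / real r)) ^ q * moment_series (\<nu> q)"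
    by metis
  define \<rho> where "\<rho> k = (if k = 0 then return borel 1 else \<nu> k)" for k :: nat
  have S: "S_transform \<mu> = (1 + fps_X + fps_const (1 / real r)) * inverse (1 + fps_X)"
    using S_transform_eqI[of \<mu> 1 "1 / real r"] moment_series_mixture[of "real r"] r by (simp add: \<mu>_def numeral_2_eq_2)
  have "compact_nonneg_prob (return borel 1)"
    by (auto simp: compact_nonneg_prob_def AE_return intro!: prob_space_return exI[of _ 1])
  then have "compact_nonneg_prob (\<rho> k)" for k using \<nu>(1) by (simp add: \<rho>_def)
  moreover have "S_transform (\<rho> k) = S_transform \<mu> ^ k" for k
  proof (cases "k = 0")
    case True
    then show ?thesis
      using S_transform_eqI[of "return borel 1" 0 0] moment_series_return by (simp add: \<rho>_def)
  next
    case False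
    then show ?thesis using S_transform_eqI[OF \<nu>(2)[of k]] by (simp add: \<rho>_def S)
  qed
  moreover have "S_transform \<mu> $ 0 \<noteq> 0"
  proof -
    have "0 < 1 + 1 / real r" using r0 by linarith
    then have "1 + 1 / real r \<noteq> 0" by simp
    then show ?thesis by (simp add: S)
  qed
  ultimately have "free_mult_power \<mu> r = \<rho> r"
    by (intro free_mult_power_eqI[where r = r]) (auto simp: \<rho>_def)
  also have "\<dots> = \<nu> r" using r by (simp add: \<rho>_def)
  finally have "free_mult_power \<mu> r = \<nu> r" .
  then show thesis using \<nu>[of r] that[of "moment_series (\<nu> r)"] by simp
qed

section \<open>Coefficients and degree of the polynomials, and the limit theorem\<close>

lemma hcoef_rec:
  assumes "u 0 = - real N" "\<And>j. j \<in> {1..r} \<Longrightarrow> l j > 0"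
  shows "real (k + 1) * (\<Prod>j=1..r. l j + real k) * hcoef r u l (k + 1)
    = (real k - real N) * (\<Prod>j=1..r. u j + real k) * hcoef r u l k"
proof -
  define L L' where "L = (\<Prod>j=1..r. pochhammer (l j) k)" and "L' = (\<Prod>j=1..r. l j + real k)"
  define U U' where "U = (\<Prod>j=1..r. pochhammer (u j) k)" and "U' = (\<Prod>j=1..r. u j + real k)"
  have pos: "L > 0" "L' > 0"
    unfolding L_def L'_def using assms(2) by (auto intro!: prod_pos pochhammer_pos add_pos_nonneg)
  have k: "hcoef r u l k = pochhammer (- real N) k * U / (fact k * L)"
    by (simp only: hcoef_def prod_atMost_split_0 assms(1) L_def U_def)
  have "hcoef r u l (k + 1) = pochhammer (- real N) k * (- real N + real k) * (U * U') / (real (k + 1) * fact k * (L * L'))"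
    by (simp only: hcoef_def prod_atMost_split_0 assms(1) Suc_eq_plus1[symmetric] pochhammer_Suc prod.distrib
        fact_Suc L_def U_def L'_def U'_def mult_ac)
  then show ?thesis
    using pos unfolding k L'_def[symmetric] U'_def[symmetric] by (simp add: divide_simps) (simp add: algebra_simps)
qed

lemma P_poly_degree:
  assumes "\<And>i. i \<in> {1..r} \<Longrightarrow> a i > -1" "\<And>j. j \<in> {1..r} \<Longrightarrow> b j > -1"
  shows "P_poly r a b n \<noteq> 0" "degree (P_poly r a b n) = mi_size r n"
proof -
  define N where "N = mi_size r n"
  have c: "coeff (P_poly r a b n) k = hcoef r (\<lambda>i. if i = 0 then - real N else b i + real (n i) + 1) (\<lambda>i. a i + 1) k" for k
    unfolding P_poly_eq N_def[symmetric] by (rule coeff_hpoly) simp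
  have "pochhammer (- real N) N \<noteq> 0" by (simp add: pochhammer_of_nat_eq_0_iff)
  moreover have "pochhammer (b j + real (n j) + 1) N \<noteq> 0" "pochhammer (a j + 1) N \<noteq> 0" if "j \<in> {1..r}" for j
    using assms(1,2)[OF that] by (auto intro!: pochhammer_pos[THEN less_imp_neq, symmetric])
  ultimately have nz: "coeff (P_poly r a b n) N \<noteq> 0"
    unfolding c by (simp add: hcoef_def prod_atMost_split_0)
  then show "P_poly r a b n \<noteq> 0" by auto
  have "degree (P_poly r a b n) \<le> N" by (rule degree_le) (simp add: c hcoef_eq_0[where N = N])
  then show "degree (P_poly r a b n) = mi_size r n" using nz le_degree N_def by fastforce
qed

theorem theorem2p17:
  fixes r :: nat and a b :: "nat \<Rightarrow> real" and n :: "nat \<Rightarrow> nat \<Rightarrow> nat"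
  assumes "r \<ge> 1"
    and "\<And>i. i \<in> {1..r} \<Longrightarrow> a i > -1"
    and "\<And>j. j \<in> {1..r} \<Longrightarrow> b j > -1"
    and "\<And>i j. i \<in> {1..r} \<Longrightarrow> j \<in> {1..r} \<Longrightarrow> i \<le> j \<Longrightarrow> b j > a i"
    and "\<And>i j. i \<in> {1..r} \<Longrightarrow> j \<in> {1..r} \<Longrightarrow> i > j \<Longrightarrow> b j > a i - 1"
    and "\<And>m. on_step_line r (n m)"
    and "filterlim (\<lambda>m. mi_size r (n m)) at_top sequentially"
  shows "weakly_converges (\<lambda>m. zero_measure (P_poly r a b (n m)))
           (distr (free_mult_power
                     (mixture (1 / real r) (return borel 1) (deformed_arcsine (real r - 1))) r)
              borel complex_of_real)"
proof -
  define P where "P m = P_poly r a b (n m)" for m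
  define \<nu> where "\<nu> = free_mult_power (mixture (1 / real r) (return borel 1) (deformed_arcsine (real r - 1))) r"
  obtain W where W0: "W $ 0 = 0" and W: "fps_X * (1 + W) ^ (r + 1) = (1 + W + fps_const (1 / real r)) ^ r * W"
    and \<nu>: "compact_nonneg_prob \<nu>" and \<nu>W: "moment_series \<nu> = W"
    using free_mult_power_mixture[OF assms(1)] unfolding \<nu>_def by metis
  interpret \<nu>: real_distribution \<nu> by (rule compact_nonneg_probD[OF \<nu>])
  have P0: "P m \<noteq> 0" and deg: "degree (P m) = mi_size r (n m)" for m
    unfolding P_def using P_poly_degree[where a = a and b = b] assms(2,3) by blast+
  have root: "z \<in> \<real> \<and> 0 < Re z" if "poly (map_poly complex_of_real (P m)) z = 0" for m z
    using P_poly_roots[of r a b "n m" z, OF assms(1-6)] that by (simp add: P_def)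
  have "\<exists>X. P m = smult (lead_coeff (P m)) (root_poly X) \<and>
      proots (map_poly complex_of_real (P m)) = image_mset complex_of_real X" for m
    using real_rooted_split[OF P0, of m "\<lambda>x. 0 < x"] root by metis
  then obtain X where PX: "\<And>m. P m = smult (lead_coeff (P m)) (root_poly (X m))"
    and roots: "\<And>m. proots (map_poly complex_of_real (P m)) = image_mset complex_of_real (X m)" by metis
  have lc: "lead_coeff (P m) \<noteq> 0" for m using P0 by simp
  have size: "size (X m) = mi_size r (n m)" for m
    using arg_cong[OF PX[of m], of degree] lc[of m] by (simp add: degree_root_poly deg)
  \<comment> \<open>On the step-line \<open>r n_j\<close> differs from the size by at most
    \<open>r\<close>, so each upper parameter is asymptotically the size divided by
    \<open>r\<close>.\<close>
  have mean_n: "(\<lambda>m. (b j + real (n m j) + 1) / real (size (X m))) \<longlonglongrightarrow> 1 / real r" if j: "j \<in> {1..r}" for j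
  proof -
    define N where "N m = real (mi_size r (n m))" for m
    have Ninf: "filterlim N at_top sequentially"
      unfolding N_def by (rule filterlim_compose[OF filterlim_real_sequentially assms(7)])
    have bd: "\<bar>real r * real (n m j) - N m\<bar> \<le> real r" for m
    proof -
      have "N m + 1 \<le> real r * real (n m j) + real j" "real r * real (n m j) + real j \<le> N m + real r"
        using on_step_line_bounds[OF assms(6)[of m] j] unfolding N_def
        by (metis of_nat_add of_nat_le_iff of_nat_mult of_nat_1)+
      then show ?thesis using j by auto
    qed
    have "(\<lambda>m. (b j + 1 + (real (n m j) - N m / real r)) / N m) \<longlonglongrightarrow> 0"
    proof (rule Lim_null_comparison)
      show "eventually (\<lambda>m. norm ((b j + 1 + (real (n m j) - N m / real r)) / N m) \<le> (\<bar>b j + 1\<bar> + 1) / N m) sequentially"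
        using eventually_gt_at_top[of 0, THEN Ninf[unfolded filterlim_iff, rule_format]]
      proof eventually_elim
        case (elim m)
        have "real (n m j) - N m / real r = (real r * real (n m j) - N m) / real r"
          using assms(1) by (simp add: field_simps)
        then have "\<bar>real (n m j) - N m / real r\<bar> \<le> 1" using bd[of m] assms(1) by (simp add: abs_divide)
        then have "\<bar>b j + 1 + (real (n m j) - N m / real r)\<bar> \<le> \<bar>b j + 1\<bar> + 1" by linarith
        then show ?case using elim by (simp add: divide_right_mono)
      qed
      show "(\<lambda>m. (\<bar>b j + 1\<bar> + 1) / N m) \<longlonglongrightarrow> 0"
        by (intro tendsto_divide_0[OF tendsto_const] filterlim_at_top_imp_at_infinity Ninf)
    qed
    then have "(\<lambda>m. 1 / real r + (b j + 1 + (real (n m j) - N m / real r)) / N m) \<longlonglongrightarrow> 1 / real r + 0"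
      by (intro tendsto_intros)
    then have "(\<lambda>m. 1 / real r + (b j + 1 + (real (n m j) - N m / real r)) / N m) \<longlonglongrightarrow> 1 / real r" by simp
    then show ?thesis
    proof (rule Lim_transform_eventually)
      show "eventually (\<lambda>m. 1 / real r + (b j + 1 + (real (n m j) - N m / real r)) / N m = (b j + real (n m j) + 1) / real (size (X m))) sequentially"
        using eventually_gt_at_top[of 0, THEN Ninf[unfolded filterlim_iff, rule_format]]
      proof eventually_elim
        case (elim m)
        then have "N m * (1 / real r) / N m = 1 / real r" by simp
        then show ?case unfolding size N_def[symmetric] by (simp add: add_divide_distrib diff_divide_distrib)
      qed
    qed
  qed
  have rec: "real (k + 1) * (\<Prod>j=1..r. (a j + 1) + real k) * coeff (P m) (k + 1)
      = (real k - real (size (X m))) * (\<Prod>j=1..r. (b j + real (n m j) + 1) + real k) * coeff (P m) k" for m k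
  proof -
    define u where "u i = (if i = 0 then - real (mi_size r (n m)) else b i + real (n m i) + 1)" for i
    have "coeff (P m) k = hcoef r u (\<lambda>i. a i + 1) k" for k
      unfolding P_def P_poly_eq u_def[symmetric] by (rule coeff_hpoly) (simp add: u_def)
    moreover have "(\<Prod>j=1..r. u j + real k) = (\<Prod>j=1..r. (b j + real (n m j) + 1) + real k)"
      by (intro prod.cong) (auto simp: u_def)
    moreover have "0 < a j + 1" if "j \<in> {1..r}" for j using assms(2)[OF that] by simp
    ultimately show ?thesis
      using hcoef_rec[of u "mi_size r (n m)" r "\<lambda>i. a i + 1" k] unfolding size by (simp add: u_def)
  qed
  have "0 < 1 / real r" using assms(1) by simp
  then have \<sigma>: "1 / real r \<noteq> - 1" by linarith
  have lim: "(\<lambda>m. power_sums (X m) $ k / real (size (X m))) \<longlonglongrightarrow> (1 + W) $ k" for k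
    by (rule power_sums_tendsto[OF PX lc _ rec mean_n \<sigma> W0 W]) (simp_all add: size assms(7))
  \<comment> \<open>Constant polynomials have no zeros and no empirical measure. The stand-in makes
    all moments exist for every \<open>m\<close> and changes only finitely many terms.\<close>
  define Y where "Y m = (if X m = {#} then {#1#} else X m)" for m
  have Yne: "Y m \<noteq> {#}" for m by (simp add: Y_def)
  have "eventually (\<lambda>m. size (X m) > 0) sequentially"
    using assms(7) eventually_gt_at_top[of 0] unfolding size by (auto simp: filterlim_iff)
  then have YX: "eventually (\<lambda>m. X m \<noteq> {#} \<and> Y m = X m) sequentially"
    by eventually_elim (auto simp: Y_def)
  have moments: "(\<lambda>m. \<integral>x. x ^ k \<partial>empirical (Y m)) \<longlonglongrightarrow> (\<integral>x. x ^ k \<partial>\<nu>)" for k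
  proof -
    have "(\<integral>x. x ^ k \<partial>\<nu>) = (1 + W) $ k"
      unfolding \<nu>W[symmetric] using \<nu>.prob_space[unfolded \<nu>.space_eq_univ] by (simp add: moment_series_def)
    moreover have "eventually (\<lambda>m. power_sums (X m) $ k / real (size (X m)) = (\<integral>x. x ^ k \<partial>empirical (Y m))) sequentially"
      using YX by eventually_elim (simp add: empirical_moment)
    ultimately show ?thesis using Lim_transform_eventually[OF lim] by simp
  qed
  show ?thesis
    unfolding weakly_converges_def P_def[symmetric] \<nu>_def[symmetric]
  proof (intro allI impI)
    fix f :: "complex \<Rightarrow> real" assume f: "continuous_on UNIV f \<and> bounded (range f)"
    then have fm: "f \<in> borel_measurable borel" by (intro borel_measurable_continuous_onI) auto
    \<comment> \<open>All zeros are real, so a test function on the plane matters only through its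
      restriction to the real line.\<close>
    define g where "g x = f (complex_of_real x)" for x
    have g: "continuous_on UNIV g"
      unfolding g_def by (rule continuous_on_compose2[OF conjunct1[OF f] continuous_on_of_real[OF continuous_on_id]]) simp
    have "bounded (range g)" by (rule bounded_subset[of "range f"]) (use f in \<open>auto simp: g_def\<close>)
    then have conv: "(\<lambda>m. \<integral>x. g x \<partial>empirical (Y m)) \<longlonglongrightarrow> (\<integral>x. g x \<partial>\<nu>)"
      by (intro moments_imp_weak_convergence[OF empirical_real_distribution _ \<nu> moments g] empirical_integrable Yne) auto
    have int: "(\<integral>x. f x \<partial>distr \<nu> borel complex_of_real) = (\<integral>x. g x \<partial>\<nu>)"
      unfolding g_def by (rule integral_distr[OF _ fm]) simp
    have "eventually (\<lambda>m. (\<integral>x. g x \<partial>empirical (Y m)) = (\<integral>x. f x \<partial>zero_measure (P m))) sequentially"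
      using YX
    proof eventually_elim
      case (elim m)
      have "(\<integral>x. f x \<partial>zero_measure (P m)) = (\<Sum>x\<in>#image_mset complex_of_real (X m). f x) / real (size (X m))"
        unfolding zero_measure_def roots using fm elim
        by (simp add: integral_distr integral_pmf_of_multiset)
      also have "\<dots> = (\<integral>x. g x \<partial>empirical (Y m))"
        using elim g by (simp add: empirical_integral borel_measurable_continuous_onI multiset.map_comp comp_def g_def)
      finally show ?case ..
    qed
    with conv show "(\<lambda>m. \<integral>x. f x \<partial>zero_measure (P m)) \<longlonglongrightarrow> (\<integral>x. f x \<partial>distr \<nu> borel complex_of_real)"
      unfolding int by (rule Lim_transform_eventually)
  qed
qed

end
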